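(* Let $\mathcal{M}\models\mathrm{KP}^{\mathcal{P}}+\Sigma_1^{\mathcal{P}}\text{-Separation}$ be countable and non-standard. Let $\mathcal{S}$ be a rank-initial topless substructure of $\mathcal{M}$. Then there is a proper (i.e. non-surjective) topless rank-initial self-embedding $i:\mathcal{M}\to\mathcal{M}$ fixing $\mathcal{S}$ pointwise, such that \[\forall\alpha\in\mathrm{Ord}^{\mathcal{M}}\setminus\mathcal{S}\,.\,\exists m\in\mathcal{M}\,.\,(\mathrm{rank}^{\mathcal{M}}(m)=\alpha\wedge i(m)\neq m).\]
   Context: Theories. The language is $\{\in\}$. Quantifiers of the forms $\exists x\in y$, $\forall x\in y$, $\exists x\subseteq y$, $\forall x\subseteq y$ count as bounded. $\Delta_0^{\mathcal{P}}=\Sigma_0^{\mathcal{P}}=\Pi_0^{\mathcal{P}}$ is the set of formulae all of whose quantifiers are bounded in this sense; $\Sigma_{n+1}^{\mathcal{P}}$ consists of the formulae $\exists x\,.\,\phi$ with $\phi\in\Pi_n^{\mathcal{P}}$, and $\Pi_{n+1}^{\mathcal{P}}$ of the $\forall x\,.\,\phi$ with $\phi\in\Sigma_n^{\mathcal{P}}$ (all up to provable equivalence in the background theory). $\mathrm{KP}^{\mathcal{P}}$ is axiomatized by Extensionality, Pair, Union, Powerset, Infinity, $\Delta_0^{\mathcal{P}}$-Separation, $\Delta_0^{\mathcal{P}}$-Collection ($\forall u\in x\exists v\,\phi(u,v)\to\exists y\forall u\in x\exists v\in y\,\phi(u,v)$) and $\Pi_1^{\mathcal{P}}$-Foundation ($\exists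 x\,\phi(x)\to\exists y(\phi(y)\wedge\forall v\in y\,\neg\phi(v))$). It proves that each set has an ordinal rank. Models. A model is non-standard if its membership relation is not well-founded. An embedding is an injection preserving and reflecting $\in$. An embedding $i:\mathcal{M}\to\mathcal{N}$ is rank-initial if every $n\in\mathcal{N}$ with $\mathrm{rank}^{\mathcal{N}}(n)\le\mathrm{rank}^{\mathcal{N}}(i(m))$ for some $m\in\mathcal{M}$ lies in $i(\mathcal{M})$; it is topless if all elements of $i(\mathcal{M})$ have $\mathcal{N}$-rank below some fixed $\alpha\in\mathrm{Ord}^{\mathcal{N}}$ and $\mathrm{Ord}^{\mathcal{N}}\setminus i(\mathcal{M})$ has no least element. A substructure is rank-initial/topless if its inclusion map is. *)

theory Defs
  imports Main "HOL-Library.Countable_Set"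
begin

record 'a set_structure =
  univ :: "'a set"
  mem :: "'a \<Rightarrow> 'a \<Rightarrow> bool"

text \<open>
  Variables are named by natural numbers. The bounded quantifiers \<open>\<exists>x\<in>y\<close> (\<open>ExMem x y\<close>) and
  \<open>\<exists>x\<subseteq>y\<close> (\<open>ExSub x y\<close>) are constructors, so that boundedness is visible in the syntax;
  \<open>sat\<close> gives them the meaning of the formulae of the language of \<open>\<in>\<close> which they abbreviate.
  The universal quantifiers and remaining connectives are obtained by negation.
\<close>

datatype fm =
    Mem nat nat
  | Eq nat nat
  | Neg fm
  | Conj fm fm
  | Ex nat fm
  | ExMem nat nat fm
  | ExSub nat nat fm

abbreviation All :: "nat \<Rightarrow> fm \<Rightarrow> fm" where
  "All x \<phi> \<equiv> Neg (Ex x (Neg \<phi>))"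

definition subset_in :: "('a, 'b) set_structure_scheme \<Rightarrow> 'a \<Rightarrow> 'a \<Rightarrow> bool" where
  "subset_in M x y \<longleftrightarrow> (\<forall>z\<in>univ M. mem M z x \<longrightarrow> mem M z y)"

primrec sat :: "('a, 'b) set_structure_scheme \<Rightarrow> (nat \<Rightarrow> 'a) \<Rightarrow> fm \<Rightarrow> bool" where
  "sat M v (Mem x y) \<longleftrightarrow> mem M (v x) (v y)"
| "sat M v (Eq x y) \<longleftrightarrow> v x = v y"
| "sat M v (Neg \<phi>) \<longleftrightarrow> \<not> sat M v \<phi>"
| "sat M v (Conj \<phi> \<psi>) \<longleftrightarrow> sat M v \<phi> \<and> sat M v \<psi>"
| "sat M v (Ex x \<phi>) \<longleftrightarrow> (\<exists>a\<in>univ M. sat M (v(x := a)) \<phi>)"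
| "sat M v (ExMem x y \<phi>) \<longleftrightarrow> (\<exists>a\<in>univ M. mem M a (v y) \<and> sat M (v(x := a)) \<phi>)"
| "sat M v (ExSub x y \<phi>) \<longleftrightarrow> (\<exists>a\<in>univ M. subset_in M a (v y) \<and> sat M (v(x := a)) \<phi>)"

primrec all_bounded :: "fm \<Rightarrow> bool" where
  "all_bounded (Mem x y) \<longleftrightarrow> True"
| "all_bounded (Eq x y) \<longleftrightarrow> True"
| "all_bounded (Neg \<phi>) \<longleftrightarrow> all_bounded \<phi>"
| "all_bounded (Conj \<phi> \<psi>) \<longleftrightarrow> all_bounded \<phi> \<and> all_bounded \<psi>"
| "all_bounded (Ex x \<phi>) \<longleftrightarrow> False"
| "all_bounded (ExMem x y \<phi>) \<longleftrightarrow> all_bounded \<phi>"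
| "all_bounded (ExSub x y \<phi>) \<longleftrightarrow> all_bounded \<phi>"

definition Delta0_P :: "fm set" where
  "Delta0_P = {\<phi>. all_bounded \<phi>}"

text \<open>
  These classes are not closed under provable equivalence. As they are only used for axiom
  schemes, closing them under equivalence provable in the theory would not change its models.
\<close>

fun Sigma_P :: "nat \<Rightarrow> fm set" and Pi_P :: "nat \<Rightarrow> fm set" where
  "Sigma_P 0 = Delta0_P"
| "Pi_P 0 = Delta0_P"
| "Sigma_P (Suc n) = {Ex x \<phi> | x \<phi>. \<phi> \<in> Pi_P n}"
| "Pi_P (Suc n) = {All x \<phi> | x \<phi>. \<phi> \<in> Sigma_P n}"


text \<open>
  Truth of the axioms in \<open>M\<close>. In the schemes the assignment \<open>v\<close> supplies the parameters, and
  \<open>a\<close>, \<open>b\<close> are the distinguished variables of \<open>\<phi>\<close>.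
\<close>

definition assignment :: "('a, 'b) set_structure_scheme \<Rightarrow> (nat \<Rightarrow> 'a) \<Rightarrow> bool" where
  "assignment M v \<longleftrightarrow> range v \<subseteq> univ M"

definition extensionality :: "('a, 'b) set_structure_scheme \<Rightarrow> bool" where
  "extensionality M \<longleftrightarrow>
    (\<forall>x\<in>univ M. \<forall>y\<in>univ M. (\<forall>z\<in>univ M. mem M z x \<longleftrightarrow> mem M z y) \<longrightarrow> x = y)"

definition is_upair :: "('a, 'b) set_structure_scheme \<Rightarrow> 'a \<Rightarrow> 'a \<Rightarrow> 'a \<Rightarrow> bool" where
  "is_upair M x y p \<longleftrightarrow> (\<forall>z\<in>univ M. mem M z p \<longleftrightarrow> z = x \<or> z = y)"

definition pairing :: "('a, 'b) set_structure_scheme \<Rightarrow> bool" where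
  "pairing M \<longleftrightarrow> (\<forall>x\<in>univ M. \<forall>y\<in>univ M. \<exists>p\<in>univ M. is_upair M x y p)"

definition union_axiom :: "('a, 'b) set_structure_scheme \<Rightarrow> bool" where
  "union_axiom M \<longleftrightarrow>
    (\<forall>x\<in>univ M. \<exists>u\<in>univ M. \<forall>z\<in>univ M. mem M z u \<longleftrightarrow> (\<exists>y\<in>univ M. mem M y x \<and> mem M z y))"

definition powerset :: "('a, 'b) set_structure_scheme \<Rightarrow> bool" where
  "powerset M \<longleftrightarrow>
    (\<forall>x\<in>univ M. \<exists>p\<in>univ M. \<forall>z\<in>univ M. mem M z p \<longleftrightarrow> subset_in M z x)"

definition infinity :: "('a, 'b) set_structure_scheme \<Rightarrow> bool" where
  "infinity M \<longleftrightarrow>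
    (\<exists>w\<in>univ M.
      (\<exists>e\<in>univ M. mem M e w \<and> (\<forall>z\<in>univ M. \<not> mem M z e)) \<and>
      (\<forall>x\<in>univ M. mem M x w \<longrightarrow>
        (\<exists>s\<in>univ M. mem M s w \<and> (\<forall>z\<in>univ M. mem M z s \<longleftrightarrow> mem M z x \<or> z = x))))"

definition separation :: "('a, 'b) set_structure_scheme \<Rightarrow> fm set \<Rightarrow> bool" where
  "separation M \<Gamma> \<longleftrightarrow>
    (\<forall>\<phi>\<in>\<Gamma>. \<forall>v a. assignment M v \<longrightarrow>
      (\<forall>x\<in>univ M. \<exists>y\<in>univ M. \<forall>u\<in>univ M.
        mem M u y \<longleftrightarrow> mem M u x \<and> sat M (v(a := u)) \<phi>))"

definition collection :: "('a, 'b) set_structure_scheme \<Rightarrow> fm set \<Rightarrow> bool" where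
  "collection M \<Gamma> \<longleftrightarrow>
    (\<forall>\<phi>\<in>\<Gamma>. \<forall>v a b. assignment M v \<longrightarrow> a \<noteq> b \<longrightarrow>
      (\<forall>x\<in>univ M.
        (\<forall>u\<in>univ M. mem M u x \<longrightarrow> (\<exists>w\<in>univ M. sat M (v(a := u, b := w)) \<phi>)) \<longrightarrow>
        (\<exists>y\<in>univ M. \<forall>u\<in>univ M. mem M u x \<longrightarrow>
          (\<exists>w\<in>univ M. mem M w y \<and> sat M (v(a := u, b := w)) \<phi>))))"

definition foundation :: "('a, 'b) set_structure_scheme \<Rightarrow> fm set \<Rightarrow> bool" where
  "foundation M \<Gamma> \<longleftrightarrow>
    (\<forall>\<phi>\<in>\<Gamma>. \<forall>v a. assignment M v \<longrightarrow>
      (\<exists>x\<in>univ M. sat M (v(a := x)) \<phi>) \<longrightarrow>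
      (\<exists>y\<in>univ M. sat M (v(a := y)) \<phi> \<and>
        (\<forall>u\<in>univ M. mem M u y \<longrightarrow> \<not> sat M (v(a := u)) \<phi>)))"

definition models_KP_P :: "('a, 'b) set_structure_scheme \<Rightarrow> bool" where
  "models_KP_P M \<longleftrightarrow>
    extensionality M \<and> pairing M \<and> union_axiom M \<and> powerset M \<and> infinity M \<and>
    separation M Delta0_P \<and> collection M Delta0_P \<and> foundation M (Pi_P 1)"

definition nonstandard :: "('a, 'b) set_structure_scheme \<Rightarrow> bool" where
  "nonstandard M \<longleftrightarrow> \<not> wf {(x, y). x \<in> univ M \<and> y \<in> univ M \<and> mem M x y}"


definition transitive_in :: "('a, 'b) set_structure_scheme \<Rightarrow> 'a \<Rightarrow> bool" where
  "transitive_in M x \<longleftrightarrow> (\<forall>y\<in>univ M. mem M y x \<longrightarrow> subset_in M y x)"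

text \<open>Well-foundedness need not be demanded, by Foundation in \<open>M\<close>.\<close>

definition Ord :: "('a, 'b) set_structure_scheme \<Rightarrow> 'a set" where
  "Ord M = {x \<in> univ M. transitive_in M x \<and> (\<forall>y\<in>univ M. mem M y x \<longrightarrow> transitive_in M y)}"

definition ord_le :: "('a, 'b) set_structure_scheme \<Rightarrow> 'a \<Rightarrow> 'a \<Rightarrow> bool" where
  "ord_le M \<alpha> \<beta> \<longleftrightarrow> mem M \<alpha> \<beta> \<or> \<alpha> = \<beta>"

text \<open>Kuratowski pairs, as computed in \<open>M\<close>.\<close>

definition is_pair :: "('a, 'b) set_structure_scheme \<Rightarrow> 'a \<Rightarrow> 'a \<Rightarrow> 'a \<Rightarrow> bool" where
  "is_pair M x y p \<longleftrightarrow>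
    (\<exists>s\<in>univ M. \<exists>t\<in>univ M. is_upair M x x s \<and> is_upair M x y t \<and> is_upair M s t p)"

definition maps_to :: "('a, 'b) set_structure_scheme \<Rightarrow> 'a \<Rightarrow> 'a \<Rightarrow> 'a \<Rightarrow> bool" where
  "maps_to M f x y \<longleftrightarrow> (\<exists>p\<in>univ M. is_pair M x y p \<and> mem M p f)"

definition is_function :: "('a, 'b) set_structure_scheme \<Rightarrow> 'a \<Rightarrow> bool" where
  "is_function M f \<longleftrightarrow>
    (\<forall>p\<in>univ M. mem M p f \<longrightarrow> (\<exists>x\<in>univ M. \<exists>y\<in>univ M. is_pair M x y p)) \<and>
    (\<forall>x\<in>univ M. \<forall>y\<in>univ M. \<forall>z\<in>univ M. maps_to M f x y \<longrightarrow> maps_to M f x z \<longrightarrow> y = z)"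

text \<open>
  In \<open>M\<close>, \<open>f\<close> is a function with transitive domain which satisfies the recursion
  \<open>f(x) = sup {f(u) + 1 | u \<in> x} = \<Union> {f(u) \<union> {f(u)} | u \<in> x}\<close>.
  As \<open>M\<close> may be ill-founded, \<open>f\<close> has to be an element of \<open>M\<close>, not an external function.
\<close>

definition is_rank_function :: "('a, 'b) set_structure_scheme \<Rightarrow> 'a \<Rightarrow> bool" where
  "is_rank_function M f \<longleftrightarrow>
    is_function M f \<and>
    (\<forall>x\<in>univ M. \<forall>y\<in>univ M. maps_to M f x y \<longrightarrow>
      (\<forall>u\<in>univ M. mem M u x \<longrightarrow> (\<exists>w\<in>univ M. maps_to M f u w)) \<and>
      (\<forall>z\<in>univ M. mem M z y \<longleftrightarrow>
        (\<exists>u\<in>univ M. mem M u x \<and> (\<exists>w\<in>univ M. maps_to M f u w \<and> (mem M z w \<or> z = w)))))"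

definition rank :: "('a, 'b) set_structure_scheme \<Rightarrow> 'a \<Rightarrow> 'a" where
  "rank M x = (THE \<alpha>. \<alpha> \<in> univ M \<and> (\<exists>f\<in>univ M. is_rank_function M f \<and> maps_to M f x \<alpha>))"


definition embedding ::
  "('a, 'c) set_structure_scheme \<Rightarrow> ('b, 'd) set_structure_scheme \<Rightarrow> ('a \<Rightarrow> 'b) \<Rightarrow> bool" where
  "embedding M N i \<longleftrightarrow>
    i ` univ M \<subseteq> univ N \<and> inj_on i (univ M) \<and>
    (\<forall>x\<in>univ M. \<forall>y\<in>univ M. mem N (i x) (i y) \<longleftrightarrow> mem M x y)"

definition rank_initial ::
  "('a, 'c) set_structure_scheme \<Rightarrow> ('b, 'd) set_structure_scheme \<Rightarrow> ('a \<Rightarrow> 'b) \<Rightarrow> bool" where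
  "rank_initial M N i \<longleftrightarrow>
    (\<forall>n\<in>univ N. (\<exists>m\<in>univ M. ord_le N (rank N n) (rank N (i m))) \<longrightarrow> n \<in> i ` univ M)"

definition topless ::
  "('a, 'c) set_structure_scheme \<Rightarrow> ('b, 'd) set_structure_scheme \<Rightarrow> ('a \<Rightarrow> 'b) \<Rightarrow> bool" where
  "topless M N i \<longleftrightarrow>
    (\<exists>\<alpha>\<in>Ord N. \<forall>m\<in>univ M. mem N (rank N (i m)) \<alpha>) \<and>
    \<not> (\<exists>\<beta> \<in> Ord N - i ` univ M. \<forall>\<gamma> \<in> Ord N - i ` univ M. ord_le N \<beta> \<gamma>)"

definition substructure ::
  "('a, 'b) set_structure_scheme \<Rightarrow> ('a, 'c) set_structure_scheme \<Rightarrow> bool" where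
  "substructure S M \<longleftrightarrow> univ S \<subseteq> univ M \<and> (\<forall>x\<in>univ S. \<forall>y\<in>univ S. mem S x y \<longleftrightarrow> mem M x y)"

end

theory Submission
  imports Defs
begin

text \<open>
  The embedding \<open>i\<close> is the union of an increasing sequence of finite partial maps \<open>m\<^sub>k \<mapsto> n\<^sub>k\<close>,
  built by going back and forth in an enumeration of the countable model \<open>M\<close>. Such a
  construction needs an invariant that survives the adjunction of an arbitrary \<open>m\<close> (so that \<open>i\<close>
  is total) and of an arbitrary \<open>n\<close> whose rank is below that of some element of the range (so
  that \<open>i\<close> is rank-initial). For models of set theory the usual choice is that every \<open>\<Sigma>\<^sub>1\<close>
  statement about the \<open>m\<^sub>k\<close>, with parameters in \<open>S\<close>, holds of the \<open>n\<^sub>k\<close> with a witness of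
  bounded rank. Working with it inside \<open>M\<close> takes a satisfaction predicate for \<open>\<Delta>\<^sub>0\<close> formulas.

  Here satisfaction is replaced by a small infinitary language whose formulas are elements of
  \<open>M\<close>. An atomic formula says that one named element is, or is not, a member of another, or that
  a named element is the constant \<open>c\<close>. For a set \<open>X\<close> of formulas there are the formulas \<open>\<exists>y. \<And>X\<close>
  and \<open>\<forall>y. \<Or>X\<close>, the latter with \<open>y\<close> restricted to small rank. This suffices for the two steps: a
  type \<open>X\<close> to be realized becomes the formula \<open>\<exists>y. \<And>X\<close>, and a set \<open>X\<close> of formulas that must fail
  becomes \<open>\<forall>y. \<Or>X\<close>. Truth (\<open>holds\<close>) is \<open>\<Sigma>\<^sub>1\<close>, being the existence of a set of claims that
  justify each other. Truth with such a set contained in \<open>B\<close> (\<open>holds_in B\<close>) is \<open>\<Delta>\<^sub>1\<close>. The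
  invariant \<open>approx ps B \<theta>\<close> says, for an ordinal \<open>\<theta>\<close> outside \<open>S\<close>, that each formula of rank
  below \<open>\<theta>\<close> which holds of the \<open>m\<^sub>k\<close> holds in \<open>B\<close> of the \<open>n\<^sub>k\<close>. Each step lowers \<open>\<theta>\<close> a little,
  to make room for the code of one more quantifier. This can go on forever because the ordinals
  outside \<open>S\<close> have no least element. \<open>\<Sigma>\<^sub>1\<close>-Separation turns types into sets, and Collection
  provides the bounds.

  The properties of \<open>i\<close> come from the following sources.
  \<^item> \<open>i\<close> fixes \<open>S\<close> since every element of \<open>S\<close> may occur as a constant in the formulas.
  \<^item> \<open>i\<close> moves an element of each rank \<open>\<alpha>\<close> outside \<open>S\<close> by Cantor's theorem: there are more sets
    of rank \<open>\<alpha>\<close> than types over a level below \<open>\<alpha>\<close>, so two of them, \<open>m\<close> and \<open>m'\<close>, have the same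
    type (\<open>same_type_ex\<close>). An image found for one of them serves for both, and it is different
    from at least one.
  \<^item> The range is bounded, hence proper, because \<open>holds_in B\<close> bounds ranks by the rank of \<open>B\<close>.
  \<^item> \<open>i\<close> is topless because the stage for an ordinal \<open>\<nu>\<close> takes a bound of rank below \<open>\<nu>\<close> if it
    can. If \<open>\<nu>\<close> were the least ordinal outside the range, then \<open>i\<close> would transport the truth of
    formulas in \<open>S\<close> to truth below \<open>\<nu>\<close>, and an overspill argument would yield a bound of rank
    less than \<open>\<nu>\<close> for the stage at which \<open>\<nu>\<close> was considered (\<open>proper_topless_self_embedding\<close>).

  To keep definability proofs short, the classes of \<open>\<Delta>\<^sub>0\<close>, \<open>\<Sigma>\<^sub>1\<close> and \<open>\<Delta>\<^sub>1\<close> formulas (always in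
  the sense that quantifiers over subsets count as bounded) are replaced by the classes of
  relations which they define, and these are shown to be closed under the usual operations and
  under substitution of total \<open>\<Sigma>\<^sub>1\<close> functions.
\<close>

section \<open>Renaming of variables\<close>

primrec vars :: "fm \<Rightarrow> nat set" where
  "vars (Mem x y) = {x, y}"
| "vars (Eq x y) = {x, y}"
| "vars (Neg \<phi>) = vars \<phi>"
| "vars (Conj \<phi> \<psi>) = vars \<phi> \<union> vars \<psi>"
| "vars (Ex x \<phi>) = insert x (vars \<phi>)"
| "vars (ExMem x y \<phi>) = {x, y} \<union> vars \<phi>"
| "vars (ExSub x y \<phi>) = {x, y} \<union> vars \<phi>"

lemma finite_vars: "finite (vars \<phi>)"
  by (induction \<phi>) auto

lemma sat_cong: "(\<And>x. x \<in> vars \<phi> \<Longrightarrow> v x = w x) \<Longrightarrow> sat M v \<phi> = sat M w \<phi>"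
proof (induction \<phi> arbitrary: v w)
  case (Ex x \<phi>)
  then have "sat M (v(x := a)) \<phi> = sat M (w(x := a)) \<phi>" for a
    by (intro Ex.IH) auto
  then show ?case by simp
next
  case (ExMem x y \<phi>)
  then have "sat M (v(x := a)) \<phi> = sat M (w(x := a)) \<phi>" for a
    by (intro ExMem.IH) auto
  with ExMem.prems show ?case by simp
next
  case (ExSub x y \<phi>)
  then have "sat M (v(x := a)) \<phi> = sat M (w(x := a)) \<phi>" for a
    by (intro ExSub.IH) auto
  with ExSub.prems show ?case by simp
next
  case (Conj \<phi> \<psi>)
  have "sat M v \<phi> = sat M w \<phi>" "sat M v \<psi> = sat M w \<psi>"
    using Conj.prems by (auto intro!: Conj.IH)
  then show ?case by simp
next
  case (Neg \<phi>)
  have "sat M v \<phi> = sat M w \<phi>" using Neg.prems by (auto intro!: Neg.IH)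
  then show ?case by simp
qed simp_all

lemma ex_fresh_var:
  fixes f :: "nat \<Rightarrow> nat"
  shows "\<exists>N. \<forall>x\<in>vars \<phi>. f x \<noteq> N"
  using ex_new_if_finite[OF infinite_UNIV_nat finite_imageI[OF finite_vars], of f \<phi>] by (metis imageI)

text \<open>
  Renaming is stated without a renaming function on formulas: \<open>f\<close> need not be injective, so
  bound variables may have to be replaced by fresh ones to avoid capture.
\<close>

lemma sat_rename:
  "\<exists>\<psi>. (all_bounded \<phi> \<longrightarrow> all_bounded \<psi>) \<and> (\<forall>v. sat M v \<psi> = sat M (\<lambda>n. v (f n)) \<phi>)"
proof (induction \<phi> arbitrary: f)
  case (Mem x y)
  show ?case by (rule exI[of _ "Mem (f x) (f y)"]) simp
next
  case (Eq x y)
  show ?case by (rule exI[of _ "Eq (f x) (f y)"]) simp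
next
  case (Neg \<phi>)
  then obtain \<psi> where "(all_bounded \<phi> \<longrightarrow> all_bounded \<psi>) \<and> (\<forall>v. sat M v \<psi> = sat M (\<lambda>n. v (f n)) \<phi>)"
    by blast
  then show ?case by (intro exI[of _ "Neg \<psi>"]) simp
next
  case (Conj \<phi> \<phi>')
  obtain \<psi> where \<psi>: "(all_bounded \<phi> \<longrightarrow> all_bounded \<psi>) \<and> (\<forall>v. sat M v \<psi> = sat M (\<lambda>n. v (f n)) \<phi>)"
    using Conj.IH(1)[of f] by blast
  obtain \<psi>' where "(all_bounded \<phi>' \<longrightarrow> all_bounded \<psi>') \<and> (\<forall>v. sat M v \<psi>' = sat M (\<lambda>n. v (f n)) \<phi>')"
    using Conj.IH(2)[of f] by blast
  with \<psi> show ?case by (intro exI[of _ "Conj \<psi> \<psi>'"]) simp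
next
  case (Ex x \<phi>)
  obtain N where N: "\<forall>y\<in>vars \<phi>. f y \<noteq> N" using ex_fresh_var by blast
  obtain \<psi> where \<psi>: "\<forall>v. sat M v \<psi> = sat M (\<lambda>n. v ((f(x := N)) n)) \<phi>" using Ex by meson
  have "sat M (v(N := a)) \<psi> = sat M ((\<lambda>n. v (f n))(x := a)) \<phi>" for v a
    unfolding \<psi>[rule_format] by (rule sat_cong) (use N in auto)
  then show ?case by (intro exI[of _ "Ex N \<psi>"]) simp
next
  case (ExMem x y \<phi>)
  obtain N where N: "\<forall>y\<in>vars \<phi>. f y \<noteq> N" using ex_fresh_var by blast
  obtain \<psi> where \<psi>: "all_bounded \<phi> \<longrightarrow> all_bounded \<psi>"
    "\<forall>v. sat M v \<psi> = sat M (\<lambda>n. v ((f(x := N)) n)) \<phi>" using ExMem by meson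
  have "sat M (v(N := a)) \<psi> = sat M ((\<lambda>n. v (f n))(x := a)) \<phi>" for v a
    unfolding \<psi>(2)[rule_format] by (rule sat_cong) (use N in auto)
  with \<psi>(1) show ?case by (intro exI[of _ "ExMem N (f y) \<psi>"]) simp
next
  case (ExSub x y \<phi>)
  obtain N where N: "\<forall>y\<in>vars \<phi>. f y \<noteq> N" using ex_fresh_var by blast
  obtain \<psi> where \<psi>: "all_bounded \<phi> \<longrightarrow> all_bounded \<psi>"
    "\<forall>v. sat M v \<psi> = sat M (\<lambda>n. v ((f(x := N)) n)) \<phi>" using ExSub by meson
  have "sat M (v(N := a)) \<psi> = sat M ((\<lambda>n. v (f n))(x := a)) \<phi>" for v a
    unfolding \<psi>(2)[rule_format] by (rule sat_cong) (use N in auto)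
  with \<psi>(1) show ?case by (intro exI[of _ "ExSub N (f y) \<psi>"]) simp
qed

section \<open>Definable relations\<close>

text \<open>
  A relation of arbitrary arity is a predicate on environments \<open>e\<close>. Quantifiers bind the
  variable \<open>0\<close> and shift the others, so that \<open>a ## e\<close> is the environment under a quantifier.
\<close>

abbreviation scons :: "'a \<Rightarrow> (nat \<Rightarrow> 'a) \<Rightarrow> nat \<Rightarrow> 'a" (infixr "##" 65) where
  "a ## e \<equiv> case_nat a e"

lemma scons_upd [simp]: "(a ## e)(0 := b) = b ## e" "(a ## e)(Suc n := b) = a ## e(n := b)"
  by (rule ext, simp split: nat.split)+

lemma scons_eta [simp]: "e 0 ## (\<lambda>n. e (Suc n)) = e"
  by (rule ext) (simp split: nat.split)

text \<open>
  Witnesses of two quantifiers can be found in a common set \<open>c\<close>. The renaming \<open>skip2\<close> makes room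
  for the quantifier over \<open>c\<close> below the other two.
\<close>

definition skip2 :: "nat \<Rightarrow> nat" where
  "skip2 = 0 ## 1 ## (\<lambda>n. Suc (Suc (Suc n)))"

lemma scons_skip2: "(\<lambda>n. (w ## a ## c ## e) (skip2 n)) = w ## a ## e"
  unfolding skip2_def by (rule ext) (simp split: nat.split)

definition Del0 :: "('a, 'b) set_structure_scheme \<Rightarrow> ((nat \<Rightarrow> 'a) \<Rightarrow> bool) \<Rightarrow> bool" where
  "Del0 M P \<longleftrightarrow> (\<exists>\<phi>\<in>Delta0_P. \<forall>e. P e = sat M e \<phi>)"

definition Sig1 :: "('a, 'b) set_structure_scheme \<Rightarrow> ((nat \<Rightarrow> 'a) \<Rightarrow> bool) \<Rightarrow> bool" where
  "Sig1 M P \<longleftrightarrow> (\<exists>Q. Del0 M Q \<and> (\<forall>e. P e = (\<exists>w. Q (w ## e))))"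

definition Del1 :: "('a, 'b) set_structure_scheme \<Rightarrow> ((nat \<Rightarrow> 'a) \<Rightarrow> bool) \<Rightarrow> bool" where
  "Del1 M P \<longleftrightarrow> Sig1 M P \<and> Sig1 M (\<lambda>e. \<not> P e)"

text \<open>
  Only the graph is required to be \<open>\<Sigma>\<^sub>1\<close>. As \<open>t\<close> is total, the complement of its graph is \<open>\<Sigma>\<^sub>1\<close>
  as well.
\<close>

definition Fun1 :: "('a, 'b) set_structure_scheme \<Rightarrow> ((nat \<Rightarrow> 'a) \<Rightarrow> 'a) \<Rightarrow> bool" where
  "Fun1 M t \<longleftrightarrow> Sig1 M (\<lambda>e. e 0 = t (\<lambda>n. e (Suc n)))"

text \<open>
  The introduction rules for \<open>Del1\<close> and \<open>Fun1\<close>. Since a total function with a \<open>\<Sigma>\<^sub>1\<close> graph can be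
  substituted into \<open>\<Delta>\<^sub>1\<close> relations, terms may be nested freely and used to bound quantifiers.
\<close>

named_theorems definable

text \<open>
  The universe is a whole type, which spares relativizing every quantifier. A countable model is
  brought into this form at the end.
\<close>

locale set_model =
  fixes M :: "'a set_structure"
  assumes univ: "univ M = UNIV"
    and KP: "models_KP_P M"
    and sep_Sigma: "separation M (Sigma_P 1)"
begin

definition elts :: "'a \<Rightarrow> 'a set" where
  "elts x = {u. mem M u x}"

lemma mem_iff [simp]: "mem M u x \<longleftrightarrow> u \<in> elts x"
  by (simp add: elts_def)

lemma subset_in_iff [simp]: "subset_in M x y \<longleftrightarrow> elts x \<subseteq> elts y"
  by (auto simp: subset_in_def univ)

lemma assignment [simp]: "assignment M v"
  by (simp add: assignment_def univ)

lemma elts_inject [simp]: "elts x = elts y \<longleftrightarrow> x = y"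
  using KP by (auto simp: models_KP_P_def extensionality_def univ set_eq_iff)

lemma Del0_mem: "Del0 M (\<lambda>e. e i \<in> elts (e j))"
  unfolding Del0_def by (rule bexI[of _ "Mem i j"]) (simp_all add: Delta0_P_def)

lemma Del0_eq: "Del0 M (\<lambda>e. e i = e j)"
  unfolding Del0_def by (rule bexI[of _ "Eq i j"]) (simp_all add: Delta0_P_def)

lemma Del0_not:
  assumes "Del0 M P" shows "Del0 M (\<lambda>e. \<not> P e)"
proof -
  obtain \<phi> where "\<phi> \<in> Delta0_P" "\<forall>e. P e = sat M e \<phi>" using assms by (auto simp: Del0_def)
  then show ?thesis unfolding Del0_def by (intro bexI[of _ "Neg \<phi>"]) (simp_all add: Delta0_P_def)
qed

lemma Del0_conj:
  assumes "Del0 M P" "Del0 M Q" shows "Del0 M (\<lambda>e. P e \<and> Q e)"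
proof -
  obtain \<phi> \<psi> where "\<phi> \<in> Delta0_P" "\<forall>e. P e = sat M e \<phi>" "\<psi> \<in> Delta0_P" "\<forall>e. Q e = sat M e \<psi>"
    using assms by (auto simp: Del0_def)
  then show ?thesis unfolding Del0_def by (intro bexI[of _ "Conj \<phi> \<psi>"]) (simp_all add: Delta0_P_def)
qed

lemma Del0_rename:
  assumes "Del0 M P" shows "Del0 M (\<lambda>e. P (\<lambda>n. e (f n)))"
proof -
  obtain \<phi> where \<phi>: "\<phi> \<in> Delta0_P" "\<forall>e. P e = sat M e \<phi>" using assms by (auto simp: Del0_def)
  obtain \<psi> where "all_bounded \<phi> \<longrightarrow> all_bounded \<psi>" "\<forall>v. sat M v \<psi> = sat M (\<lambda>n. v (f n)) \<phi>"
    using sat_rename by blast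
  with \<phi> show ?thesis unfolding Del0_def by (intro bexI[of _ \<psi>]) (simp_all add: Delta0_P_def)
qed

text \<open>
  The shift performed by \<open>a ## e\<close> is undone by letting the formula use, for the variable \<open>0\<close>, a
  name \<open>N\<close> that does not clash with the other variables.
\<close>

lemma Del0_fresh_var:
  assumes "Del0 M Q"
  obtains \<phi> N where "\<phi> \<in> Delta0_P" "\<And>e a. sat M (e(N := a)) \<phi> = Q (a ## e)"
proof -
  obtain \<phi> where \<phi>: "\<phi> \<in> Delta0_P" "\<forall>e. Q e = sat M e \<phi>" using assms by (auto simp: Del0_def)
  obtain N where N: "\<forall>x\<in>vars \<phi>. x - 1 \<noteq> N" using ex_fresh_var[of \<phi> "\<lambda>x. x - 1"] by blast
  obtain \<psi> where \<psi>: "all_bounded \<phi> \<longrightarrow> all_bounded \<psi>"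
    "\<forall>v. sat M v \<psi> = sat M (\<lambda>n. v ((N ## (\<lambda>x. x)) n)) \<phi>"
    using sat_rename by blast
  have "sat M (e(N := a)) \<psi> = Q (a ## e)" for e a
    unfolding \<psi>(2)[rule_format] \<phi>(2)[rule_format]
    by (rule sat_cong) (use N in \<open>auto split: nat.split\<close>)
  then show ?thesis using that[of \<psi> N] \<psi>(1) \<phi>(1) by (simp add: Delta0_P_def)
qed

lemma Del0_bex:
  assumes "Del0 M Q" shows "Del0 M (\<lambda>e. \<exists>a\<in>elts (e j). Q (a ## e))"
proof -
  obtain \<phi> N where "\<phi> \<in> Delta0_P" "\<And>e a. sat M (e(N := a)) \<phi> = Q (a ## e)"
    using Del0_fresh_var[OF assms] by metis
  then show ?thesis unfolding Del0_def
    by (intro bexI[of _ "ExMem N j \<phi>"]) (auto simp: Delta0_P_def univ)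
qed

lemma Del0_bex_subset:
  assumes "Del0 M Q" shows "Del0 M (\<lambda>e. \<exists>a. elts a \<subseteq> elts (e j) \<and> Q (a ## e))"
proof -
  obtain \<phi> N where "\<phi> \<in> Delta0_P" "\<And>e a. sat M (e(N := a)) \<phi> = Q (a ## e)"
    using Del0_fresh_var[OF assms] by metis
  then show ?thesis unfolding Del0_def
    by (intro bexI[of _ "ExSub N j \<phi>"]) (auto simp: Delta0_P_def univ)
qed

lemma Del0_ball:
  assumes "Del0 M Q" shows "Del0 M (\<lambda>e. \<forall>a\<in>elts (e j). Q (a ## e))"
  using Del0_not[OF Del0_bex[OF Del0_not[OF assms]]] by simp

section \<open>Closure properties of definability\<close>

lemma Del0_imp_Sig1:
  assumes "Del0 M P" shows "Sig1 M P"
  unfolding Sig1_def using Del0_rename[OF assms, of Suc] by (intro exI[of _ "\<lambda>e. P (\<lambda>n. e (Suc n))"]) auto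

lemma Sig1_rename:
  assumes "Sig1 M P" shows "Sig1 M (\<lambda>e. P (\<lambda>n. e (f n)))"
proof -
  obtain Q where Q: "Del0 M Q" "\<And>e. P e = (\<exists>w. Q (w ## e))" using assms by (auto simp: Sig1_def)
  have *: "(\<lambda>n. (w ## e) ((0 ## (\<lambda>n. Suc (f n))) n)) = w ## (\<lambda>n. e (f n))" for w and e :: "nat \<Rightarrow> 'a"
    by (rule ext) (simp split: nat.split)
  show ?thesis unfolding Sig1_def Q(2)
    using Del0_rename[OF Q(1), of "0 ## (\<lambda>n. Suc (f n))"]
    by (intro exI[of _ "\<lambda>e. Q (\<lambda>n. e ((0 ## (\<lambda>n. Suc (f n))) n))"]) (auto simp: * )
qed

lemma upair_ex: "\<exists>p. elts p = {x, y}"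
  using KP by (fastforce simp: models_KP_P_def pairing_def is_upair_def univ set_eq_iff)

text \<open>
  Two existential quantifiers are contracted into one by bounding both by an unordered pair.
\<close>

lemma Sig1_ex_scons:
  assumes "Sig1 M P" shows "Sig1 M (\<lambda>e. \<exists>a. P (a ## e))"
proof -
  obtain Q where Q: "Del0 M Q" "\<And>e. P e = (\<exists>w. Q (w ## e))" using assms by (auto simp: Sig1_def)
  let ?R = "\<lambda>e. \<exists>a\<in>elts (e 0). \<exists>w\<in>elts ((a ## e) 1). Q (\<lambda>n. (w ## a ## e) (skip2 n))"
  have D: "Del0 M ?R" by (rule Del0_bex[OF Del0_bex[OF Del0_rename[OF Q(1)]]])
  have "(\<exists>a. P (a ## e)) = (\<exists>c. ?R (c ## e))" for e
  proof
    assume "\<exists>a. P (a ## e)"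
    then obtain a w where "Q (w ## a ## e)" unfolding Q(2) by blast
    moreover obtain c where "elts c = {a, w}" using upair_ex by blast
    ultimately have "?R (c ## e)" unfolding scons_skip2 by auto
    then show "\<exists>c. ?R (c ## e)" ..
  next
    assume "\<exists>c. ?R (c ## e)"
    then show "\<exists>a. P (a ## e)" unfolding scons_skip2 Q(2) by blast
  qed
  with D show ?thesis unfolding Sig1_def by blast
qed

lemma Sig1_ex:
  assumes "Sig1 M (\<lambda>e. R (e 0) (\<lambda>n. e (Suc n)))" shows "Sig1 M (\<lambda>e. \<exists>a. R a e)"
  using Sig1_ex_scons[OF assms] by simp

lemma Del0_conj_Sig1:
  assumes "Del0 M P" "Sig1 M Q" shows "Sig1 M (\<lambda>e. P e \<and> Q e)"
proof -
  obtain Q' where Q: "Del0 M Q'" "\<And>e. Q e = (\<exists>w. Q' (w ## e))" using assms(2) by (auto simp: Sig1_def)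
  have "Del0 M (\<lambda>e. P (\<lambda>n. e (Suc n)) \<and> Q' e)"
    by (rule Del0_conj[OF Del0_rename[OF assms(1)] Q(1)])
  then show ?thesis unfolding Sig1_def Q(2) by (intro exI[of _ "\<lambda>e. P (\<lambda>n. e (Suc n)) \<and> Q' e"]) auto
qed

lemma Sig1_conj:
  assumes "Sig1 M P" "Sig1 M Q" shows "Sig1 M (\<lambda>e. P e \<and> Q e)"
proof -
  obtain Q' where Q: "Del0 M Q'" "\<And>e. P e = (\<exists>w. Q' (w ## e))" using assms(1) by (auto simp: Sig1_def)
  have "Sig1 M (\<lambda>e. Q' e \<and> Q (\<lambda>n. e (Suc n)))"
    by (rule Del0_conj_Sig1[OF Q(1) Sig1_rename[OF assms(2)]])
  from Sig1_ex_scons[OF this] show ?thesis unfolding Q(2) by simp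
qed

lemma Sig1_disj:
  assumes "Sig1 M P" "Sig1 M Q" shows "Sig1 M (\<lambda>e. P e \<or> Q e)"
proof -
  obtain P' where P: "Del0 M P'" "\<And>e. P e = (\<exists>w. P' (w ## e))" using assms(1) by (auto simp: Sig1_def)
  obtain Q' where Q: "Del0 M Q'" "\<And>e. Q e = (\<exists>w. Q' (w ## e))" using assms(2) by (auto simp: Sig1_def)
  have "Del0 M (\<lambda>e. \<not> (\<not> P' e \<and> \<not> Q' e))"
    by (intro Del0_conj Del0_not P(1) Q(1))
  then have "Del0 M (\<lambda>e. P' e \<or> Q' e)" by simp
  then show ?thesis unfolding Sig1_def P(2) Q(2) by (intro exI[of _ "\<lambda>e. P' e \<or> Q' e"]) auto
qed

lemma collection_Del0:
  assumes "Del0 M Q" "\<And>u. u \<in> elts x \<Longrightarrow> \<exists>w. Q (w ## u ## e)"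
  shows "\<exists>y. \<forall>u\<in>elts x. \<exists>w\<in>elts y. Q (w ## u ## e)"
proof -
  obtain \<phi> where \<phi>: "\<phi> \<in> Delta0_P" "\<And>e. Q e = sat M e \<phi>" using assms(1) by (auto simp: Del0_def)
  have "collection M Delta0_P" using KP by (simp add: models_KP_P_def)
  from this[unfolded collection_def, rule_format, OF \<phi>(1), of "x ## x ## e" 1 0 x] assms(2)
  show ?thesis by (simp add: univ \<phi>(2) Ball_def Bex_def)
qed

lemma union_ex: "\<exists>u. elts u = (\<Union>y\<in>elts x. elts y)"
  using KP by (fastforce simp: models_KP_P_def union_axiom_def univ set_eq_iff)

lemma collection_Sig1:
  assumes "Sig1 M Q" "\<And>u. u \<in> elts x \<Longrightarrow> \<exists>w. Q (w ## u ## e)"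
  shows "\<exists>y. \<forall>u\<in>elts x. \<exists>w\<in>elts y. Q (w ## u ## e)"
proof -
  obtain Q' where Q: "Del0 M Q'" "\<And>e. Q e = (\<exists>w. Q' (w ## e))" using assms(1) by (auto simp: Sig1_def)
  let ?R = "\<lambda>e. \<exists>a\<in>elts (e 0). \<exists>w\<in>elts ((a ## e) 1). Q' (\<lambda>n. (w ## a ## e) (skip2 n))"
  have D: "Del0 M ?R" by (rule Del0_bex[OF Del0_bex[OF Del0_rename[OF Q(1)]]])
  have "\<exists>c. ?R (c ## u ## e)" if u: "u \<in> elts x" for u
  proof -
    obtain w a where "Q' (a ## w ## u ## e)" using assms(2)[OF u] Q(2) by auto
    moreover obtain c where "elts c = {w, a}" using upair_ex by blast
    ultimately have "?R (c ## u ## e)" unfolding scons_skip2 by auto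
    then show ?thesis ..
  qed
  from collection_Del0[OF D this] obtain y where y: "\<forall>u\<in>elts x. \<exists>c\<in>elts y. ?R (c ## u ## e)" by blast
  obtain z where z: "elts z = (\<Union>y\<in>elts y. elts y)" using union_ex by blast
  have "\<exists>w\<in>elts z. Q (w ## u ## e)" if u: "u \<in> elts x" for u
    using y u unfolding scons_skip2 Q(2) z by fastforce
  then show ?thesis by blast
qed

text \<open>
  Collection moves the unbounded existential quantifier to the front.
\<close>

lemma Sig1_ball_var:
  assumes "Sig1 M Q" shows "Sig1 M (\<lambda>e. \<forall>a\<in>elts (e j). Q (a ## e))"
proof -
  obtain Q' where Q: "Del0 M Q'" "\<And>e. Q e = (\<exists>w. Q' (w ## e))" using assms by (auto simp: Sig1_def)
  let ?R = "\<lambda>e. \<forall>a\<in>elts (e (Suc j)). \<exists>w\<in>elts ((a ## e) 1). Q' (\<lambda>n. (w ## a ## e) (skip2 n))"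
  have D: "Del0 M ?R" by (rule Del0_ball[OF Del0_bex[OF Del0_rename[OF Q(1)]]])
  have "(\<forall>a\<in>elts (e j). Q (a ## e)) = (\<exists>c. ?R (c ## e))" for e
    unfolding scons_skip2 Q(2) using collection_Del0[OF Q(1), of "e j" e] by fastforce
  with D show ?thesis unfolding Sig1_def by blast
qed

lemma Fun1_rename: 
  assumes "Fun1 M t" shows "Fun1 M (\<lambda>e. t (\<lambda>n. e (f n)))"
  using Sig1_rename[OF assms[unfolded Fun1_def], of "0 ## (\<lambda>n. Suc (f n))"] unfolding Fun1_def by simp

lemma Fun1_var [definable]: "Fun1 M (\<lambda>e. e n)"
  unfolding Fun1_def by (rule Del0_imp_Sig1[OF Del0_eq])

text \<open>
  As \<open>P (s e) e\<close> is equivalent to \<open>\<exists>a. a = s e \<and> P a e\<close>, total \<open>\<Sigma>\<^sub>1\<close> functions can be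
  substituted. In the versions for several arguments the variables are first put in reverse
  order, so that the argument to be replaced is always the variable \<open>0\<close>.
\<close>

lemma Sig1_subst:
  assumes "Sig1 M (\<lambda>e. P (e 0) (\<lambda>n. e (Suc n)))" "Fun1 M s" shows "Sig1 M (\<lambda>e. P (s e) e)"
  using Sig1_ex[OF Sig1_conj[OF assms(2)[unfolded Fun1_def] assms(1)]] by simp

lemma Sig1_subst1:
  assumes "Sig1 M (\<lambda>e. P (e 0))" "Fun1 M s" shows "Sig1 M (\<lambda>e. P (s e))"
  using Sig1_subst[of "\<lambda>a e. P a"] assms by simp

lemma Sig1_subst2:
  assumes "Sig1 M (\<lambda>e. P (e 0) (e 1))" "Fun1 M s" "Fun1 M t"
  shows "Sig1 M (\<lambda>e. P (s e) (t e))"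
proof -
  have "Sig1 M (\<lambda>e. P (e 1) (e 0))"
    using Sig1_rename[OF assms(1), of "\<lambda>n. 1 - n"] by simp
  then have "Sig1 M (\<lambda>e. P (e 0) (t (\<lambda>n. e (Suc n))))"
    using Sig1_subst[of "\<lambda>b e. P (e 0) b", OF _ Fun1_rename[OF assms(3), of Suc]] by simp
  from Sig1_subst[of "\<lambda>a e. P a (t e)", OF this assms(2)] show ?thesis .
qed

lemma Sig1_subst3:
  assumes "Sig1 M (\<lambda>e. P (e 0) (e 1) (e 2))" "Fun1 M s" "Fun1 M t" "Fun1 M u"
  shows "Sig1 M (\<lambda>e. P (s e) (t e) (u e))"
proof -
  have "Sig1 M (\<lambda>e. P (e 2) (e 1) (e 0))"
    using Sig1_rename[OF assms(1), of "\<lambda>n. 2 - n"] by simp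
  then have "Sig1 M (\<lambda>e. P (e 1) (e 0) (u (\<lambda>n. e (Suc (Suc n)))))"
    using Sig1_subst[of "\<lambda>c e. P (e 1) (e 0) c", OF _ Fun1_rename[OF assms(4), of "\<lambda>n. Suc (Suc n)"]]
    by (simp add: numeral_2_eq_2)
  then have "Sig1 M (\<lambda>e. P (e 0) (t (\<lambda>n. e (Suc n))) (u (\<lambda>n. e (Suc n))))"
    using Sig1_subst[of "\<lambda>b e. P (e 0) b (u (\<lambda>n. e (Suc n)))", OF _ Fun1_rename[OF assms(3), of Suc]]
    by simp
  from Sig1_subst[of "\<lambda>a e. P a (t e) (u e)", OF this assms(2)] show ?thesis .
qed

lemma Del1_subst1:
  "Del1 M (\<lambda>e. P (e 0)) \<Longrightarrow> Fun1 M s \<Longrightarrow> Del1 M (\<lambda>e. P (s e))"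
  unfolding Del1_def using Sig1_subst1[of P] Sig1_subst1[of "\<lambda>x. \<not> P x"] by blast

lemma Del1_subst2:
  "Del1 M (\<lambda>e. P (e 0) (e 1)) \<Longrightarrow> Fun1 M s \<Longrightarrow> Fun1 M t \<Longrightarrow> Del1 M (\<lambda>e. P (s e) (t e))"
  unfolding Del1_def using Sig1_subst2[of P] Sig1_subst2[of "\<lambda>x y. \<not> P x y"] by blast

lemma Del1_subst3:
  "Del1 M (\<lambda>e. P (e 0) (e 1) (e 2)) \<Longrightarrow> Fun1 M s \<Longrightarrow> Fun1 M t \<Longrightarrow> Fun1 M u \<Longrightarrow>
    Del1 M (\<lambda>e. P (s e) (t e) (u e))"
  unfolding Del1_def using Sig1_subst3[of P] Sig1_subst3[of "\<lambda>x y z. \<not> P x y z"] by blast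

lemma Fun1_subst1:
  assumes "Fun1 M (\<lambda>e. f (e 0))" "Fun1 M s" shows "Fun1 M (\<lambda>e. f (s e))"
  using Sig1_subst2[of "\<lambda>y x. y = f x", OF _ Fun1_var[of 0] Fun1_rename[OF assms(2), of Suc]] assms(1)
  by (simp add: Fun1_def)

lemma Fun1_subst2:
  assumes "Fun1 M (\<lambda>e. f (e 0) (e 1))" "Fun1 M s" "Fun1 M t" shows "Fun1 M (\<lambda>e. f (s e) (t e))"
  using Sig1_subst3[of "\<lambda>y x z. y = f x z", OF _ Fun1_var[of 0]
      Fun1_rename[OF assms(2), of Suc] Fun1_rename[OF assms(3), of Suc]] assms(1)
  by (simp add: Fun1_def numeral_2_eq_2)

lemma Del1_not [definable]: "Del1 M P \<Longrightarrow> Del1 M (\<lambda>e. \<not> P e)"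
  by (simp add: Del1_def)

lemma Del1_conj [definable]: "Del1 M P \<Longrightarrow> Del1 M Q \<Longrightarrow> Del1 M (\<lambda>e. P e \<and> Q e)"
  unfolding Del1_def de_Morgan_conj by (intro conjI Sig1_conj Sig1_disj) auto

lemma Del1_disj [definable]: "Del1 M P \<Longrightarrow> Del1 M Q \<Longrightarrow> Del1 M (\<lambda>e. P e \<or> Q e)"
  unfolding Del1_def de_Morgan_disj by (intro conjI Sig1_conj Sig1_disj) auto

lemma Del1_imp [definable]: "Del1 M P \<Longrightarrow> Del1 M Q \<Longrightarrow> Del1 M (\<lambda>e. P e \<longrightarrow> Q e)"
  unfolding imp_conv_disj by (intro Del1_disj Del1_not)

lemma Del1_iff [definable]: "Del1 M P \<Longrightarrow> Del1 M Q \<Longrightarrow> Del1 M (\<lambda>e. P e \<longleftrightarrow> Q e)"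
  unfolding iff_conv_conj_imp by (intro Del1_conj Del1_imp)

lemma Del1_Del0: "Del0 M P \<Longrightarrow> Del1 M P"
  by (simp add: Del1_def Del0_imp_Sig1 Del0_not)

lemma Del1_mem [definable]:
  "Fun1 M s \<Longrightarrow> Fun1 M t \<Longrightarrow> Del1 M (\<lambda>e. s e \<in> elts (t e))"
  by (rule Del1_subst2[of "\<lambda>x y. x \<in> elts y", OF Del1_Del0[OF Del0_mem]])

lemma Del1_eq [definable]: "Fun1 M s \<Longrightarrow> Fun1 M t \<Longrightarrow> Del1 M (\<lambda>e. s e = t e)"
  by (rule Del1_subst2[of "\<lambda>x y. x = y", OF Del1_Del0[OF Del0_eq]])

lemma Sig1_ball:
  assumes "Fun1 M t" "Sig1 M (\<lambda>e. R (e 0) (\<lambda>n. e (Suc n)))"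
  shows "Sig1 M (\<lambda>e. \<forall>a\<in>elts (t e). R a e)"
proof -
  have "Sig1 M (\<lambda>e. R (e 0) (\<lambda>n. e (Suc (Suc n))))"
    using Sig1_rename[OF assms(2), of "0 ## (\<lambda>n. Suc (Suc n))"] by simp
  from Sig1_ball_var[OF this, of 0] have "Sig1 M (\<lambda>e. \<forall>a\<in>elts (e 0). R a (\<lambda>n. e (Suc n)))"
    by simp
  from Sig1_subst[of "\<lambda>x e. \<forall>a\<in>elts x. R a e", OF this assms(1)] show ?thesis .
qed

lemma Sig1_Del1: "Del1 M P \<Longrightarrow> Sig1 M P"
  by (simp add: Del1_def)

lemma Sig1_bex:
  assumes "Fun1 M t" "Sig1 M (\<lambda>e. R (e 0) (\<lambda>n. e (Suc n)))"
  shows "Sig1 M (\<lambda>e. \<exists>a\<in>elts (t e). R a e)"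
  unfolding Bex_def
  by (rule Sig1_ex, rule Sig1_conj[OF Sig1_Del1[OF Del1_mem] assms(2)])
    (rule Fun1_var, rule Fun1_rename[OF assms(1)])

lemma Del1_ball [definable]:
  "Fun1 M t \<Longrightarrow> Del1 M (\<lambda>e. R (e 0) (\<lambda>n. e (Suc n))) \<Longrightarrow> Del1 M (\<lambda>e. \<forall>a\<in>elts (t e). R a e)"
  unfolding Del1_def ball_simps(10) by (intro conjI Sig1_ball Sig1_bex) simp_all

lemma Del1_bex [definable]:
  "Fun1 M t \<Longrightarrow> Del1 M (\<lambda>e. R (e 0) (\<lambda>n. e (Suc n))) \<Longrightarrow> Del1 M (\<lambda>e. \<exists>a\<in>elts (t e). R a e)"
  unfolding Del1_def bex_simps(8) by (intro conjI Sig1_ball Sig1_bex) simp_all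

lemma Del1_subset [definable]:
  assumes "Fun1 M s" "Fun1 M t" shows "Del1 M (\<lambda>e. elts (s e) \<subseteq> elts (t e))"
  unfolding subset_eq by (intro definable assms Fun1_rename[OF assms(2)])

lemma Fun1I:
  assumes "Sig1 M (\<lambda>e. Q (e 0) (\<lambda>n. e (Suc n)))" "\<And>y e. y = t e \<longleftrightarrow> Q y e"
  shows "Fun1 M t"
  using assms by (simp add: Fun1_def)

lemma Fun1I':
  assumes "Del1 M (\<lambda>e. Q (e 0) (\<lambda>n. e (Suc n)))" "\<And>y e. y = t e \<longleftrightarrow> Q y e"
  shows "Fun1 M t"
  using assms by (simp add: Fun1_def Del1_def)

section \<open>Separation, induction, collection\<close>

lemma separation_Sig1:
  assumes "Sig1 M P" shows "\<exists>y. elts y = {u \<in> elts x. P (u ## e)}"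
proof -
  obtain Q where "Del0 M Q" "\<And>e. P e = (\<exists>w. Q (w ## e))" using assms by (auto simp: Sig1_def)
  then obtain \<phi> where \<phi>: "\<phi> \<in> Delta0_P" "\<And>e. P e = (\<exists>w. sat M (w ## e) \<phi>)"
    by (auto simp: Del0_def)
  have "Ex 0 \<phi> \<in> Sigma_P 1" using \<phi>(1) by simp
  from sep_Sigma[unfolded separation_def, rule_format, OF this, of "x ## x ## e" x 1]
  show ?thesis by (simp add: univ \<phi>(2) set_eq_iff)
qed

text \<open>
  This is \<open>\<Pi>\<^sub>1\<close>-Foundation for the negation of \<open>P\<close>.
\<close>

lemma induct_Sig1:
  assumes "Sig1 M P" "\<And>x. (\<And>u. u \<in> elts x \<Longrightarrow> P (u ## e)) \<Longrightarrow> P (x ## e)"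
  shows "P (x ## e)"
proof (rule ccontr)
  obtain Q where "Del0 M Q" "\<And>e. P e = (\<exists>w. Q (w ## e))" using assms by (auto simp: Sig1_def)
  then obtain \<phi> where \<phi>: "\<phi> \<in> Delta0_P" "\<And>e. P e = (\<exists>w. sat M (w ## e) \<phi>)"
    by (auto simp: Del0_def)
  assume "\<not> P (x ## e)"
  let ?\<psi> = "All 0 (Neg \<phi>)"
  have "Neg \<phi> \<in> Delta0_P" using \<phi>(1) by (simp add: Delta0_P_def)
  then have \<psi>: "?\<psi> \<in> Pi_P 1" by simp
  have s: "sat M ((x ## x ## e)(1 := y)) ?\<psi> \<longleftrightarrow> \<not> P (y ## e)" for y
    by (simp add: univ \<phi>(2))
  have "foundation M (Pi_P 1)" using KP by (simp add: models_KP_P_def)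
  from this[unfolded foundation_def, rule_format, OF \<psi>, of "x ## x ## e" 1] \<open>\<not> P (x ## e)\<close>
  obtain y where "\<not> P (y ## e)" "\<And>u. u \<in> elts y \<Longrightarrow> P (u ## e)"
    unfolding s by (auto simp: univ)
  with assms(2) show False by blast
qed

section \<open>Basic set operations\<close>

text \<open>
  A small set of elements of \<open>M\<close> is one that \<open>M\<close> knows as a set, and \<open>mk\<close> turns it into an
  element of \<open>M\<close>.
\<close>

definition small :: "'a set \<Rightarrow> bool" where
  "small A \<longleftrightarrow> (\<exists>x. elts x = A)"

definition mk :: "'a set \<Rightarrow> 'a" where
  "mk A = (THE x. elts x = A)"

lemma elts_mk [simp]:
  assumes "small A" shows "elts (mk A) = A"
proof -
  obtain x where A: "elts x = A" using assms by (auto simp: small_def)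
  then have "mk A = x" unfolding mk_def by (intro the_equality) (auto simp flip: A)
  with A show ?thesis by simp
qed

lemma small_elts [simp]: "small (elts x)"
  by (auto simp: small_def)

lemma smallI: "elts x = A \<Longrightarrow> small A"
  unfolding small_def by blast

definition zero :: 'a where "zero = mk {}"
definition upair :: "'a \<Rightarrow> 'a \<Rightarrow> 'a" where "upair x y = mk {x, y}"
definition opair :: "'a \<Rightarrow> 'a \<Rightarrow> 'a" where "opair x y = upair (upair x x) (upair x y)"
definition un :: "'a \<Rightarrow> 'a" where "un x = mk (\<Union>y\<in>elts x. elts y)"
definition pw :: "'a \<Rightarrow> 'a" where "pw x = mk {y. elts y \<subseteq> elts x}"
definition adj :: "'a \<Rightarrow> 'a \<Rightarrow> 'a" where "adj x y = mk (insert y (elts x))"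
abbreviation succ :: "'a \<Rightarrow> 'a" where "succ x \<equiv> adj x x"

lemma small_upair: "small {x, y}"
  using upair_ex by (simp add: small_def)

lemma elts_upair [simp]: "elts (upair x y) = {x, y}"
  by (simp add: upair_def small_upair)

lemma small_Union: "small (\<Union>y\<in>elts x. elts y)"
  using union_ex by (simp add: small_def)

lemma elts_un [simp]: "elts (un x) = (\<Union>y\<in>elts x. elts y)"
  by (simp add: un_def small_Union)

lemma small_Pow: "small {y. elts y \<subseteq> elts x}"
  using KP by (fastforce simp: models_KP_P_def powerset_def univ small_def set_eq_iff)

lemma elts_pw [simp]: "elts (pw x) = {y. elts y \<subseteq> elts x}"
  by (simp add: pw_def small_Pow)

lemma small_insert: "small (insert y (elts x))"
proof -
  have "elts (un (upair x (upair y y))) = insert y (elts x)" by auto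
  then show ?thesis by (rule smallI)
qed

lemma elts_adj [simp]: "elts (adj x y) = insert y (elts x)"
  by (simp add: adj_def small_insert)

lemma small_empty: "small {}"
  using KP by (auto simp: models_KP_P_def infinity_def univ small_def)

lemma elts_zero [simp]: "elts zero = {}"
  by (simp add: zero_def small_empty)

lemma upair_inject: "upair x y = upair u v \<longleftrightarrow> {x, y} = {u, v}"
  by (metis elts_inject elts_upair)

lemma opair_inject [simp]: "opair x y = opair u v \<longleftrightarrow> x = u \<and> y = v"
  by (auto simp: opair_def upair_inject doubleton_eq_iff)

lemma Fun1_zero [definable]: "Fun1 M (\<lambda>e. zero)"
proof (rule Fun1I')
  show "y = zero \<longleftrightarrow> (\<forall>z\<in>elts y. z \<noteq> z)" for y
    by (auto simp: elts_inject[symmetric] simp del: elts_inject)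
qed (intro definable)

lemma Fun1_upair0: "Fun1 M (\<lambda>e. upair (e 0) (e 1))"
proof (rule Fun1I')
  show "y = upair (e 0) (e 1) \<longleftrightarrow> e 0 \<in> elts y \<and> e 1 \<in> elts y \<and> (\<forall>z\<in>elts y. z = e 0 \<or> z = e 1)" for y e
    by (auto simp: elts_inject[symmetric] simp del: elts_inject)
qed (intro definable)

lemma Fun1_upair [definable]: "Fun1 M s \<Longrightarrow> Fun1 M t \<Longrightarrow> Fun1 M (\<lambda>e. upair (s e) (t e))"
  by (rule Fun1_subst2[of upair, OF Fun1_upair0])

lemma Fun1_opair [definable]: "Fun1 M s \<Longrightarrow> Fun1 M t \<Longrightarrow> Fun1 M (\<lambda>e. opair (s e) (t e))"
  unfolding opair_def by (intro definable)

lemma Fun1_un0: "Fun1 M (\<lambda>e. un (e 0))"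
proof (rule Fun1I')
  show "y = un (e 0) \<longleftrightarrow> (\<forall>z\<in>elts y. \<exists>w\<in>elts (e 0). z \<in> elts w) \<and> (\<forall>w\<in>elts (e 0). elts w \<subseteq> elts y)"
    for y e
    by (auto simp: elts_inject[symmetric] simp del: elts_inject)
qed (intro definable)

lemma Fun1_un [definable]: "Fun1 M s \<Longrightarrow> Fun1 M (\<lambda>e. un (s e))"
  by (rule Fun1_subst1[of un, OF Fun1_un0])

lemma Fun1_adj0: "Fun1 M (\<lambda>e. adj (e 0) (e 1))"
proof (rule Fun1I')
  show "y = adj (e 0) (e 1) \<longleftrightarrow>
      (\<forall>z\<in>elts y. z = e 1 \<or> z \<in> elts (e 0)) \<and> elts (e 0) \<subseteq> elts y \<and> e 1 \<in> elts y" for y e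
    by (auto simp: elts_inject[symmetric] simp del: elts_inject)
qed (intro definable)

lemma Fun1_adj [definable]: "Fun1 M s \<Longrightarrow> Fun1 M t \<Longrightarrow> Fun1 M (\<lambda>e. adj (s e) (t e))"
  by (rule Fun1_subst2[of adj, OF Fun1_adj0])

lemma Del0_ball_subset:
  assumes "Del0 M Q" shows "Del0 M (\<lambda>e. \<forall>a. elts a \<subseteq> elts (e j) \<longrightarrow> Q (a ## e))"
  using Del0_not[OF Del0_bex_subset[OF Del0_not[OF assms]]] by simp

text \<open>
  This is where it matters that quantifiers over subsets count as bounded.
\<close>

lemma Fun1_pw0: "Fun1 M (\<lambda>e. pw (e 0))"
proof (rule Fun1I)
  show "y = pw (e 0) \<longleftrightarrow> (\<forall>z\<in>elts y. elts z \<subseteq> elts (e 0)) \<and>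
      (\<forall>z. elts z \<subseteq> elts (e 0) \<longrightarrow> z \<in> elts y)" for y e
    by (auto simp: elts_inject[symmetric] simp del: elts_inject)
  have "Sig1 M (\<lambda>e. \<forall>z\<in>elts (e 0). elts z \<subseteq> elts (e 1))"
    by (rule Sig1_Del1) (intro definable)
  moreover have "Sig1 M (\<lambda>e. \<forall>z. elts z \<subseteq> elts (e 1) \<longrightarrow> z \<in> elts (e 0))"
    using Del0_imp_Sig1[OF Del0_ball_subset[OF Del0_mem[of 0 1], of 1]] by simp
  ultimately show "Sig1 M (\<lambda>e. (\<forall>z\<in>elts (e 0). elts z \<subseteq> elts (e (Suc 0))) \<and>
      (\<forall>z. elts z \<subseteq> elts (e (Suc 0)) \<longrightarrow> z \<in> elts (e 0)))"
    by (simp add: Sig1_conj)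
qed

lemma Fun1_pw [definable]: "Fun1 M s \<Longrightarrow> Fun1 M (\<lambda>e. pw (s e))"
  by (rule Fun1_subst1[of pw, OF Fun1_pw0])

definition pfst :: "'a \<Rightarrow> 'a" where
  "pfst p = (if \<exists>x y. p = opair x y then THE x. \<exists>y. p = opair x y else zero)"

definition psnd :: "'a \<Rightarrow> 'a" where
  "psnd p = (if \<exists>x y. p = opair x y then THE y. \<exists>x. p = opair x y else zero)"

lemma fst_opair [simp]: "pfst (opair x y) = x"
  by (auto simp: pfst_def)

lemma snd_opair [simp]: "psnd (opair x y) = y"
  by (auto simp: psnd_def)

lemma in_un_opair: "x \<in> elts (un (opair x y))" "y \<in> elts (un (opair x y))"
  by (auto simp: opair_def)

lemma is_opair_iff: "(\<exists>x y. p = opair x y) \<longleftrightarrow> (\<exists>x\<in>elts (un p). \<exists>y\<in>elts (un p). p = opair x y)"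
  using in_un_opair by metis

lemma Fun1_fst0: "Fun1 M (\<lambda>e. pfst (e 0))"
proof (rule Fun1I')
  show "y = pfst (e 0) \<longleftrightarrow> (\<exists>z\<in>elts (un (e 0)). e 0 = opair y z) \<or>
      \<not> (\<exists>x\<in>elts (un (e 0)). \<exists>z\<in>elts (un (e 0)). e 0 = opair x z) \<and> y = zero" for y e
  proof (cases "\<exists>x z. e 0 = opair x z")
    case True
    then obtain x z where "e 0 = opair x z" by blast
    then show ?thesis unfolding is_opair_iff[symmetric] by (auto simp: in_un_opair simp del: elts_un)
  next
    case False
    then show ?thesis by (auto simp: pfst_def)
  qed
qed (intro definable)

lemma Fun1_snd0: "Fun1 M (\<lambda>e. psnd (e 0))"
proof (rule Fun1I')
  show "y = psnd (e 0) \<longleftrightarrow> (\<exists>z\<in>elts (un (e 0)). e 0 = opair z y) \<or>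
      \<not> (\<exists>x\<in>elts (un (e 0)). \<exists>z\<in>elts (un (e 0)). e 0 = opair x z) \<and> y = zero" for y e
  proof (cases "\<exists>x z. e 0 = opair x z")
    case True
    then obtain x z where "e 0 = opair x z" by blast
    then show ?thesis unfolding is_opair_iff[symmetric] by (auto simp: in_un_opair simp del: elts_un)
  next
    case False
    then show ?thesis by (auto simp: psnd_def)
  qed
qed (intro definable)

lemma Fun1_fst [definable]: "Fun1 M s \<Longrightarrow> Fun1 M (\<lambda>e. pfst (s e))"
  by (rule Fun1_subst1[of pfst, OF Fun1_fst0])

lemma Fun1_snd [definable]: "Fun1 M s \<Longrightarrow> Fun1 M (\<lambda>e. psnd (s e))"
  by (rule Fun1_subst1[of psnd, OF Fun1_snd0])

lemma Ord_iff: "x \<in> Ord M \<longleftrightarrow>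
    (\<forall>y\<in>elts x. elts y \<subseteq> elts x) \<and> (\<forall>y\<in>elts x. \<forall>z\<in>elts y. elts z \<subseteq> elts y)"
  by (simp add: Ord_def transitive_in_def univ Ball_def)

lemma Del1_Ord0: "Del1 M (\<lambda>e. e 0 \<in> Ord M)"
  unfolding Ord_iff by (intro definable)

lemma Del1_Ord [definable]: "Fun1 M s \<Longrightarrow> Del1 M (\<lambda>e. s e \<in> Ord M)"
  by (rule Del1_subst1[of "\<lambda>x. x \<in> Ord M", OF Del1_Ord0])

text \<open>
  Induction, Separation and Collection for relations with explicit parameters \<open>p\<close>, \<open>q\<close>, \<open>r\<close>
  instead of environments.
\<close>

lemma induct_param:
  assumes "Sig1 M (\<lambda>e. R (e 0) (e 1) (e 2))"
    and "\<And>x. (\<And>u. u \<in> elts x \<Longrightarrow> R u p q) \<Longrightarrow> R x p q"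
  shows "R x p q"
proof -
  let ?e = "p ## q ## undefined"
  have "R ((x ## ?e) 0) ((x ## ?e) 1) ((x ## ?e) 2)"
    by (rule induct_Sig1[OF assms(1)]) (use assms(2) in simp)
  then show ?thesis by simp
qed

lemma separation_param:
  assumes "Sig1 M (\<lambda>e. R (e 0) (e 1) (e 2) (e 3))"
  shows "\<exists>y. elts y = {u \<in> elts x. R u p q r}"
  using separation_Sig1[OF assms, of x "p ## q ## r ## undefined"] by simp

lemma small_param:
  assumes "Sig1 M (\<lambda>e. R (e 0) (e 1) (e 2) (e 3))"
  shows "small {u \<in> elts x. R u p q r}"
  using separation_param[OF assms] unfolding small_def by blast

lemma collection_param:
  assumes "Sig1 M (\<lambda>e. R (e 0) (e 1) (e 2) (e 3) (e 4))" "\<And>u. u \<in> elts x \<Longrightarrow> \<exists>w. R w u p q r"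
  shows "\<exists>y. \<forall>u\<in>elts x. \<exists>w\<in>elts y. R w u p q r"
  using collection_Sig1[OF assms(1), of x "p ## q ## r ## undefined"] assms(2) by simp

section \<open>Regularity\<close>

lemma regularity:
  assumes "elts x \<noteq> {}" shows "\<exists>y\<in>elts x. elts y \<inter> elts x = {}"
proof (rule ccontr)
  assume *: "\<not> ?thesis"
  have "z \<notin> elts x" for z
  proof (rule induct_param[where R = "\<lambda>z x x'. z \<notin> elts x" and q = x])
    show "Sig1 M (\<lambda>e. e 0 \<notin> elts (e 1))" by (rule Sig1_Del1) (intro definable)
  qed (use * in blast)
  with assms show False by blast
qed

lemma mem_irrefl [simp]: "x \<notin> elts x"
  using regularity[of "upair x x"] by auto

lemma mem_asym: "x \<in> elts y \<Longrightarrow> y \<notin> elts x"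
  using regularity[of "upair x y"] by auto

section \<open>The rank function\<close>

lemma is_pair_iff: "is_pair M x y p \<longleftrightarrow> p = opair x y"
proof -
  have "is_upair M u v q \<longleftrightarrow> q = upair u v" for u v q
    by (auto simp: is_upair_def univ elts_inject[symmetric] simp del: elts_inject)
  then show ?thesis by (simp add: is_pair_def univ opair_def)
qed

lemma maps_to_iff: "maps_to M f x y \<longleftrightarrow> opair x y \<in> elts f"
  by (simp add: maps_to_def is_pair_iff univ)

lemma rank_function_iff: "is_rank_function M f \<longleftrightarrow>
    (\<forall>p\<in>elts f. \<exists>x y. p = opair x y) \<and>
    (\<forall>x y z. opair x y \<in> elts f \<longrightarrow> opair x z \<in> elts f \<longrightarrow> y = z) \<and>
    (\<forall>x y. opair x y \<in> elts f \<longrightarrow> (\<forall>u\<in>elts x. \<exists>w. opair u w \<in> elts f) \<and>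
      (\<forall>z. z \<in> elts y \<longleftrightarrow> (\<exists>u\<in>elts x. \<exists>w. opair u w \<in> elts f \<and> (z \<in> elts w \<or> z = w))))"
  unfolding is_rank_function_def is_function_def maps_to_iff is_pair_iff
  by (simp add: univ Ball_def Bex_def)

lemma in_field:
  assumes "opair x y \<in> elts f" shows "x \<in> elts (un (un f))" "y \<in> elts (un (un f))"
proof -
  have "elts (un (opair x y)) \<subseteq> elts (un (un f))" using assms by auto
  then show "x \<in> elts (un (un f))" "y \<in> elts (un (un f))" using in_un_opair by blast+
qed

text \<open>
  The quantifiers in the definition of a rank function \<open>f\<close> range over the field of \<open>f\<close>, which is
  contained in \<open>\<Union>\<Union>f\<close>.
\<close>

lemma rank_function_bounded_iff: "is_rank_function M f \<longleftrightarrow>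
    (\<forall>p\<in>elts f. \<exists>x\<in>elts (un p). \<exists>y\<in>elts (un p). p = opair x y) \<and>
    (\<forall>x\<in>elts (un (un f)). \<forall>y\<in>elts (un (un f)). \<forall>z\<in>elts (un (un f)).
      opair x y \<in> elts f \<longrightarrow> opair x z \<in> elts f \<longrightarrow> y = z) \<and>
    (\<forall>x\<in>elts (un (un f)). \<forall>y\<in>elts (un (un f)). opair x y \<in> elts f \<longrightarrow>
      (\<forall>u\<in>elts x. \<exists>w\<in>elts (un (un f)). opair u w \<in> elts f) \<and>
      (\<forall>z\<in>elts y. \<exists>u\<in>elts x. \<exists>w\<in>elts (un (un f)). opair u w \<in> elts f \<and> (z \<in> elts w \<or> z = w)) \<and>
      (\<forall>u\<in>elts x. \<forall>w\<in>elts (un (un f)). opair u w \<in> elts f \<longrightarrow> w \<in> elts y \<and> elts w \<subseteq> elts y))"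
proof -
  let ?F = "elts (un (un f))"
  have F: "(\<exists>w. opair u w \<in> elts f \<and> R w) \<longleftrightarrow> (\<exists>w\<in>?F. opair u w \<in> elts f \<and> R w)" for u R
    using in_field by blast
  have F1: "(\<exists>w. opair u w \<in> elts f) \<longleftrightarrow> (\<exists>w\<in>?F. opair u w \<in> elts f)" for u
    using in_field by blast
  have "(\<forall>x y z. opair x y \<in> elts f \<longrightarrow> opair x z \<in> elts f \<longrightarrow> y = z) \<longleftrightarrow>
     (\<forall>x\<in>?F. \<forall>y\<in>?F. \<forall>z\<in>?F. opair x y \<in> elts f \<longrightarrow> opair x z \<in> elts f \<longrightarrow> y = z)"
    using in_field by meson
  moreover have "(\<forall>z. z \<in> elts y \<longleftrightarrow> (\<exists>u\<in>elts x. \<exists>w. opair u w \<in> elts f \<and> (z \<in> elts w \<or> z = w))) \<longleftrightarrow>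
      (\<forall>z\<in>elts y. \<exists>u\<in>elts x. \<exists>w\<in>?F. opair u w \<in> elts f \<and> (z \<in> elts w \<or> z = w)) \<and>
      (\<forall>u\<in>elts x. \<forall>w\<in>?F. opair u w \<in> elts f \<longrightarrow> w \<in> elts y \<and> elts w \<subseteq> elts y)" for x y
    unfolding F by blast
  moreover have "(\<forall>x y. opair x y \<in> elts f \<longrightarrow> R x y) \<longleftrightarrow> (\<forall>x\<in>?F. \<forall>y\<in>?F. opair x y \<in> elts f \<longrightarrow> R x y)" for R
    using in_field by meson
  ultimately show ?thesis
    unfolding rank_function_iff is_opair_iff[symmetric] F1 by presburger
qed

lemma Del1_rank_function0: "Del1 M (\<lambda>e. is_rank_function M (e 0))"
  unfolding rank_function_bounded_iff by (intro definable)

lemma Del1_rank_function [definable]: "Fun1 M s \<Longrightarrow> Del1 M (\<lambda>e. is_rank_function M (s e))"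
  by (rule Del1_subst1[of "is_rank_function M", OF Del1_rank_function0])

lemma rank_function_fun:
  "is_rank_function M f \<Longrightarrow> opair x y \<in> elts f \<Longrightarrow> opair x z \<in> elts f \<Longrightarrow> y = z"
  unfolding rank_function_iff by blast

lemma rank_function_dom:
  "is_rank_function M f \<Longrightarrow> opair x y \<in> elts f \<Longrightarrow> u \<in> elts x \<Longrightarrow> \<exists>w. opair u w \<in> elts f"
  unfolding rank_function_iff by blast

lemma rank_function_elts:
  "is_rank_function M f \<Longrightarrow> opair x y \<in> elts f \<Longrightarrow>
    elts y = {z. \<exists>u\<in>elts x. \<exists>w. opair u w \<in> elts f \<and> (z \<in> elts w \<or> z = w)}"
  unfolding rank_function_iff by blast

lemma rank_functionI:
  assumes "\<And>p. p \<in> elts f \<Longrightarrow> \<exists>x y. p = opair x y"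
    and "\<And>x y z. opair x y \<in> elts f \<Longrightarrow> opair x z \<in> elts f \<Longrightarrow> y = z"
    and "\<And>x y u. opair x y \<in> elts f \<Longrightarrow> u \<in> elts x \<Longrightarrow> \<exists>w. opair u w \<in> elts f"
    and "\<And>x y. opair x y \<in> elts f \<Longrightarrow>
      elts y = {z. \<exists>u\<in>elts x. \<exists>w. opair u w \<in> elts f \<and> (z \<in> elts w \<or> z = w)}"
  shows "is_rank_function M f"
  unfolding rank_function_iff
  by (intro conjI allI impI ballI) (use assms(1-3) in blast, use assms(2) in blast, use assms(3) in blast, 
    drule assms(4), simp)

lemma rank_functions_agree:
  assumes f: "is_rank_function M f" and g: "is_rank_function M g"
    and "opair x y \<in> elts f" "opair x z \<in> elts g"
  shows "y = z"
proof -
  let ?P = "\<lambda>x. \<forall>y\<in>elts (un (un f)). \<forall>z\<in>elts (un (un g)).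
    opair x y \<in> elts f \<longrightarrow> opair x z \<in> elts g \<longrightarrow> y = z"
  let ?R = "\<lambda>x f g. \<forall>y\<in>elts (un (un f)). \<forall>z\<in>elts (un (un g)).
    opair x y \<in> elts f \<longrightarrow> opair x z \<in> elts g \<longrightarrow> y = z"
  have D: "Sig1 M (\<lambda>e. ?R (e 0) (e 1) (e 2))"
    by (rule Sig1_Del1) (intro definable)
  have "?P x" if IH: "\<And>u. u \<in> elts x \<Longrightarrow> ?P u" for x
  proof (intro ballI impI)
    fix y z assume y: "opair x y \<in> elts f" and z: "opair x z \<in> elts g"
    have *: "v = w" if "u \<in> elts x" "opair u v \<in> elts f" "opair u w \<in> elts g" for u v w
      using IH[OF that(1)] that(2,3) in_field[OF that(2)] in_field[OF that(3)] by blast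
    have "opair u v \<in> elts f \<longleftrightarrow> opair u v \<in> elts g" if u: "u \<in> elts x" for u v
      using *[OF u] rank_function_dom[OF f y u] rank_function_dom[OF g z u] by metis
    then have "elts y = elts z"
      unfolding rank_function_elts[OF f y] rank_function_elts[OF g z] by simp
    then show "y = z" by simp
  qed
  then have "?P x" by (rule induct_param[where R = ?R, OF D])
  then show ?thesis using assms(3,4) in_field[OF assms(3)] in_field[OF assms(4)] by blast
qed

lemma rank_function_union:
  assumes g: "elts g = (\<Union>f\<in>A. elts f)" and A: "\<And>f. f \<in> A \<Longrightarrow> is_rank_function M f"
  shows "is_rank_function M g"
proof (rule rank_functionI)
  fix p assume "p \<in> elts g"
  then show "\<exists>x y. p = opair x y" using g A unfolding rank_function_iff by auto
next
  fix x y z assume "opair x y \<in> elts g" "opair x z \<in> elts g"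
  then obtain f f' where "f \<in> A" "f' \<in> A" "opair x y \<in> elts f" "opair x z \<in> elts f'"
    using g by auto
  then show "y = z" using rank_functions_agree A by metis
next
  fix x y u assume "opair x y \<in> elts g" "u \<in> elts x"
  then show "\<exists>w. opair u w \<in> elts g" using g rank_function_dom[OF A] by fastforce
next
  fix x y assume xy: "opair x y \<in> elts g"
  then obtain f where f: "f \<in> A" "opair x y \<in> elts f" using g by auto
  have "opair u w \<in> elts f \<longleftrightarrow> opair u w \<in> elts g" if u: "u \<in> elts x" for u w
  proof
    show "opair u w \<in> elts f \<Longrightarrow> opair u w \<in> elts g" using g f by blast
    assume w: "opair u w \<in> elts g"
    then obtain f' where f': "f' \<in> A" "opair u w \<in> elts f'" using g by auto
    obtain w' where w': "opair u w' \<in> elts f"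
      using rank_function_dom[OF A[OF f(1)] f(2) u] by blast
    then have "w = w'" using rank_functions_agree[OF A[OF f'(1)] A[OF f(1)]] f' by blast
    with w' show "opair u w \<in> elts f" by simp
  qed
  then show "elts y = {z. \<exists>u\<in>elts x. \<exists>w. opair u w \<in> elts g \<and> (z \<in> elts w \<or> z = w)}"
    unfolding rank_function_elts[OF A[OF f(1)] f(2)] by simp
qed

lemma rank_function_adj:
  assumes g: "is_rank_function M g" and dom: "\<And>u. u \<in> elts x \<Longrightarrow> \<exists>w. opair u w \<in> elts g"
    and new: "\<And>y. opair x y \<notin> elts g"
    and v: "elts v = {z. \<exists>u\<in>elts x. \<exists>w. opair u w \<in> elts g \<and> (z \<in> elts w \<or> z = w)}"
  shows "is_rank_function M (adj g (opair x v))" (is "is_rank_function M ?g")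
proof (rule rank_functionI)
  fix p assume "p \<in> elts ?g"
  then show "\<exists>x y. p = opair x y" using g unfolding rank_function_iff by auto
next
  fix x1 y z assume "opair x1 y \<in> elts ?g" "opair x1 z \<in> elts ?g"
  then show "y = z" using rank_function_fun[OF g] new by auto
next
  fix x1 y u assume "opair x1 y \<in> elts ?g" "u \<in> elts x1"
  then show "\<exists>w. opair u w \<in> elts ?g"
    using rank_function_dom[OF g] dom by (metis elts_adj insert_iff opair_inject)
next
  fix x1 y assume a: "opair x1 y \<in> elts ?g"
  then consider "opair x1 y \<in> elts g" | "x1 = x" "y = v" by auto
  then show "elts y = {z. \<exists>u\<in>elts x1. \<exists>w. opair u w \<in> elts ?g \<and> (z \<in> elts w \<or> z = w)}"
  proof cases
    case 1
    have "opair u w \<in> elts ?g \<longleftrightarrow> opair u w \<in> elts g" if "u \<in> elts x1" for u w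
      using rank_function_dom[OF g 1 that] new by auto
    then show ?thesis unfolding rank_function_elts[OF g 1] by simp
  next
    case 2
    have "opair u w \<in> elts ?g \<longleftrightarrow> opair u w \<in> elts g" if "u \<in> elts x" for u w
      using that mem_irrefl by auto
    then show ?thesis unfolding 2 v by simp
  qed
qed

text \<open>
  The recursion theorem for the rank: by \<open>\<Sigma>\<^sub>1\<close>-induction each element of \<open>x\<close> is in the domain of
  a rank function. Collection gathers such functions into a set, they agree on common arguments,
  and their union is extended to \<open>x\<close>.
\<close>

lemma rank_function_ex: "\<exists>f. is_rank_function M f \<and> (\<exists>y. opair x y \<in> elts f)"
proof -
  let ?B = "\<lambda>x f. is_rank_function M f \<and> (\<exists>y\<in>elts (un (un f)). opair x y \<in> elts f)"
  let ?P = "\<lambda>x. \<exists>f. ?B x f"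
  have Y: "(\<exists>y. opair x y \<in> elts f) \<longleftrightarrow> (\<exists>y\<in>elts (un (un f)). opair x y \<in> elts f)" for x f
    using in_field by blast
  have B: "Sig1 M (\<lambda>e. ?B (e 1) (e 0))" by (rule Sig1_Del1) (intro definable)
  then have D: "Sig1 M (\<lambda>e. ?P (e 0))" by (intro Sig1_ex) simp
  have "?P x" if IH: "\<And>u. u \<in> elts x \<Longrightarrow> ?P u" for x
  proof -
    obtain Y where Y': "\<And>u. u \<in> elts x \<Longrightarrow> \<exists>f\<in>elts Y. ?B u f"
      using collection_param[where R = "\<lambda>f u _ _ _. ?B u f", OF B IH] by blast
    have "Sig1 M (\<lambda>e. is_rank_function M (e 0))" by (rule Sig1_Del1) (intro definable)
    then obtain Y1 where Y1: "elts Y1 = {f \<in> elts Y. is_rank_function M f}"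
      using separation_param[where R = "\<lambda>f _ _ _. is_rank_function M f"] by blast
    define g where "g = un Y1"
    have g: "is_rank_function M g"
      by (rule rank_function_union[of _ "elts Y1"]) (auto simp: g_def Y1)
    have dom: "\<exists>w. opair u w \<in> elts g" if "u \<in> elts x" for u
      using Y'[OF that] by (auto simp: g_def Y1)
    show "?P x"
    proof (cases "\<exists>y. opair x y \<in> elts g")
      case True
      with g Y show ?thesis by blast
    next
      case False
      let ?z = "\<lambda>z. \<exists>u\<in>elts x. \<exists>w\<in>elts (un (un g)). opair u w \<in> elts g \<and> (z \<in> elts w \<or> z = w)"
      have "Sig1 M (\<lambda>e. \<exists>u\<in>elts (e 1). \<exists>w\<in>elts (un (un (e 2))).
          opair u w \<in> elts (e 2) \<and> (e 0 \<in> elts w \<or> e 0 = w))"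
        by (rule Sig1_Del1) (intro definable)
      from separation_param[where R = "\<lambda>z x g _. \<exists>u\<in>elts x. \<exists>w\<in>elts (un (un g)).
          opair u w \<in> elts g \<and> (z \<in> elts w \<or> z = w)", OF this]
      obtain v where "elts v = {z \<in> elts (un (upair (un (un (un g))) (un (un g)))). ?z z}" by blast
      then have "elts v = {z. ?z z}" by auto
      also have "\<dots> = {z. \<exists>u\<in>elts x. \<exists>w. opair u w \<in> elts g \<and> (z \<in> elts w \<or> z = w)}"
        using in_field(2)[of _ _ g] by (auto simp del: elts_un)
      finally have v: "elts v = \<dots>" .
      have "is_rank_function M (adj g (opair x v))"
        using rank_function_adj[OF g dom] False v by blast
      then show ?thesis using Y by (metis elts_adj insertI1)
    qed
  qed
  then have "?P x" by (rule induct_param[where R = "\<lambda>x _ _. ?P x", OF D])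
  then show ?thesis by blast
qed

abbreviation rk :: "'a \<Rightarrow> 'a" where "rk \<equiv> rank M"

lemma rank_eqI:
  assumes "is_rank_function M f" "opair x y \<in> elts f" shows "rk x = y"
  unfolding rank_def maps_to_iff univ using assms rank_functions_agree by (intro the_equality) auto

lemma rank_unique_ex: "\<exists>!\<alpha>. \<alpha> \<in> univ M \<and> (\<exists>f\<in>univ M. is_rank_function M f \<and> maps_to M f x \<alpha>)"
  unfolding maps_to_iff univ using rank_function_ex[of x] rank_functions_agree by auto

lemma elts_rank: "elts (rk x) = (\<Union>u\<in>elts x. insert (rk u) (elts (rk u)))"
proof -
  obtain f y where f: "is_rank_function M f" "opair x y \<in> elts f" using rank_function_ex by blast
  have "\<exists>w. opair u w \<in> elts f" if "u \<in> elts x" for u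
    using rank_function_dom[OF f that] .
  then have r: "opair u (rk u) \<in> elts f" if "u \<in> elts x" for u
    using rank_eqI[OF f(1)] that by blast
  have "opair u w \<in> elts f \<longleftrightarrow> w = rk u" if "u \<in> elts x" for u w
    using r[OF that] rank_eqI[OF f(1)] by blast
  then have "elts y = (\<Union>u\<in>elts x. insert (rk u) (elts (rk u)))"
    unfolding rank_function_elts[OF f] by auto
  with rank_eqI[OF f] show ?thesis by simp
qed

lemma Fun1_rank0: "Fun1 M (\<lambda>e. rk (e 0))"
proof (rule Fun1I)
  show "y = rk (e 0) \<longleftrightarrow> (\<exists>f. is_rank_function M f \<and> opair (e 0) y \<in> elts f)" for y and e :: "nat \<Rightarrow> 'a"
    using rank_function_ex rank_eqI by metis
qed (intro Sig1_ex Sig1_Del1, intro definable)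

lemma Fun1_rank [definable]: "Fun1 M s \<Longrightarrow> Fun1 M (\<lambda>e. rk (s e))"
  by (rule Fun1_subst1[of rk, OF Fun1_rank0])

section \<open>Ordinals\<close>

lemma Ord_in_Ord: "\<alpha> \<in> Ord M \<Longrightarrow> \<beta> \<in> elts \<alpha> \<Longrightarrow> \<beta> \<in> Ord M"
  unfolding Ord_iff by blast

lemma Ord_trans: "\<alpha> \<in> Ord M \<Longrightarrow> \<beta> \<in> elts \<alpha> \<Longrightarrow> \<gamma> \<in> elts \<beta> \<Longrightarrow> \<gamma> \<in> elts \<alpha>"
  unfolding Ord_iff by blast

lemma Ord_succ: "\<alpha> \<in> Ord M \<Longrightarrow> succ \<alpha> \<in> Ord M"
  unfolding Ord_iff by auto

lemma Ord_rank: "rk x \<in> Ord M"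
proof -
  have D: "Sig1 M (\<lambda>e. rk (e 0) \<in> Ord M)" by (rule Sig1_Del1) (intro definable)
  have "rk x \<in> Ord M" if IH: "\<And>u. u \<in> elts x \<Longrightarrow> rk u \<in> Ord M" for x
    using IH unfolding Ord_iff elts_rank[of x] by blast
  then show ?thesis by (rule induct_param[where R = "\<lambda>x _ _. rk x \<in> Ord M", OF D])
qed

lemma rank_Ord: assumes "\<alpha> \<in> Ord M" shows "rk \<alpha> = \<alpha>"
proof -
  have D: "Sig1 M (\<lambda>e. e 0 \<in> Ord M \<longrightarrow> rk (e 0) = e 0)" by (rule Sig1_Del1) (intro definable)
  have "\<alpha> \<in> Ord M \<longrightarrow> rk \<alpha> = \<alpha>" if IH: "\<And>u. u \<in> elts \<alpha> \<Longrightarrow> u \<in> Ord M \<longrightarrow> rk u = u" for \<alpha>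
  proof
    assume \<alpha>: "\<alpha> \<in> Ord M"
    then have "rk u = u" if "u \<in> elts \<alpha>" for u using IH Ord_in_Ord that by blast
    then have "elts (rk \<alpha>) = elts \<alpha>" unfolding elts_rank[of \<alpha>] using Ord_trans[OF \<alpha>] by auto
    then show "rk \<alpha> = \<alpha>" by simp
  qed
  then have "\<alpha> \<in> Ord M \<longrightarrow> rk \<alpha> = \<alpha>"
    by (rule induct_param[where R = "\<lambda>\<alpha> _ _. \<alpha> \<in> Ord M \<longrightarrow> rk \<alpha> = \<alpha>", OF D])
  with assms show ?thesis by simp
qed

lemma rank_rank [simp]: "rk (rk x) = rk x"
  by (rule rank_Ord[OF Ord_rank])

lemma small_diff: "small (elts x - elts y)"
proof -
  have "Sig1 M (\<lambda>e. e 0 \<notin> elts (e 1))" by (rule Sig1_Del1) (intro definable)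
  from small_param[where R = "\<lambda>u y _ _. u \<notin> elts y", OF this, of x y]
  show ?thesis by (simp add: set_diff_eq)
qed

text \<open>
  The usual double induction. The statement quantified over all \<open>\<beta>\<close> would be \<open>\<Pi>\<^sub>1\<close>, which is too
  complex for the available induction, so \<open>\<beta>\<close> is restricted to the elements of a fixed ordinal.
\<close>

lemma Ord_linear:
  assumes "\<alpha> \<in> Ord M" "\<beta> \<in> Ord M" shows "\<alpha> \<in> elts \<beta> \<or> \<alpha> = \<beta> \<or> \<beta> \<in> elts \<alpha>"
proof -
  let ?C = "\<lambda>\<alpha> \<beta>. \<alpha> \<in> elts \<beta> \<or> \<alpha> = \<beta> \<or> \<beta> \<in> elts \<alpha>"
  let ?P = "\<lambda>\<alpha>. \<alpha> \<in> Ord M \<longrightarrow> (\<forall>\<beta>'\<in>elts (succ \<beta>). ?C \<alpha> \<beta>')"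
  let ?B = "succ \<beta>"
  have B: "?B \<in> Ord M" by (rule Ord_succ[OF assms(2)])
  have step: "?P \<alpha>" if IH: "\<And>u. u \<in> elts \<alpha> \<Longrightarrow> ?P u" for \<alpha>
  proof
    assume \<alpha>: "\<alpha> \<in> Ord M"
    let ?Q = "\<lambda>\<gamma>. \<gamma> \<in> elts ?B \<longrightarrow> ?C \<alpha> \<gamma>"
    have "?Q \<gamma>" if IH2: "\<And>u. u \<in> elts \<gamma> \<Longrightarrow> ?Q u" for \<gamma>
    proof (rule impI, rule ccontr)
      assume \<gamma>: "\<gamma> \<in> elts ?B" and "\<not> ?C \<alpha> \<gamma>"
      then have n: "\<alpha> \<notin> elts \<gamma>" "\<alpha> \<noteq> \<gamma>" "\<gamma> \<notin> elts \<alpha>" by auto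
      have \<gamma>O: "\<gamma> \<in> Ord M" using Ord_in_Ord[OF B \<gamma>] .
      have "u \<in> elts \<gamma>" if u: "u \<in> elts \<alpha>" for u
      proof -
        have "?C u \<gamma>" using IH[OF u] Ord_in_Ord[OF \<alpha> u] \<gamma> by blast
        then show ?thesis using n u Ord_trans[OF \<alpha>] by blast
      qed
      moreover have "u \<in> elts \<alpha>" if u: "u \<in> elts \<gamma>" for u
      proof -
        have "?C \<alpha> u" using IH2[OF u] Ord_trans[OF B \<gamma> u] by blast
        then show ?thesis using n u Ord_trans[OF \<gamma>O] by blast
      qed
      ultimately have "elts \<alpha> = elts \<gamma>" by blast
      with n show False by simp
    qed
    moreover have D: "Sig1 M (\<lambda>e. e 0 \<in> elts (e 1) \<longrightarrow> ?C (e 2) (e 0))"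
      by (rule Sig1_Del1) (intro definable)
    ultimately have "?Q \<gamma>" for \<gamma>
      by (rule induct_param[where R = "\<lambda>\<gamma> B \<alpha>. \<gamma> \<in> elts B \<longrightarrow> ?C \<alpha> \<gamma>", rotated])
    then show "\<forall>\<beta>'\<in>elts ?B. ?C \<alpha> \<beta>'" by blast
  qed
  have "Sig1 M (\<lambda>e. e 0 \<in> Ord M \<longrightarrow> (\<forall>\<beta>'\<in>elts (e 1). ?C (e 0) \<beta>'))"
    by (rule Sig1_Del1) (intro definable)
  from this step have "?P \<alpha>"
    by (rule induct_param[where R = "\<lambda>\<alpha> B _. \<alpha> \<in> Ord M \<longrightarrow> (\<forall>\<beta>'\<in>elts B. ?C \<alpha> \<beta>')"])
  with assms show ?thesis by simp
qed

lemma Ord_subset_iff: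
  assumes "\<alpha> \<in> Ord M" "\<beta> \<in> Ord M" shows "elts \<alpha> \<subseteq> elts \<beta> \<longleftrightarrow> \<alpha> \<in> elts \<beta> \<or> \<alpha> = \<beta>"
  using Ord_linear[OF assms] Ord_trans[OF assms(2)] mem_irrefl by blast

lemma ord_le_iff:
  assumes "\<alpha> \<in> Ord M" "\<beta> \<in> Ord M" shows "ord_le M \<alpha> \<beta> \<longleftrightarrow> elts \<alpha> \<subseteq> elts \<beta>"
  using Ord_subset_iff[OF assms] by (auto simp: ord_le_def)

lemma rank_mem: "u \<in> elts x \<Longrightarrow> rk u \<in> elts (rk x)"
  unfolding elts_rank[of x] by blast

lemma rank_subset: "elts x \<subseteq> elts y \<Longrightarrow> elts (rk x) \<subseteq> elts (rk y)"
  unfolding elts_rank[of x] elts_rank[of y] by blast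

lemma rank_subset_Ord:
  assumes "\<alpha> \<in> Ord M" "\<And>u. u \<in> elts x \<Longrightarrow> rk u \<in> elts \<alpha>" shows "elts (rk x) \<subseteq> elts \<alpha>"
  unfolding elts_rank[of x] using assms Ord_trans by blast

lemma rank_zero [simp]: "rk zero = zero"
proof -
  have "elts (rk zero) = {}" unfolding elts_rank[of zero] by simp
  then show ?thesis by (metis elts_inject elts_zero)
qed

section \<open>The cumulative hierarchy\<close>

text \<open>
  Levels of the cumulative hierarchy are indexed by arbitrary sets instead of ordinals. This
  makes \<open>V\<close> a total \<open>\<Sigma>\<^sub>1\<close> function, which can be substituted into definitions.
\<close>

definition V :: "'a \<Rightarrow> 'a" where
  "V x = mk {y. rk y \<in> elts (rk x)}"

text \<open>
  The condition \<open>\<forall>y. rk y \<in> elts \<alpha> \<longrightarrow> y \<in> elts w\<close> with the quantifier bounded by the power set of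
  \<open>w\<close>. For an ordinal \<open>\<alpha>\<close> this amounts to the same, by induction on \<open>y\<close>.
\<close>

definition rank_closed :: "'a \<Rightarrow> 'a \<Rightarrow> bool" where
  "rank_closed w \<alpha> \<longleftrightarrow> (\<forall>y\<in>elts (pw w). rk y \<in> elts \<alpha> \<longrightarrow> y \<in> elts w)"

lemma rank_closed_all:
  assumes "rank_closed w \<alpha>" "\<alpha> \<in> Ord M" "rk y \<in> elts \<alpha>" shows "y \<in> elts w"
proof -
  let ?P = "\<lambda>y. rk y \<in> elts \<alpha> \<longrightarrow> y \<in> elts w"
  have D: "Sig1 M (\<lambda>e. rk (e 0) \<in> elts (e 1) \<longrightarrow> e 0 \<in> elts (e 2))"
    by (rule Sig1_Del1) (intro definable)
  have "?P y" if "\<And>u. u \<in> elts y \<Longrightarrow> ?P u" for y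
  proof
    assume y: "rk y \<in> elts \<alpha>"
    then have "u \<in> elts w" if "u \<in> elts y" for u
      using \<open>\<And>u. u \<in> elts y \<Longrightarrow> ?P u\<close>[OF that] rank_mem[OF that] Ord_trans[OF assms(2)] by blast
    then have "y \<in> elts (pw w)" by auto
    with y assms(1) show "y \<in> elts w" by (auto simp: rank_closed_def)
  qed
  then have "?P y"
    by (rule induct_param[where R = "\<lambda>y \<alpha> w. rk y \<in> elts \<alpha> \<longrightarrow> y \<in> elts w", OF D])
  with assms(3) show ?thesis by blast
qed

lemma rank_closed_ex: "\<exists>w. rank_closed w \<alpha>"
proof -
  have D: "Sig1 M (\<lambda>e. rank_closed (e 0) (e 1))"
    unfolding rank_closed_def by (rule Sig1_Del1) (intro definable)
  then have D': "Sig1 M (\<lambda>e. \<exists>w. rank_closed w (e 0))" by (intro Sig1_ex) simp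
  have "\<exists>w. rank_closed w \<alpha>" if IH: "\<And>u. u \<in> elts \<alpha> \<Longrightarrow> \<exists>w. rank_closed w u" for \<alpha>
  proof -
    obtain Y where Y: "\<And>u. u \<in> elts \<alpha> \<Longrightarrow> \<exists>w\<in>elts Y. rank_closed w u"
      using collection_param[where R = "\<lambda>w u _ _ _. rank_closed w u", OF D IH] by blast
    have "rank_closed (pw (un Y)) \<alpha>" unfolding rank_closed_def
    proof (intro ballI impI)
      fix y assume "rk y \<in> elts \<alpha>"
      then obtain w where "w \<in> elts Y" "rank_closed w (rk y)" using Y by blast
      then have "u \<in> elts (un Y)" if "u \<in> elts y" for u
        using rank_closed_all[OF _ Ord_rank rank_mem[OF that]] by auto
      then show "y \<in> elts (pw (un Y))" by (auto simp del: elts_un)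
    qed
    then show ?thesis ..
  qed
  then show ?thesis by (rule induct_param[where R = "\<lambda>\<alpha> _ _. \<exists>w. rank_closed w \<alpha>", OF D'])
qed

lemma small_V: "small {y. rk y \<in> elts (rk x)}"
proof -
  obtain w where "rank_closed w (rk x)" using rank_closed_ex by blast
  then have *: "rk y \<in> elts (rk x) \<Longrightarrow> y \<in> elts w" for y using rank_closed_all Ord_rank by blast
  have "Sig1 M (\<lambda>e. rk (e 0) \<in> elts (rk (e 1)))" by (rule Sig1_Del1) (intro definable)
  from small_param[where R = "\<lambda>u x _ _. rk u \<in> elts (rk x)", OF this, of w x]
  have "small {u \<in> elts w. rk u \<in> elts (rk x)}" .
  also have "{u \<in> elts w. rk u \<in> elts (rk x)} = {y. rk y \<in> elts (rk x)}" using * by blast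
  finally show ?thesis .
qed

lemma elts_V [simp]: "elts (V x) = {y. rk y \<in> elts (rk x)}"
  by (simp add: V_def small_V)

lemma Fun1_V0: "Fun1 M (\<lambda>e. V (e 0))"
proof (rule Fun1I')
  show "y = V (e 0) \<longleftrightarrow> (\<forall>z\<in>elts y. rk z \<in> elts (rk (e 0))) \<and> rank_closed y (rk (e 0))"
    for y and e :: "nat \<Rightarrow> 'a"
  proof
    assume y: "(\<forall>z\<in>elts y. rk z \<in> elts (rk (e 0))) \<and> rank_closed y (rk (e 0))"
    have "elts y = elts (V (e 0))"
      using y rank_closed_all[of y "rk (e 0)", OF _ Ord_rank] by auto
    then show "y = V (e 0)" unfolding elts_inject .
  next
    assume "y = V (e 0)"
    then show "(\<forall>z\<in>elts y. rk z \<in> elts (rk (e 0))) \<and> rank_closed y (rk (e 0))"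
      by (simp add: rank_closed_def)
  qed
qed (unfold rank_closed_def, intro definable)

lemma Fun1_V [definable]: "Fun1 M s \<Longrightarrow> Fun1 M (\<lambda>e. V (s e))"
  by (rule Fun1_subst1[of V, OF Fun1_V0])

section \<open>Numerals and ranks of pairs\<close>

fun num :: "nat \<Rightarrow> 'a" where
  "num 0 = zero"
| "num (Suc k) = succ (num k)"

lemma Fun1_num [definable]: "Fun1 M (\<lambda>e. num k)"
proof (induction k)
  case 0
  show ?case unfolding num.simps by (intro definable)
next
  case (Suc k)
  show ?case unfolding num.simps by (intro definable Suc)
qed

lemma elts_num: "elts (num k) = num ` {..<k}"
  by (induction k) (auto simp: lessThan_Suc)

lemma num_inject [simp]: "num j = num k \<longleftrightarrow> j = k"
proof -
  have "num j \<noteq> num k" if "j < k" for j k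
  proof -
    have "num j \<in> elts (num k)" using that by (simp add: elts_num)
    then show ?thesis using mem_irrefl by metis
  qed
  then show ?thesis by (metis linorder_neqE_nat)
qed

lemma rank_opair: "rk x \<in> elts (rk (opair x y))" "rk y \<in> elts (rk (opair x y))"
proof -
  have *: "rk w \<in> elts (rk (opair x y))" if "w \<in> elts u" "u \<in> elts (opair x y)" for u w
    by (rule Ord_trans[OF Ord_rank rank_mem[OF that(2)] rank_mem[OF that(1)]])
  have "upair x x \<in> elts (opair x y)" "upair x y \<in> elts (opair x y)" by (simp_all add: opair_def)
  then show "rk x \<in> elts (rk (opair x y))" "rk y \<in> elts (rk (opair x y))"
    using *[of x "upair x x"] *[of y "upair x y"] by simp_all
qed

section \<open>Infinitary formulas\<close>

text \<open>
  A position \<open>a\<close> is a set of pairs \<open>opair z x\<close>, which gives the element \<open>x\<close> the name \<open>z\<close>.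
\<close>

definition upd :: "'a \<Rightarrow> 'a \<Rightarrow> 'a \<Rightarrow> 'a" where
  "upd a z y = adj a (opair z y)"

lemma Fun1_upd [definable]:
  "Fun1 M s \<Longrightarrow> Fun1 M t \<Longrightarrow> Fun1 M u \<Longrightarrow> Fun1 M (\<lambda>e. upd (s e) (t e) (u e))"
  unfolding upd_def by (intro definable)

text \<open>
  A formula consists of a tag, which determines its kind, and two components. The meaning of the
  five tags is fixed by \<open>clause\<close>.
\<close>

definition fml :: "nat \<Rightarrow> 'a \<Rightarrow> 'a \<Rightarrow> 'a" where
  "fml k z X = opair (num k) (opair z X)"

text \<open>
  \<open>H\<close> is a set of pairs \<open>opair s a\<close>, each of which claims that the formula \<open>s\<close> holds at the
  position \<open>a\<close>. The clause justifies one such claim by others in \<open>H\<close>. The formulas with tags 0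
  and 1 express that one named element is, or is not, a member of another, those with tag 2 that
  an element is a given constant. Those with tag 3 are \<open>\<exists>y. \<And>X\<close>, where the witness \<open>y\<close> gets the
  name \<open>z\<close>. The bound \<open>V H\<close> on \<open>y\<close> keeps the clause \<open>\<Delta>\<^sub>1\<close>. Those with tag 4 are \<open>\<forall>y. \<Or>X\<close> with
  \<open>y\<close> of smaller rank than the position. Negation is absent, which makes the clause monotone in
  \<open>H\<close>.
\<close>

definition clause :: "'a \<Rightarrow> 'a \<Rightarrow> 'a \<Rightarrow> bool" where
  "clause H a s \<longleftrightarrow>
    pfst s = num 0 \<and> (\<exists>x\<in>elts (un (un a)). \<exists>y\<in>elts (un (un a)).
      opair (pfst (psnd s)) x \<in> elts a \<and> opair (psnd (psnd s)) y \<in> elts a \<and> x \<in> elts y) \<or>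
    pfst s = num 1 \<and> (\<exists>x\<in>elts (un (un a)). \<exists>y\<in>elts (un (un a)).
      opair (pfst (psnd s)) x \<in> elts a \<and> opair (psnd (psnd s)) y \<in> elts a \<and> x \<notin> elts y) \<or>
    pfst s = num 2 \<and> psnd s \<in> elts a \<or>
    pfst s = num 3 \<and> (\<exists>y\<in>elts (V H). \<forall>t\<in>elts (psnd (psnd s)).
      opair t (upd a (pfst (psnd s)) y) \<in> elts H) \<or>
    pfst s = num 4 \<and> (\<forall>y\<in>elts (V a). \<exists>t\<in>elts (psnd (psnd s)).
      opair t (upd a (pfst (psnd s)) y) \<in> elts H)"

definition consistent :: "'a \<Rightarrow> bool" where
  "consistent H \<longleftrightarrow> (\<forall>p\<in>elts H. clause H (psnd p) (pfst p))"

text \<open>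
  Truth is membership in a set of claims that justify each other. In this form it is \<open>\<Sigma>\<^sub>1\<close>
  without an appeal to recursion, it becomes \<open>\<Delta>\<^sub>1\<close> if the set is bounded by \<open>B\<close>, and it is
  monotone in \<open>B\<close>.
\<close>

definition holds_in :: "'a \<Rightarrow> 'a \<Rightarrow> 'a \<Rightarrow> bool" where
  "holds_in B a s \<longleftrightarrow> (\<exists>H\<in>elts (pw B). consistent H \<and> opair s a \<in> elts H)"

definition holds :: "'a \<Rightarrow> 'a \<Rightarrow> bool" where
  "holds a s \<longleftrightarrow> (\<exists>B. holds_in B a s)"

lemma Del1_consistent0: "Del1 M (\<lambda>e. consistent (e 0))"
  unfolding consistent_def clause_def by (intro definable)

lemma Del1_consistent [definable]: "Fun1 M s \<Longrightarrow> Del1 M (\<lambda>e. consistent (s e))"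
  by (rule Del1_subst1[of consistent, OF Del1_consistent0])

lemma Del1_holds_in0: "Del1 M (\<lambda>e. holds_in (e 0) (e 1) (e 2))"
  unfolding holds_in_def by (intro definable)

lemma Del1_holds_in [definable]:
  "Fun1 M s \<Longrightarrow> Fun1 M t \<Longrightarrow> Fun1 M u \<Longrightarrow> Del1 M (\<lambda>e. holds_in (s e) (t e) (u e))"
  by (rule Del1_subst3[of holds_in, OF Del1_holds_in0])

lemma Sig1_holds0: "Sig1 M (\<lambda>e. holds (e 0) (e 1))"
  unfolding holds_def by (intro Sig1_ex Sig1_Del1, intro definable)

lemma Sig1_holds: "Fun1 M s \<Longrightarrow> Fun1 M t \<Longrightarrow> Sig1 M (\<lambda>e. holds (s e) (t e))"
  by (rule Sig1_subst2[of holds, OF Sig1_holds0])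

lemma clause_mono:
  assumes "elts H \<subseteq> elts H'" "clause H a s" shows "clause H' a s"
proof -
  have "elts (V H) \<subseteq> elts (V H')" using rank_subset[OF assms(1)] by auto
  then show ?thesis using assms unfolding clause_def by blast
qed

lemma holds_in_mono: "elts B \<subseteq> elts B' \<Longrightarrow> holds_in B a s \<Longrightarrow> holds_in B' a s"
  unfolding holds_in_def by auto

text \<open>
  By monotonicity of the clauses, consistent sets are closed under unions.
\<close>

lemma largest_consistent:
  "\<exists>H\<in>elts (pw B). consistent H \<and> (\<forall>a s. holds_in B a s \<longrightarrow> opair s a \<in> elts H)"
proof -
  have "Sig1 M (\<lambda>e. consistent (e 0))" by (rule Sig1_Del1) (intro definable)
  from separation_param[where R = "\<lambda>H _ _ _. consistent H", OF this]
  obtain Y where Y: "elts Y = {H \<in> elts (pw B). consistent H}" by blast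
  have "consistent (un Y)" unfolding consistent_def
  proof
    fix p assume "p \<in> elts (un Y)"
    then obtain H where H: "H \<in> elts Y" "p \<in> elts H" by auto
    then have "clause H (psnd p) (pfst p)" using Y by (auto simp: consistent_def)
    then show "clause (un Y) (psnd p) (pfst p)" by (rule clause_mono[rotated]) (use H in auto)
  qed
  moreover have "un Y \<in> elts (pw B)" using Y by auto
  moreover have "opair s a \<in> elts (un Y)" if "holds_in B a s" for a s
    using that Y unfolding holds_in_def by auto
  ultimately show ?thesis by blast
qed

lemma holds_uniform:
  assumes "\<And>t. t \<in> elts X \<Longrightarrow> holds a t" shows "\<exists>B. \<forall>t\<in>elts X. holds_in B a t"
proof -
  have "Sig1 M (\<lambda>e. holds_in (e 0) (e 2) (e 1))" by (rule Sig1_Del1) (intro definable)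
  from collection_param[where R = "\<lambda>B t a _ _. holds_in B a t", OF this] assms
  obtain Y where "\<And>t. t \<in> elts X \<Longrightarrow> \<exists>B\<in>elts Y. holds_in B a t" unfolding holds_def by blast
  moreover have "elts B \<subseteq> elts (un Y)" if "B \<in> elts Y" for B using that by auto
  ultimately show ?thesis using holds_in_mono by meson
qed

text \<open>
  A claim may be added to a consistent set that justifies it.
\<close>

lemma holds_by_clause:
  assumes "elts H \<subseteq> elts H'" "consistent H" "elts H' = insert (opair s a) (elts H)" "clause H' a s"
  shows "holds a s"
proof -
  have "consistent H'" unfolding consistent_def
  proof
    fix p assume p: "p \<in> elts H'"
    show "clause H' (psnd p) (pfst p)"
    proof (cases "p = opair s a")
      case True
      with assms(4) show ?thesis by simp
    next
      case False
      with p assms have "clause H (psnd p) (pfst p)" by (simp add: consistent_def)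
      with clause_mono assms(1) show ?thesis by blast
    qed
  qed
  then have "holds_in H' a s" unfolding holds_in_def by (intro bexI[of _ H']) (auto simp: assms(3))
  then show ?thesis by (auto simp: holds_def)
qed

lemma holds_atomic:
  assumes "\<And>H. clause H a s" shows "holds a s"
proof (rule holds_by_clause[of zero "adj zero (opair s a)"])
  show "consistent zero" by (simp add: consistent_def)
qed (use assms in auto)

lemma holds_mem:
  assumes "opair z x \<in> elts a" "opair w y \<in> elts a" "x \<in> elts y" shows "holds a (fml 0 z w)"
proof (rule holds_atomic)
  show "clause H a (fml 0 z w)" for H
    unfolding clause_def fml_def using assms in_field by (simp del: elts_un) blast
qed

lemma holds_not_mem:
  assumes "opair z x \<in> elts a" "opair w y \<in> elts a" "x \<notin> elts y" shows "holds a (fml 1 z w)"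
proof (rule holds_atomic)
  show "clause H a (fml 1 z w)" for H
    unfolding clause_def fml_def using assms in_field by (simp del: elts_un num.simps) blast
qed

lemma holds_const:
  assumes "opair z c \<in> elts a" shows "holds a (fml 2 z c)"
  by (rule holds_atomic) (simp add: clause_def fml_def assms del: num.simps)

lemma holds_ex:
  assumes "\<And>t. t \<in> elts X \<Longrightarrow> holds (upd a z y) t" shows "holds a (fml 3 z X)"
proof -
  obtain B where B: "\<And>t. t \<in> elts X \<Longrightarrow> holds_in B (upd a z y) t"
    using holds_uniform[of X "upd a z y"] assms by blast
  obtain H where H: "consistent H" "\<And>a s. holds_in B a s \<Longrightarrow> opair s a \<in> elts H"
    using largest_consistent by blast
  let ?H = "adj H (opair (fml 3 z X) a)"
  have "\<exists>y\<in>elts (V ?H). \<forall>t\<in>elts X. opair t (upd a z y) \<in> elts ?H"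
  proof (cases "elts X = {}")
    case True
    have "rk (opair (fml 3 z X) a) \<in> elts (rk ?H)" by (rule rank_mem) simp
    then have "rk a \<in> elts (rk ?H)" by (rule Ord_trans[OF Ord_rank _ rank_opair(2)])
    with True show ?thesis by auto
  next
    case False
    then obtain t where t: "t \<in> elts X" by blast
    have "rk (opair t (upd a z y)) \<in> elts (rk ?H)" by (rule rank_mem) (use H B t in simp)
    then have "rk (upd a z y) \<in> elts (rk ?H)" by (rule Ord_trans[OF Ord_rank _ rank_opair(2)])
    moreover have "rk (opair z y) \<in> elts (rk (upd a z y))" by (rule rank_mem) (simp add: upd_def)
    ultimately have "rk y \<in> elts (rk ?H)" using Ord_trans[OF Ord_rank] rank_opair(2) by blast
    with H B show ?thesis by auto
  qed
  then have "clause ?H a (fml 3 z X)" by (simp add: clause_def fml_def del: num.simps elts_V)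
  then show ?thesis by (intro holds_by_clause[of H ?H] H(1)) auto
qed

lemma holds_all:
  assumes "\<And>y. rk y \<in> elts (rk a) \<Longrightarrow> \<exists>t\<in>elts X. holds (upd a z y) t" shows "holds a (fml 4 z X)"
proof -
  have D: "Sig1 M (\<lambda>e. \<exists>t\<in>elts (e 4). holds_in (e 0) (upd (e 2) (e 3) (e 1)) t)"
    by (rule Sig1_Del1) (intro definable)
  have "\<exists>B. \<exists>t\<in>elts X. holds_in B (upd a z y) t" if "y \<in> elts (V a)" for y
    using assms[of y] that by (auto simp: holds_def)
  from collection_param[where R = "\<lambda>B y a z X. \<exists>t\<in>elts X. holds_in B (upd a z y) t", OF D this]
  obtain Y where Y: "\<And>y. y \<in> elts (V a) \<Longrightarrow> \<exists>B\<in>elts Y. \<exists>t\<in>elts X. holds_in B (upd a z y) t" by blast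
  have Y': "\<exists>t\<in>elts X. holds_in (un Y) (upd a z y) t" if y: "y \<in> elts (V a)" for y
  proof -
    obtain B t where "B \<in> elts Y" "t \<in> elts X" "holds_in B (upd a z y) t" using Y[OF y] by blast
    moreover from this have "elts B \<subseteq> elts (un Y)" by auto
    ultimately show ?thesis using holds_in_mono by blast
  qed
  obtain H where H: "consistent H" "\<And>a s. holds_in (un Y) a s \<Longrightarrow> opair s a \<in> elts H"
    using largest_consistent by blast
  let ?H = "adj H (opair (fml 4 z X) a)"
  have "\<forall>y\<in>elts (V a). \<exists>t\<in>elts X. opair t (upd a z y) \<in> elts ?H"
  proof
    fix y assume "y \<in> elts (V a)"
    from Y'[OF this] H(2) show "\<exists>t\<in>elts X. opair t (upd a z y) \<in> elts ?H" by auto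
  qed
  then have "clause ?H a (fml 4 z X)" by (simp add: clause_def fml_def del: num.simps elts_V)
  then show ?thesis by (intro holds_by_clause[of H ?H] H(1)) auto
qed

text \<open>
  The elimination rules are for \<open>holds_in B\<close>: the claims that justify a claim in \<open>H\<close> are
  themselves in \<open>H\<close>, so the bound \<open>B\<close> is not lost when a formula is analysed.
\<close>

lemma holds_inE:
  assumes "holds_in B a s"
  obtains H where "elts H \<subseteq> elts B" "\<And>a' t. opair t a' \<in> elts H \<Longrightarrow> holds_in B a' t" 
    "opair s a \<in> elts H" "clause H a s"
proof -
  obtain H where H: "H \<in> elts (pw B)" "consistent H" "opair s a \<in> elts H"
    using assms unfolding holds_in_def by blast
  then have "clause H (psnd (opair s a)) (pfst (opair s a))" unfolding consistent_def by blast
  with H show ?thesis by (intro that[of H]) (auto simp: holds_in_def)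
qed

lemma holds_in_rank:
  assumes "holds_in B a s" shows "rk a \<in> elts (rk B)"
proof -
  obtain H where H: "elts H \<subseteq> elts B" "opair s a \<in> elts H" by (rule holds_inE[OF assms]) blast
  then have "rk (opair s a) \<in> elts (rk B)" by (intro rank_mem) auto
  then show ?thesis by (rule Ord_trans[OF Ord_rank _ rank_opair(2)])
qed

lemma holds_in_mem:
  assumes "holds_in B a (fml 0 z w)"
  shows "\<exists>x y. opair z x \<in> elts a \<and> opair w y \<in> elts a \<and> x \<in> elts y"
  by (rule holds_inE[OF assms]) (auto simp: clause_def fml_def simp del: num.simps)

lemma holds_in_not_mem:
  assumes "holds_in B a (fml 1 z w)"
  shows "\<exists>x y. opair z x \<in> elts a \<and> opair w y \<in> elts a \<and> x \<notin> elts y"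
  by (rule holds_inE[OF assms]) (auto simp: clause_def fml_def simp del: num.simps)

lemma holds_in_const:
  assumes "holds_in B a (fml 2 z c)" shows "opair z c \<in> elts a"
  by (rule holds_inE[OF assms]) (simp add: clause_def fml_def del: num.simps)

lemma holds_in_ex:
  assumes "holds_in B a (fml 3 z X)"
  shows "\<exists>y. \<forall>t\<in>elts X. holds_in B (upd a z y) t"
proof -
  obtain H where H: "\<And>a' t. opair t a' \<in> elts H \<Longrightarrow> holds_in B a' t" "clause H a (fml 3 z X)"
    by (rule holds_inE[OF assms]) blast
  from H(2) have "\<exists>y\<in>elts (V H). \<forall>t\<in>elts X. opair t (upd a z y) \<in> elts H"
    by (simp add: clause_def fml_def del: num.simps elts_V)
  with H(1) show ?thesis by blast
qed

lemma holds_in_all: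
  assumes "holds_in B a (fml 4 z X)" "rk y \<in> elts (rk a)"
  shows "\<exists>t\<in>elts X. holds_in B (upd a z y) t"
proof -
  obtain H where H: "\<And>a' t. opair t a' \<in> elts H \<Longrightarrow> holds_in B a' t" "clause H a (fml 4 z X)"
    by (rule holds_inE[OF assms(1)]) blast
  from H(2) have "\<forall>y\<in>elts (V a). \<exists>t\<in>elts X. opair t (upd a z y) \<in> elts H"
    by (simp add: clause_def fml_def del: num.simps elts_V)
  with H(1) assms(2) show ?thesis by simp blast
qed

end

section \<open>Topless rank-initial substructures\<close>

locale rank_cut = set_model +
  fixes S :: "'a set"
  assumes S_initial: "m \<in> S \<Longrightarrow> ord_le M (rank M n) (rank M m) \<Longrightarrow> n \<in> S"
    and S_bounded: "\<exists>\<alpha>\<in>Ord M. \<forall>m\<in>S. rank M m \<in> elts \<alpha>"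
    and S_topless: "\<not> (\<exists>\<beta>\<in>Ord M - S. \<forall>\<gamma>\<in>Ord M - S. ord_le M \<beta> \<gamma>)"
begin

lemma S_rank_le: "m \<in> S \<Longrightarrow> elts (rk n) \<subseteq> elts (rk m) \<Longrightarrow> n \<in> S"
  using S_initial[of m n] ord_le_iff[OF Ord_rank Ord_rank] by blast

lemma Ord_outside: obtains \<alpha> where "\<alpha> \<in> Ord M - S"
proof -
  obtain \<alpha> where \<alpha>: "\<alpha> \<in> Ord M" "\<forall>m\<in>S. rk m \<in> elts \<alpha>" using S_bounded by blast
  then have "\<alpha> \<notin> S" using rank_Ord[OF \<alpha>(1)] mem_irrefl by metis
  with \<alpha> that show ?thesis by blast
qed

text \<open>
  Toplessness enters in this form: below each ordinal outside \<open>S\<close> there is another one.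
\<close>

lemma outside_lower:
  assumes "\<theta> \<in> Ord M - S" obtains \<theta>' where "\<theta>' \<in> Ord M - S" "\<theta>' \<in> elts \<theta>"
proof -
  obtain \<gamma> where \<gamma>: "\<gamma> \<in> Ord M - S" "\<not> ord_le M \<theta> \<gamma>" using S_topless assms by blast
  then have "\<gamma> \<in> elts \<theta>" using Ord_linear[of \<theta> \<gamma>] assms by (auto simp: ord_le_def)
  with \<gamma> that show ?thesis by blast
qed

lemma S_below_outside:
  assumes "x \<in> S" "\<theta> \<in> Ord M - S" shows "rk x \<in> elts \<theta>"
proof (rule ccontr)
  assume "rk x \<notin> elts \<theta>"
  then have "elts \<theta> \<subseteq> elts (rk x)"
    using Ord_linear[of \<theta> "rk x"] Ord_rank Ord_subset_iff[of \<theta> "rk x"] assms(2) by blast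
  then have "\<theta> \<in> S" using S_rank_le[OF assms(1), of \<theta>] rank_Ord[of \<theta>] assms(2) by auto
  with assms(2) show False by blast
qed

lemma not_outsideI:
  assumes "\<And>\<theta>. \<theta> \<in> Ord M - S \<Longrightarrow> rk x \<in> elts \<theta>" shows "x \<in> S"
proof (rule ccontr)
  assume x: "x \<notin> S"
  then have "rk x \<notin> S" using S_rank_le[of "rk x" x] by auto
  then have "rk x \<in> Ord M - S" using Ord_rank by blast
  with assms mem_irrefl show False by blast
qed

lemma zero_in_S: "zero \<in> S"
proof (rule not_outsideI)
  fix \<theta> assume "\<theta> \<in> Ord M - S"
  then obtain \<theta>' where "\<theta>' \<in> elts \<theta>" by (rule outside_lower)
  then have "\<theta> \<noteq> zero" by auto
  moreover have "zero \<in> Ord M" using Ord_rank[of zero] by simp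
  ultimately show "rk zero \<in> elts \<theta>" using Ord_linear[of zero \<theta>] \<open>\<theta> \<in> Ord M - S\<close> by auto
qed

lemma rank_upair_le:
  assumes "\<alpha> \<in> Ord M" "rk x \<in> elts \<alpha>" "rk y \<in> elts \<alpha>" shows "elts (rk (upair x y)) \<subseteq> elts \<alpha>"
  by (rule rank_subset_Ord[OF assms(1)]) (use assms in auto)

lemma rank_mem_of_le:
  assumes "elts (rk x) \<subseteq> elts \<alpha>" "\<alpha> \<in> elts \<beta>" "\<beta> \<in> Ord M" shows "rk x \<in> elts \<beta>"
  using assms Ord_subset_iff[OF Ord_rank Ord_in_Ord[OF assms(3,2)], of x] Ord_trans[OF assms(3,2)] by blast

lemma rank_opair_mem:
  assumes "rk x \<in> elts \<alpha>" "rk y \<in> elts \<alpha>" "\<alpha> \<in> elts \<beta>" "\<beta> \<in> elts \<gamma>" "\<gamma> \<in> Ord M"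
  shows "rk (opair x y) \<in> elts \<gamma>"
proof -
  have O: "\<beta> \<in> Ord M" "\<alpha> \<in> Ord M" using assms Ord_in_Ord by blast+
  have "rk (upair x x) \<in> elts \<beta>" "rk (upair x y) \<in> elts \<beta>"
    using rank_mem_of_le[OF rank_upair_le[OF O(2)] assms(3) O(1)] assms(1,2) by blast+
  from rank_mem_of_le[OF rank_upair_le[OF O(1) this] assms(4,5)] show ?thesis by (simp add: opair_def)
qed

lemma num_in_S: "num k \<in> S"
proof (induction k)
  case (Suc k)
  show ?case
  proof (rule not_outsideI)
    fix \<theta> assume \<theta>: "\<theta> \<in> Ord M - S"
    then obtain \<theta>' where \<theta>': "\<theta>' \<in> Ord M - S" "\<theta>' \<in> elts \<theta>" by (rule outside_lower)
    have k: "rk (num k) \<in> elts \<theta>'" by (rule S_below_outside[OF Suc \<theta>'(1)])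
    have "rk u \<in> elts \<theta>'" if "u \<in> elts (num (Suc k))" for u
      using that k Ord_trans[OF _ k rank_mem[of u "num k"]] \<theta>'(1) by auto
    then have "elts (rk (num (Suc k))) \<subseteq> elts \<theta>'" using \<theta>'(1) by (intro rank_subset_Ord) auto
    then show "rk (num (Suc k)) \<in> elts \<theta>"
      using \<theta>' \<theta> by (intro rank_mem_of_le[of _ \<theta>']) auto
  qed
qed (simp add: zero_in_S)

text \<open>
  Coding a formula increases the rank by a fixed finite amount, and \<open>outside_lower\<close> can be
  applied any finite number of times.
\<close>

lemma level_for_fmls:
  assumes "\<theta> \<in> Ord M - S"
  obtains \<theta>' where "\<theta>' \<in> Ord M - S" "\<theta>' \<in> elts \<theta>"
    "\<And>k z X. z \<in> S \<Longrightarrow> elts (rk X) \<subseteq> elts \<theta>' \<Longrightarrow> rk (fml k z X) \<in> elts \<theta>"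
proof -
  obtain \<theta>1 where 1: "\<theta>1 \<in> Ord M - S" "\<theta>1 \<in> elts \<theta>" by (rule outside_lower[OF assms])
  obtain \<theta>2 where 2: "\<theta>2 \<in> Ord M - S" "\<theta>2 \<in> elts \<theta>1" by (rule outside_lower[OF 1(1)])
  obtain \<theta>3 where 3: "\<theta>3 \<in> Ord M - S" "\<theta>3 \<in> elts \<theta>2" by (rule outside_lower[OF 2(1)])
  obtain \<theta>4 where 4: "\<theta>4 \<in> Ord M - S" "\<theta>4 \<in> elts \<theta>3" by (rule outside_lower[OF 3(1)])
  obtain \<theta>5 where 5: "\<theta>5 \<in> Ord M - S" "\<theta>5 \<in> elts \<theta>4" by (rule outside_lower[OF 4(1)])
  have "rk (fml k z X) \<in> elts \<theta>" if z: "z \<in> S" and X: "elts (rk X) \<subseteq> elts \<theta>5" for k z X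
  proof -
    have "rk X \<in> elts \<theta>4" using X 4 5 by (intro rank_mem_of_le[of _ \<theta>5]) auto
    then have "rk (opair z X) \<in> elts \<theta>2"
      using S_below_outside[OF z 4(1)] 2 3 4
      by (elim DiffE) (rule rank_opair_mem[of _ \<theta>4 _ \<theta>3 \<theta>2])
    then show ?thesis unfolding fml_def
      using S_below_outside[OF num_in_S 2(1)] 1 2 assms
      by (elim DiffE) (rule rank_opair_mem[of _ \<theta>2 _ \<theta>1 \<theta>])
  qed
  moreover have "\<theta>5 \<in> elts \<theta>"
    using 1 2 3 4 5 assms Ord_trans by (metis DiffD1)
  ultimately show ?thesis using that 5(1) by blast
qed

section \<open>The invariant\<close>

text \<open>
  The element that was added as number \<open>j\<close> is named by the numeral \<open>j\<close>. The most recent element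
  is at the head of the list.
\<close>

fun pos :: "'a list \<Rightarrow> 'a" where
  "pos [] = zero"
| "pos (x # xs) = upd (pos xs) (num (length xs)) x"

text \<open>
  The elements on the left of \<open>ps\<close> are to be mapped to those on the right. The ordinal \<open>\<theta>\<close> lies
  outside \<open>S\<close>, so the condition covers all formulas that belong to \<open>S\<close> and some more. The latter
  are what the steps below live on.
\<close>

definition approx :: "('a \<times> 'a) list \<Rightarrow> 'a \<Rightarrow> 'a \<Rightarrow> bool" where
  "approx ps B \<theta> \<longleftrightarrow> \<theta> \<in> Ord M - S \<and>
    (\<forall>t. rk t \<in> elts \<theta> \<longrightarrow> holds (pos (map fst ps)) t \<longrightarrow> holds_in B (pos (map snd ps)) t)"

lemma pos_name_less: "opair (num j) x \<in> elts (pos xs) \<Longrightarrow> j < length xs"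
  by (induction xs) (auto simp: upd_def)

lemma pos_lookup:
  "(m, n) \<in> set ps \<Longrightarrow> \<exists>j. (\<forall>x. opair (num j) x \<in> elts (pos (map fst ps)) \<longleftrightarrow> x = m) \<and>
    (\<forall>x. opair (num j) x \<in> elts (pos (map snd ps)) \<longleftrightarrow> x = n)"
proof (induction ps)
  case (Cons p ps)
  show ?case
  proof (cases "(m, n) \<in> set ps")
    case True
    then obtain j where j: "\<forall>x. opair (num j) x \<in> elts (pos (map fst ps)) \<longleftrightarrow> x = m"
      "\<forall>x. opair (num j) x \<in> elts (pos (map snd ps)) \<longleftrightarrow> x = n" using Cons.IH by blast
    then have "j < length ps" using pos_name_less[of j m "map fst ps"] by simp
    with j show ?thesis by (intro exI[of _ j]) (simp add: upd_def)
  next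
    case False
    then have "p = (m, n)" using Cons.prems by simp
    then show ?thesis
      using pos_name_less[of "length ps" _ "map fst ps"] pos_name_less[of "length ps" _ "map snd ps"]
      by (intro exI[of _ "length ps"]) (auto simp: upd_def)
  qed
qed simp

lemma rank_fml_below:
  assumes "z \<in> S" "w \<in> S" "\<theta> \<in> Ord M - S" shows "rk (fml k z w) \<in> elts \<theta>"
proof -
  obtain \<theta>' where \<theta>': "\<theta>' \<in> Ord M - S"
    "\<And>k z X. z \<in> S \<Longrightarrow> elts (rk X) \<subseteq> elts \<theta>' \<Longrightarrow> rk (fml k z X) \<in> elts \<theta>"
    using level_for_fmls[OF assms(3)] by metis
  have "elts (rk w) \<subseteq> elts \<theta>'"
    using S_below_outside[OF assms(2) \<theta>'(1)] \<theta>'(1) Ord_trans by blast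
  then show ?thesis by (rule \<theta>'(2)[OF assms(1)])
qed

lemma approx_transfer:
  assumes "approx ps B \<theta>" "z \<in> S" "w \<in> S" "holds (pos (map fst ps)) (fml k z w)"
  shows "holds_in B (pos (map snd ps)) (fml k z w)"
  using assms rank_fml_below unfolding approx_def by blast

lemma approx_mem_iff:
  assumes "approx ps B \<theta>" "(m, n) \<in> set ps" "(m', n') \<in> set ps"
  shows "m \<in> elts m' \<longleftrightarrow> n \<in> elts n'"
proof -
  obtain j where j: "\<forall>x. opair (num j) x \<in> elts (pos (map fst ps)) \<longleftrightarrow> x = m"
      "\<forall>x. opair (num j) x \<in> elts (pos (map snd ps)) \<longleftrightarrow> x = n"
    using pos_lookup[OF assms(2)] by blast
  obtain k where k: "\<forall>x. opair (num k) x \<in> elts (pos (map fst ps)) \<longleftrightarrow> x = m'"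
      "\<forall>x. opair (num k) x \<in> elts (pos (map snd ps)) \<longleftrightarrow> x = n'"
    using pos_lookup[OF assms(3)] by blast
  note tr = approx_transfer[OF assms(1) num_in_S[of j] num_in_S[of k]]
  show ?thesis
  proof (cases "m \<in> elts m'")
    case True
    then have "holds (pos (map fst ps)) (fml 0 (num j) (num k))" using j k by (intro holds_mem) auto
    from holds_in_mem[OF tr[OF this]] j k True show ?thesis by auto
  next
    case False
    then have "holds (pos (map fst ps)) (fml 1 (num j) (num k))" using j k by (intro holds_not_mem) auto
    from holds_in_not_mem[OF tr[OF this]] j k False show ?thesis by auto
  qed
qed

lemma approx_fixes:
  assumes "approx ps B \<theta>" "(m, n) \<in> set ps" "m \<in> S" shows "n = m"
proof -
  obtain j where j: "\<forall>x. opair (num j) x \<in> elts (pos (map fst ps)) \<longleftrightarrow> x = m"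
      "\<forall>x. opair (num j) x \<in> elts (pos (map snd ps)) \<longleftrightarrow> x = n"
    using pos_lookup[OF assms(2)] by blast
  have "holds (pos (map fst ps)) (fml 2 (num j) m)" using j by (intro holds_const) auto
  from holds_in_const[OF approx_transfer[OF assms(1) num_in_S assms(3) this]] j show ?thesis by auto
qed

text \<open>
  The formula \<open>\<exists>y. \<And>{}\<close> is always true, so by the invariant it is true in \<open>B\<close>.
\<close>

lemma approx_bounded:
  assumes "approx ps B \<theta>" shows "rk (pos (map snd ps)) \<in> elts (rk B)"
proof -
  have "holds (pos (map fst ps)) (fml 3 zero zero)" by (rule holds_ex) simp
  from holds_in_rank[OF approx_transfer[OF assms zero_in_S zero_in_S this]] show ?thesis .
qed

lemma approx_lower:
  assumes "approx ps B \<theta>" "\<theta>' \<in> Ord M - S" "elts \<theta>' \<subseteq> elts \<theta>" shows "approx ps B \<theta>'"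
  using assms unfolding approx_def by blast

lemma small_type: "small {t \<in> elts (V \<theta>). holds a t}"
  by (rule small_param[where R = "\<lambda>t a _ _. holds a t", OF Sig1_holds[OF Fun1_var Fun1_var]])

text \<open>
  By \<open>\<Sigma>\<^sub>1\<close>-Separation the true formulas of rank below \<open>\<theta>\<close> form a set, so they have a common
  bound.
\<close>

lemma approx_start: "\<exists>B \<theta>. approx [] B \<theta>"
proof -
  obtain \<theta> where \<theta>: "\<theta> \<in> Ord M - S" by (rule Ord_outside)
  let ?T = "mk {t \<in> elts (V \<theta>). holds zero t}"
  obtain B where "\<forall>t\<in>elts ?T. holds_in B zero t"
    using holds_uniform[of ?T zero] by (auto simp: small_type simp del: elts_V)
  with \<theta> have "approx [] B \<theta>" by (auto simp: approx_def small_type rank_Ord simp del: elts_V) (simp add: rank_Ord)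
  then show ?thesis by blast
qed

section \<open>The steps of the back-and-forth construction\<close>

text \<open>
  The type \<open>T\<close> of \<open>m\<close> is a set, and \<open>\<exists>y. \<And>T\<close> is a formula that holds before \<open>m\<close> is added. By the
  invariant some \<open>n\<close> realizes \<open>T\<close> in \<open>B\<close>. This \<open>n\<close> is an image for every element whose type is
  included in \<open>T\<close>, a generality on which the proof that elements are moved depends.
\<close>

lemma approx_extend:
  assumes approx: "approx ps B \<theta>" and \<theta>': "\<theta>' \<in> Ord M - S"
    and level: "\<And>k z X. z \<in> S \<Longrightarrow> elts (rk X) \<subseteq> elts \<theta>' \<Longrightarrow> rk (fml k z X) \<in> elts \<theta>"
  shows "\<exists>n. \<forall>m'. (\<forall>t. rk t \<in> elts \<theta>' \<longrightarrow> holds (pos (m' # map fst ps)) t \<longrightarrow> holds (pos (m # map fst ps)) t)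
     \<longrightarrow> approx ((m', n) # ps) B \<theta>'"
proof -
  let ?a = "pos (map fst ps)" and ?b = "pos (map snd ps)" and ?z = "num (length ps)"
  obtain T where "elts T = {t \<in> elts (V \<theta>'). holds (pos (m # map fst ps)) t}"
    using small_type unfolding small_def by blast
  then have T: "elts T = {t. rk t \<in> elts \<theta>' \<and> holds (pos (m # map fst ps)) t}"
    using \<theta>' by (simp add: rank_Ord)
  then have "elts (rk T) \<subseteq> elts \<theta>'" using \<theta>' by (intro rank_subset_Ord) auto
  moreover have "holds ?a (fml 3 ?z T)" by (rule holds_ex[of _ _ _ m]) (use T in auto)
  ultimately have "holds_in B ?b (fml 3 ?z T)"
    using approx level[OF num_in_S] unfolding approx_def by blast
  from holds_in_ex[OF this] obtain n where "\<forall>t\<in>elts T. holds_in B (upd ?b ?z n) t" by blast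
  then show ?thesis using \<theta>' by (intro exI[of _ n]) (simp add: approx_def T)
qed

lemma approx_forth:
  assumes "approx ps B \<theta>" shows "\<exists>n \<theta>'. approx ((m, n) # ps) B \<theta>'"
proof -
  have "\<theta> \<in> Ord M - S" using assms by (simp add: approx_def)
  then obtain \<theta>' where "\<theta>' \<in> Ord M - S"
    "\<And>k z X. z \<in> S \<Longrightarrow> elts (rk X) \<subseteq> elts \<theta>' \<Longrightarrow> rk (fml k z X) \<in> elts \<theta>"
    using level_for_fmls by metis
  from approx_extend[OF assms this] show ?thesis by blast
qed

text \<open>
  Let \<open>X\<close> be the set of formulas which fail in \<open>B\<close> at the position extended by \<open>n\<close>. If each
  candidate \<open>m\<close> satisfied some formula in \<open>X\<close>, then \<open>\<forall>y. \<Or>X\<close> would hold on the left, hence in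
  \<open>B\<close> on the right, and \<open>n\<close> would satisfy a formula in \<open>X\<close>.
\<close>

lemma approx_back:
  assumes approx: "approx ps B \<theta>" and n: "rk n \<in> elts (rk (pos (map snd ps)))"
  shows "\<exists>m \<theta>'. approx ((m, n) # ps) B \<theta>'"
proof -
  let ?a = "pos (map fst ps)" and ?b = "pos (map snd ps)" and ?z = "num (length ps)"
  have "\<theta> \<in> Ord M - S" using approx by (simp add: approx_def)
  then obtain \<theta>' where \<theta>': "\<theta>' \<in> Ord M - S"
    and level: "\<And>k z X. z \<in> S \<Longrightarrow> elts (rk X) \<subseteq> elts \<theta>' \<Longrightarrow> rk (fml k z X) \<in> elts \<theta>"
    using level_for_fmls by metis
  have "Sig1 M (\<lambda>e. \<not> holds_in (e 1) (e 2) (e 0))" by (rule Sig1_Del1) (intro definable)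
  from separation_param[where R = "\<lambda>t B b _. \<not> holds_in B b t", OF this, of "V \<theta>'"]
  obtain X where "elts X = {t \<in> elts (V \<theta>'). \<not> holds_in B (upd ?b ?z n) t}" by blast
  then have X: "elts X = {t. rk t \<in> elts \<theta>' \<and> \<not> holds_in B (upd ?b ?z n) t}"
    using \<theta>' by (simp add: rank_Ord)
  then have "elts (rk X) \<subseteq> elts \<theta>'" using \<theta>' by (intro rank_subset_Ord) auto
  then have fml: "rk (fml 4 ?z X) \<in> elts \<theta>" by (rule level[OF num_in_S])
  have "\<exists>m. \<forall>t\<in>elts X. \<not> holds (upd ?a ?z m) t"
  proof (rule ccontr)
    assume "\<not> ?thesis"
    then have "holds ?a (fml 4 ?z X)" by (intro holds_all) blast
    then have "holds_in B ?b (fml 4 ?z X)" using approx fml unfolding approx_def by blast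
    from holds_in_all[OF this n] show False using X by blast
  qed
  then obtain m where "\<forall>t\<in>elts X. \<not> holds (upd ?a ?z m) t" ..
  then have "approx ((m, n) # ps) B \<theta>'" using \<theta>' by (auto simp: approx_def X)
  then show ?thesis by blast
qed

text \<open>
  Cantor's diagonal argument. A type over \<open>V \<theta>\<close> is a subset of \<open>V \<theta>\<close>, and the sets of rank \<open>\<alpha>\<close>
  include all sets \<open>D \<union> (\<alpha> - V \<gamma>)\<close> where \<open>D\<close> is a set of types. The part \<open>\<alpha> - V \<gamma>\<close> only raises
  the rank to \<open>\<alpha>\<close>. It contains no types, because types belong to \<open>V \<gamma>\<close>. For the set \<open>D\<close> of types
  of sets of rank \<open>\<alpha>\<close> that do not contain their own type, the resulting \<open>d\<close> shares its type with
  another set.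
\<close>

lemma same_type_ex:
  assumes \<gamma>: "\<gamma> \<in> elts \<alpha>" "\<theta> \<in> elts \<gamma>" and \<alpha>: "\<alpha> \<in> Ord M"
  shows "\<exists>m m'. rk m = \<alpha> \<and> rk m' = \<alpha> \<and> m \<noteq> m' \<and>
    (\<forall>t. rk t \<in> elts \<theta> \<longrightarrow> holds (upd a z m) t \<longleftrightarrow> holds (upd a z m') t)"
proof -
  have \<gamma>O: "\<gamma> \<in> Ord M" and \<theta>O: "\<theta> \<in> Ord M" using Ord_in_Ord \<gamma> \<alpha> by blast+
  define E where "E = mk {m \<in> elts (V (succ \<alpha>)). rk m = rk \<alpha>}"
  have s: "Sig1 M (\<lambda>e. rk (e 0) = rk (e 1))" by (rule Sig1_Del1) (intro definable)
  have "elts E = {m \<in> elts (V (succ \<alpha>)). rk m = rk \<alpha>}" 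
    unfolding E_def by (rule elts_mk[OF small_param[where R = "\<lambda>m \<alpha> _ _. rk m = rk \<alpha>", OF s]])
  then have E: "elts E = {m. rk m = \<alpha>}"
    using \<alpha> rank_mem[of \<alpha> "succ \<alpha>"] by (auto simp: rank_Ord)
  \<comment> \<open>A set large enough to contain all Kuratowski pairs from \<open>E\<close> and \<open>V \<theta>\<close>.\<close>
  define P where "P = pw (pw (un (upair E (V \<theta>))))"
  have P: "opair m t \<in> elts P" if "rk m = \<alpha>" "rk t \<in> elts \<theta>" for m t
    using that \<theta>O by (simp add: P_def opair_def E rank_Ord)
  define R where "R = mk {p \<in> elts P. holds (upd a z (pfst p)) (psnd p)}"
  have "Sig1 M (\<lambda>e. holds (upd (e 1) (e 2) (pfst (e 0))) (psnd (e 0)))"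
    by (rule Sig1_holds) (intro definable)+
  from small_param[where R = "\<lambda>p a z _. holds (upd a z (pfst p)) (psnd p)", OF this, of P a z]
  have R: "opair m t \<in> elts R \<longleftrightarrow> holds (upd a z m) t" if "rk m = \<alpha>" "rk t \<in> elts \<theta>" for m t
    using P[OF that] by (simp add: R_def)
  define tp where "tp m = mk {t \<in> elts (V \<theta>). holds (upd a z m) t}" for m
  have tp: "elts (tp m) = {t. rk t \<in> elts \<theta> \<and> holds (upd a z m) t}" for m
    using small_type[of \<theta> "upd a z m"] \<theta>O by (simp add: tp_def rank_Ord)
  have "elts (rk (tp m)) \<subseteq> elts \<theta>" for m by (rule rank_subset_Ord[OF \<theta>O]) (simp add: tp)
  then have tp_rank: "rk (tp m) \<in> elts \<gamma>" for m using rank_mem_of_le \<gamma>(2) \<gamma>O by blast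
  \<comment> \<open>The truth predicate enters through the set \<open>R\<close> only, so membership in the diagonal set
    is \<open>\<Delta>\<^sub>1\<close>.\<close>
  define is_tp where "is_tp E W R T \<longleftrightarrow> (\<exists>m\<in>elts E. T \<notin> elts m \<and> elts T \<subseteq> elts W \<and>
    (\<forall>t\<in>elts W. t \<in> elts T \<longleftrightarrow> opair m t \<in> elts R))" for E W R T
  have is_tp: "is_tp E (V \<theta>) R T \<longleftrightarrow> (\<exists>m. rk m = \<alpha> \<and> T \<notin> elts m \<and> T = tp m)" for T
  proof -
    have "elts T \<subseteq> elts (V \<theta>) \<and> (\<forall>t\<in>elts (V \<theta>). t \<in> elts T \<longleftrightarrow> opair m t \<in> elts R) \<longleftrightarrow> T = tp m"
      if "rk m = \<alpha>" for m
      unfolding elts_inject[symmetric] tp using R[OF that] \<theta>O by (auto simp: rank_Ord)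
    then show ?thesis unfolding is_tp_def E by blast
  qed
  define D where "D = mk {T \<in> elts (V \<gamma>). is_tp E (V \<theta>) R T}"
  have "Sig1 M (\<lambda>e. is_tp (e 1) (e 2) (e 3) (e 0))"
    unfolding is_tp_def by (rule Sig1_Del1) (intro definable)
  from small_param[where R = "\<lambda>T E W R. is_tp E W R T", OF this, of "V \<gamma>" E "V \<theta>" R]
  have D: "T \<in> elts D \<longleftrightarrow> (\<exists>m. rk m = \<alpha> \<and> T \<notin> elts m \<and> T = tp m)" for T
    using tp_rank \<gamma>O by (auto simp: D_def is_tp rank_Ord simp del: elts_V) (simp add: rank_Ord)
  define d where "d = un (upair D (mk (elts \<alpha> - elts (V \<gamma>))))"
  have d: "elts d = elts D \<union> (elts \<alpha> - elts (V \<gamma>))" by (auto simp: d_def small_diff simp del: elts_V)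
  have d_rank: "rk d = \<alpha>"
  proof -
    have "rk u \<in> elts \<alpha>" if "u \<in> elts d" for u
      using that tp_rank D Ord_trans[OF \<alpha> \<gamma>(1)] rank_Ord[OF Ord_in_Ord[OF \<alpha>]] unfolding d by auto
    then have "elts (rk d) \<subseteq> elts \<alpha>" by (rule rank_subset_Ord[OF \<alpha>])
    moreover have "\<delta> \<in> elts (rk d)" if \<delta>: "\<delta> \<in> elts \<alpha>" for \<delta>
    proof -
      have top: "\<epsilon> \<in> elts (rk d)" if "\<epsilon> \<in> elts \<alpha>" "\<epsilon> \<notin> elts \<gamma>" for \<epsilon>
      proof -
        have \<epsilon>: "rk \<epsilon> = \<epsilon>" using rank_Ord Ord_in_Ord[OF \<alpha> that(1)] .
        then have "\<epsilon> \<in> elts d" using that \<gamma>O by (simp add: d rank_Ord)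
        from rank_mem[OF this] \<epsilon> show ?thesis by simp
      qed
      show ?thesis
      proof (cases "\<delta> \<in> elts \<gamma>")
        case True
        then show ?thesis using Ord_trans[OF Ord_rank top[OF \<gamma>(1) mem_irrefl]] by blast
      next
        case False
        with \<delta> top show ?thesis by blast
      qed
    qed
    ultimately have "elts (rk d) = elts \<alpha>" by blast
    then show ?thesis by simp
  qed
  have d_tp: "tp m \<in> elts d \<longleftrightarrow> tp m \<in> elts D" for m
    using tp_rank[of m] \<gamma>O by (auto simp: d rank_Ord)
  have "tp d \<in> elts d"
  proof (rule ccontr)
    assume "tp d \<notin> elts d"
    then have "tp d \<in> elts D" using D d_rank by blast
    with d_tp \<open>tp d \<notin> elts d\<close> show False by blast
  qed
  then obtain m where m: "rk m = \<alpha>" "tp d \<notin> elts m" "tp d = tp m" using d_tp D by blast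
  then have "m \<noteq> d" using \<open>tp d \<in> elts d\<close> by blast
  moreover have "rk t \<in> elts \<theta> \<longrightarrow> holds (upd a z m) t \<longleftrightarrow> holds (upd a z d) t" for t
    using tp[of m] tp[of d] m(3) by auto
  ultimately show ?thesis using m(1) d_rank by blast
qed

text \<open>
  Two elements of rank \<open>\<alpha>\<close> with the same type can be given the same image, and this differs from
  one of them.
\<close>

lemma approx_move:
  assumes approx: "approx ps B \<theta>" and \<alpha>: "\<alpha> \<in> Ord M - S"
  shows "\<exists>m n \<theta>'. rk m = \<alpha> \<and> n \<noteq> m \<and> approx ((m, n) # ps) B \<theta>'"
proof -
  have \<theta>: "\<theta> \<in> Ord M - S" using approx by (simp add: approx_def)
  obtain \<gamma> where \<gamma>: "\<gamma> \<in> Ord M - S" "\<gamma> \<in> elts \<alpha>" by (rule outside_lower[OF \<alpha>])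
  \<comment> \<open>The minimum of \<open>\<theta>\<close> and \<open>\<gamma>\<close>.\<close>
  obtain \<theta>0 where \<theta>0: "\<theta>0 \<in> Ord M - S" "elts \<theta>0 \<subseteq> elts \<theta>" "elts \<theta>0 \<subseteq> elts \<gamma>"
    using Ord_linear[of \<theta> \<gamma>] Ord_subset_iff[of \<theta> \<gamma>] Ord_subset_iff[of \<gamma> \<theta>] \<theta> \<gamma>(1) by blast
  have inv0: "approx ps B \<theta>0" by (rule approx_lower[OF approx \<theta>0(1,2)])
  obtain \<theta>' where \<theta>': "\<theta>' \<in> Ord M - S" "\<theta>' \<in> elts \<theta>0"
    and level: "\<And>k z X. z \<in> S \<Longrightarrow> elts (rk X) \<subseteq> elts \<theta>' \<Longrightarrow> rk (fml k z X) \<in> elts \<theta>0"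
    using level_for_fmls[OF \<theta>0(1)] by metis
  let ?a = "pos (map fst ps)" and ?z = "num (length ps)"
  obtain m m' where m: "rk m = \<alpha>" "rk m' = \<alpha>" "m \<noteq> m'"
    "\<forall>t. rk t \<in> elts \<theta>' \<longrightarrow> holds (upd ?a ?z m) t \<longleftrightarrow> holds (upd ?a ?z m') t"
    using same_type_ex[OF \<gamma>(2), of \<theta>' ?a ?z] \<theta>'(2) \<theta>0(3) \<alpha> by blast
  obtain n where n: "\<forall>m'. (\<forall>t. rk t \<in> elts \<theta>' \<longrightarrow> holds (upd ?a ?z m') t \<longrightarrow> holds (upd ?a ?z m) t)
     \<longrightarrow> approx ((m', n) # ps) B \<theta>'"
    using approx_extend[OF inv0 \<theta>'(1) level, of m] by auto
  have "approx ((m, n) # ps) B \<theta>'" "approx ((m', n) # ps) B \<theta>'" using n m(4) by blast+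
  with m(1-3) show ?thesis by metis
qed

lemma rank_pos: "n \<in> set xs \<Longrightarrow> rk n \<in> elts (rk (pos xs))"
proof (induction xs)
  case (Cons x xs)
  have "elts (rk (pos xs)) \<subseteq> elts (rk (pos (x # xs)))" by (rule rank_subset) (auto simp: upd_def)
  moreover have "rk x \<in> elts (rk (pos (x # xs)))"
    by (rule Ord_trans[OF Ord_rank rank_mem rank_opair(2)[of _ "num (length xs)"]]) (simp add: upd_def)
  ultimately show ?case using Cons by auto
qed simp

lemma rank_V_le: "elts (rk (V \<nu>)) \<subseteq> elts (rk \<nu>)"
  by (rule rank_subset_Ord[OF Ord_rank]) simp

text \<open>
  The bound is lowered to a rank below \<open>x\<close> if that is possible. Toplessness of the embedding
  rests on the case where \<open>x\<close> is an ordinal.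
\<close>

lemma approx_shrink:
  assumes "approx ps B \<theta>"
  shows "\<exists>B' \<theta>'. approx ps B' \<theta>' \<and> elts (rk B') \<subseteq> elts (rk B) \<and>
    ((\<exists>\<nu>\<in>elts x. \<exists>\<theta>'. approx ps (V \<nu>) \<theta>') \<longrightarrow> (\<exists>\<nu>\<in>elts x. elts (rk B') \<subseteq> elts (rk \<nu>)))"
proof (cases "\<exists>\<nu>\<in>elts x. \<exists>\<theta>'. approx ps (V \<nu>) \<theta>'")
  case True
  then obtain \<nu> \<theta>' where \<nu>: "\<nu> \<in> elts x" "approx ps (V \<nu>) \<theta>'" by blast
  show ?thesis
  proof (cases "elts (rk (V \<nu>)) \<subseteq> elts (rk B)")
    case True
    then show ?thesis using \<nu> rank_V_le by blast
  next
    case False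
    then have "elts (rk B) \<subseteq> elts (rk (V \<nu>))"
      using Ord_linear[OF Ord_rank Ord_rank, of B "V \<nu>"] Ord_subset_iff[OF Ord_rank Ord_rank] by blast
    then show ?thesis using \<nu> rank_V_le assms by blast
  qed
next
  case False
  then show ?thesis using assms by blast
qed

text \<open>
  One stage of the construction, which deals with a single element \<open>x\<close> in all its roles: as a
  new argument, as a new value, as a rank at which an element is to be moved, and as a possible
  least ordinal outside the range.
\<close>

lemma approx_step:
  assumes "approx ps B \<theta>"
  shows "\<exists>ps' B' \<theta>'. approx ps' B' \<theta>' \<and> set ps \<subseteq> set ps' \<and> elts (rk B') \<subseteq> elts (rk B) \<and>
    (\<exists>n. (x, n) \<in> set ps') \<and>
    (rk x \<in> elts (rk (pos (map snd ps))) \<longrightarrow> (\<exists>m. (m, x) \<in> set ps')) \<and>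
    (x \<in> Ord M - S \<longrightarrow> (\<exists>m n. rk m = x \<and> n \<noteq> m \<and> (m, n) \<in> set ps')) \<and>
    ((\<exists>\<nu>\<in>elts x. \<exists>\<theta>'. approx ps (V \<nu>) \<theta>') \<longrightarrow> (\<exists>\<nu>\<in>elts x. elts (rk B') \<subseteq> elts (rk \<nu>)))"
proof -
  obtain B' \<theta>1 where 1: "approx ps B' \<theta>1" "elts (rk B') \<subseteq> elts (rk B)"
    "(\<exists>\<nu>\<in>elts x. \<exists>\<theta>'. approx ps (V \<nu>) \<theta>') \<longrightarrow> (\<exists>\<nu>\<in>elts x. elts (rk B') \<subseteq> elts (rk \<nu>))"
    using approx_shrink[OF assms] by blast
  obtain ps2 \<theta>2 where 2: "approx ps2 B' \<theta>2" "set ps \<subseteq> set ps2"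
    "rk x \<in> elts (rk (pos (map snd ps))) \<longrightarrow> (\<exists>m. (m, x) \<in> set ps2)"
  proof (cases "rk x \<in> elts (rk (pos (map snd ps)))")
    case True
    then obtain m \<theta>2 where "approx ((m, x) # ps) B' \<theta>2" using approx_back[OF 1(1)] by blast
    then show ?thesis by (rule that) auto
  next
    case False
    show ?thesis by (rule that[OF 1(1)]) (use False in auto)
  qed
  obtain n \<theta>3 where 3: "approx ((x, n) # ps2) B' \<theta>3" using approx_forth[OF 2(1)] by blast
  obtain ps4 \<theta>4 where 4: "approx ps4 B' \<theta>4" "set ((x, n) # ps2) \<subseteq> set ps4"
    "x \<in> Ord M - S \<longrightarrow> (\<exists>m n. rk m = x \<and> n \<noteq> m \<and> (m, n) \<in> set ps4)"
  proof (cases "x \<in> Ord M - S")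
    case True
    then obtain m n' \<theta>4 where "rk m = x" "n' \<noteq> m" "approx ((m, n') # (x, n) # ps2) B' \<theta>4"
      using approx_move[OF 3] by blast
    then show ?thesis by (intro that[of "(m, n') # (x, n) # ps2"]) auto
  next
    case False
    show ?thesis by (rule that[OF 3]) (use False in auto)
  qed
  have "set ps \<subseteq> set ps4" "\<exists>n. (x, n) \<in> set ps4"
    "rk x \<in> elts (rk (pos (map snd ps))) \<longrightarrow> (\<exists>m. (m, x) \<in> set ps4)"
    using 2(2,3) 4(2) by auto
  with 1(2,3) 4(1,3) show ?thesis by blast
qed

section \<open>The limit of the construction\<close>

text \<open>
  Every element is considered at infinitely many stages, because it is treated as a value only
  at stages where its rank is below that of the position on the right. That the union of the
  finite maps is an injective function follows from Extensionality: \<open>\<in>\<close> is preserved in both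
  directions, all elements occur as arguments, and all elements of a value occur as values. The
  last clause of the conclusion records what \<open>approx_shrink\<close> has achieved.
\<close>

lemma back_and_forth:
  assumes "countable (UNIV :: 'a set)"
  shows "\<exists>i. (\<forall>x y. i x \<in> elts (i y) \<longleftrightarrow> x \<in> elts y) \<and> inj i \<and>
    (\<forall>x y. elts (rk y) \<subseteq> elts (rk (i x)) \<longrightarrow> y \<in> range i) \<and>
    (\<forall>s\<in>S. i s = s) \<and> (\<forall>\<alpha>\<in>Ord M - S. \<exists>m. rk m = \<alpha> \<and> i m \<noteq> m) \<and>
    (\<exists>\<beta>. \<forall>x. rk (i x) \<in> elts (rk \<beta>)) \<and>
    (\<forall>x. \<exists>as. (\<exists>\<nu>\<in>elts x. \<exists>\<theta>. approx (map (\<lambda>a. (a, i a)) as) (V \<nu>) \<theta>) \<longrightarrow>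
      (\<exists>\<nu>\<in>elts x. \<forall>a. rk (i a) \<in> elts (rk \<nu>)))"
proof -
  define task where "task k = from_nat_into (UNIV :: 'a set) (fst (prod_decode k))" for k
  have task: "\<exists>k\<ge>j. task k = x" for x j
  proof -
    obtain l where "from_nat_into (UNIV :: 'a set) l = x"
      using from_nat_into_surj[OF assms] by blast
    then have "task (prod_encode (l, j)) = x" by (simp add: task_def)
    then show ?thesis using le_prod_encode_2 by blast
  qed
  let ?I = "\<lambda>(ps, B, \<theta>). approx ps B \<theta>"
  let ?Q = "\<lambda>x (ps, B, \<theta>) (ps', B', \<theta>'). set ps \<subseteq> set ps' \<and> elts (rk B') \<subseteq> elts (rk B) \<and>
    (\<exists>n. (x, n) \<in> set ps') \<and>
    (rk x \<in> elts (rk (pos (map snd ps))) \<longrightarrow> (\<exists>m. (m, x) \<in> set ps')) \<and>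
    (x \<in> Ord M - S \<longrightarrow> (\<exists>m n. rk m = x \<and> n \<noteq> m \<and> (m, n) \<in> set ps')) \<and>
    ((\<exists>\<nu>\<in>elts x. \<exists>\<theta>'. approx ps (V \<nu>) \<theta>') \<longrightarrow> (\<exists>\<nu>\<in>elts x. elts (rk B') \<subseteq> elts (rk \<nu>)))"
  have "\<exists>f. \<forall>k. ?I (f k) \<and> ?Q (task k) (f k) (f (Suc k))"
  proof (rule dependent_nat_choice)
    show "\<exists>s. ?I s" using approx_start by auto
    show "\<exists>t. ?I t \<and> ?Q (task k) s t" if "?I s" for s k
    proof -
      obtain ps B \<theta> where s: "s = (ps, B, \<theta>)" by (cases s)
      with that have "approx ps B \<theta>" by simp
      from approx_step[OF this, of "task k"] show ?thesis unfolding s by auto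
    qed
  qed
  then obtain f where f': "\<forall>k. ?I (f k) \<and> ?Q (task k) (f k) (f (Suc k))" by (rule exE)
  note f = conjunct1[OF spec[OF f']] conjunct2[OF spec[OF f']]
  define P where "P k = fst (f k)" for k
  define B where "B k = fst (snd (f k))" for k
  have approx: "\<exists>\<theta>. approx (P k) (B k) \<theta>" for k
    using f(1)[of k] by (auto simp: P_def B_def split: prod.splits)
  have step: "set (P k) \<subseteq> set (P (Suc k))" "elts (rk (B (Suc k))) \<subseteq> elts (rk (B k))"
    "\<exists>n. (task k, n) \<in> set (P (Suc k))"
    "rk (task k) \<in> elts (rk (pos (map snd (P k)))) \<Longrightarrow> \<exists>m. (m, task k) \<in> set (P (Suc k))"
    "task k \<in> Ord M - S \<Longrightarrow> \<exists>m n. rk m = task k \<and> n \<noteq> m \<and> (m, n) \<in> set (P (Suc k))"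
    "\<exists>\<nu>\<in>elts (task k). \<exists>\<theta>'. approx (P k) (V \<nu>) \<theta>' \<Longrightarrow> \<exists>\<nu>\<in>elts (task k). elts (rk (B (Suc k))) \<subseteq> elts (rk \<nu>)"
    for k
    using f(2)[of k] unfolding P_def B_def by (auto split: prod.splits)
  have P_mono: "j \<le> k \<Longrightarrow> set (P j) \<subseteq> set (P k)" for j k
    by (rule lift_Suc_mono_le[of "\<lambda>k. set (P k)"]) (rule step(1))
  have B_mono: "j \<le> k \<Longrightarrow> elts (rk (B k)) \<subseteq> elts (rk (B j))" for j k
    by (rule lift_Suc_antimono_le[of "\<lambda>k. elts (rk (B k))"]) (rule step(2))
  define R where "R = (\<Union>k. set (P k))"
  have two: "\<exists>k\<ge>l. p \<in> set (P k) \<and> q \<in> set (P k)" if pq: "p \<in> R" "q \<in> R" for p q l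
  proof -
    obtain j k where "p \<in> set (P j)" "q \<in> set (P k)" using pq by (auto simp: R_def)
    then have "p \<in> set (P (j + k + l))" "q \<in> set (P (j + k + l))"
      using subsetD[OF P_mono[of j "j + k + l"]] subsetD[OF P_mono[of k "j + k + l"]] by simp_all
    then show ?thesis by (intro exI[of _ "j + k + l"]) simp
  qed
  have R_mem: "m \<in> elts m' \<longleftrightarrow> n \<in> elts n'" if "(m, n) \<in> R" "(m', n') \<in> R" for m n m' n'
    using two[OF that] approx approx_mem_iff by meson
  have R_total: "\<exists>n. (m, n) \<in> R" for m
  proof -
    obtain k where "task k = m" using task by blast
    with step(3)[of k] show ?thesis by (auto simp: R_def)
  qed
  have R_bound: "rk n \<in> elts (rk (B k))" if mn: "(m, n) \<in> R" for m n k
  proof -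
    obtain l where l: "l \<ge> k" "(m, n) \<in> set (P l)" using two[OF mn mn] by blast
    obtain \<theta> where "approx (P l) (B l) \<theta>" using approx by blast
    from approx_bounded[OF this] have "rk (pos (map snd (P l))) \<in> elts (rk (B l))" .
    moreover have "rk n \<in> elts (rk (pos (map snd (P l))))" using l(2) by (intro rank_pos) force
    ultimately have "rk n \<in> elts (rk (B l))" using Ord_trans[OF Ord_rank] by blast
    with B_mono[OF l(1)] show ?thesis by blast
  qed
  have R_back: "\<exists>m'. (m', y) \<in> R" if mn: "(m, n) \<in> R" and y: "elts (rk y) \<subseteq> elts (rk n)" for m n y
  proof -
    obtain j where j: "(m, n) \<in> set (P j)" using mn by (auto simp: R_def)
    obtain k where k: "k \<ge> j" "task k = y" using task by blast
    have "(m, n) \<in> set (P k)" using P_mono[OF k(1)] j by blast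
    then have "rk n \<in> elts (rk (pos (map snd (P k))))" by (intro rank_pos) force
    then have "rk y \<in> elts (rk (pos (map snd (P k))))" by (rule rank_mem_of_le[OF y _ Ord_rank])
    with step(4)[of k] k(2) show ?thesis by (auto simp: R_def)
  qed
  have R_fun_le: "elts n \<subseteq> elts n'" if mn: "(m, n) \<in> R" "(m, n') \<in> R" for m n n'
  proof
    fix u assume u: "u \<in> elts n"
    have "elts (rk u) \<subseteq> elts (rk n)" using rank_mem[OF u] Ord_trans[OF Ord_rank] by blast
    then obtain m' where "(m', u) \<in> R" using R_back[OF mn(1)] by blast
    with R_mem mn u show "u \<in> elts n'" by blast
  qed
  have R_fun: "n = n'" if "(m, n) \<in> R" "(m, n') \<in> R" for m n n'
    using R_fun_le[OF that] R_fun_le[OF that(2,1)] by (metis elts_inject subset_antisym)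
  have R_inj: "m = m'" if "(m, n) \<in> R" "(m', n) \<in> R" for m m' n
  proof -
    have "u \<in> elts m \<longleftrightarrow> u \<in> elts m'" for u using R_total[of u] R_mem that by blast
    then have "elts m = elts m'" by blast
    then show ?thesis by simp
  qed
  define i where "i m = (THE n. (m, n) \<in> R)" for m
  have i: "(m, n) \<in> R \<longleftrightarrow> n = i m" for m n
  proof -
    obtain n0 where n0: "(m, n0) \<in> R" using R_total by blast
    then have "i m = n0" unfolding i_def using R_fun by blast
    with n0 R_fun show ?thesis by blast
  qed
  have iR: "(m, i m) \<in> R" for m
    by (simp add: i)
  have P_map: "P k = map (\<lambda>a. (a, i a)) (map fst (P k))" for k
    by (rule nth_equalityI) (auto simp: prod_eq_iff i[symmetric] R_def intro!: exI[of _ k] nth_mem)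
  show ?thesis
  proof (intro exI[of _ i] conjI allI ballI impI)
    show "i x \<in> elts (i y) \<longleftrightarrow> x \<in> elts y" for x y
      using R_mem[OF iR iR] by blast
    show "inj i" by (rule injI) (metis R_inj iR)
    show "y \<in> range i" if y: "elts (rk y) \<subseteq> elts (rk (i x))" for x y
    proof -
      obtain m where "(m, y) \<in> R" using R_back[OF iR y] by blast
      then show ?thesis by (simp add: i)
    qed
    show "i s = s" if "s \<in> S" for s
    proof -
      obtain k where "(s, i s) \<in> set (P k)" using iR[of s] by (auto simp: R_def)
      with approx_fixes approx that show ?thesis by blast
    qed
    show "\<exists>m. rk m = \<alpha> \<and> i m \<noteq> m" if \<alpha>: "\<alpha> \<in> Ord M - S" for \<alpha>
    proof -
      obtain k where "task k = \<alpha>" using task by blast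
      with step(5)[of k] \<alpha> obtain m n where "rk m = \<alpha>" "n \<noteq> m" "(m, n) \<in> R"
        by (auto simp: R_def)
      then show ?thesis by (intro exI[of _ m]) (simp add: i)
    qed
    show "\<exists>\<beta>. \<forall>x. rk (i x) \<in> elts (rk \<beta>)" using R_bound[OF iR] by blast
    show "\<exists>as. (\<exists>\<nu>\<in>elts x. \<exists>\<theta>. approx (map (\<lambda>a. (a, i a)) as) (V \<nu>) \<theta>) \<longrightarrow>
      (\<exists>\<nu>\<in>elts x. \<forall>a. rk (i a) \<in> elts (rk \<nu>))" for x
    proof -
      obtain k where k: "task k = x" using task by blast
      show ?thesis
      proof (intro exI[of _ "map fst (P k)"] impI)
        assume "\<exists>\<nu>\<in>elts x. \<exists>\<theta>. approx (map (\<lambda>a. (a, i a)) (map fst (P k))) (V \<nu>) \<theta>"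
        then obtain \<nu> where "\<nu> \<in> elts x" "elts (rk (B (Suc k))) \<subseteq> elts (rk \<nu>)"
          using step(6)[of k] k unfolding P_map[symmetric] by blast
        then show "\<exists>\<nu>\<in>elts x. \<forall>a. rk (i a) \<in> elts (rk \<nu>)" using R_bound[OF iR] by blast
      qed
    qed
  qed
qed

end

section \<open>Absoluteness for rank-initial embeddings\<close>

locale initial_embedding = set_model +
  fixes i :: "'a \<Rightarrow> 'a"
  assumes mem_i [simp]: "i x \<in> elts (i y) \<longleftrightarrow> x \<in> elts y"
    and inj_i: "inj i"
    and initial_i: "elts (rank M y) \<subseteq> elts (rank M (i x)) \<Longrightarrow> y \<in> range i"
begin

lemma i_eq [simp]: "i x = i y \<longleftrightarrow> x = y"
  by (rule inj_eq[OF inj_i])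

lemma elts_i: "elts (i x) = i ` elts x"
proof
  show "i ` elts x \<subseteq> elts (i x)" by auto
  show "elts (i x) \<subseteq> i ` elts x"
  proof
    fix u assume u: "u \<in> elts (i x)"
    then have "elts (rk u) \<subseteq> elts (rk (i x))" using rank_mem[OF u] Ord_trans[OF Ord_rank] by blast
    then obtain w where "u = i w" using initial_i by blast
    with u show "u \<in> i ` elts x" by auto
  qed
qed

lemma subset_i: "elts u \<subseteq> elts (i x) \<longleftrightarrow> (\<exists>w. u = i w \<and> elts w \<subseteq> elts x)"
proof
  assume u: "elts u \<subseteq> elts (i x)"
  then obtain w where "u = i w" using initial_i[OF rank_subset[OF u]] by blast
  with u show "\<exists>w. u = i w \<and> elts w \<subseteq> elts x" by (auto simp: elts_i)
next
  assume "\<exists>w. u = i w \<and> elts w \<subseteq> elts x"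
  then show "elts u \<subseteq> elts (i x)" using elts_i by blast
qed

text \<open>
  The range of \<open>i\<close> contains all elements and all subsets of its elements, so both kinds of
  bounded quantifiers have the same meaning in the range as in \<open>M\<close>.
\<close>

lemma Delta0_absolute: "all_bounded \<phi> \<Longrightarrow> sat M (\<lambda>n. i (v n)) \<phi> = sat M v \<phi>"
proof (induction \<phi> arbitrary: v)
  case (ExMem x y \<phi>)
  have "sat M ((\<lambda>n. i (v n))(x := i a)) \<phi> = sat M (v(x := a)) \<phi>" for a
  proof -
    have "(\<lambda>n. i (v n))(x := i a) = (\<lambda>n. i ((v(x := a)) n))" by auto
    with ExMem.IH[of "v(x := a)"] ExMem.prems show ?thesis by (simp del: fun_upd_apply)
  qed
  then show ?case by (simp add: univ elts_i image_iff) blast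
next
  case (ExSub x y \<phi>)
  have "sat M ((\<lambda>n. i (v n))(x := i a)) \<phi> = sat M (v(x := a)) \<phi>" for a
  proof -
    have "(\<lambda>n. i (v n))(x := i a) = (\<lambda>n. i ((v(x := a)) n))" by auto
    with ExSub.IH[of "v(x := a)"] ExSub.prems show ?thesis by (simp del: fun_upd_apply)
  qed
  then show ?case by (simp add: univ subset_i) blast
qed simp_all

lemma Sig1_upward:
  assumes "Sig1 M P" "P e" shows "P (\<lambda>n. i (e n))"
proof -
  obtain Q where Q: "Del0 M Q" "\<And>e. P e = (\<exists>w. Q (w ## e))" using assms(1) by (auto simp: Sig1_def)
  then obtain \<phi> where \<phi>: "\<phi> \<in> Delta0_P" "\<And>e. Q e = sat M e \<phi>" by (auto simp: Del0_def)
  obtain w where "sat M (w ## e) \<phi>" using assms(2) Q(2) \<phi>(2) by blast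
  then have "sat M (\<lambda>n. i ((w ## e) n)) \<phi>" using Delta0_absolute \<phi>(1) by (simp add: Delta0_P_def)
  moreover have "(\<lambda>n. i ((w ## e) n)) = i w ## (\<lambda>n. i (e n))"
    by (rule ext) (simp split: nat.split)
  ultimately show ?thesis using Q(2) \<phi>(2) by metis
qed

text \<open>
  \<open>\<Sigma>\<^sub>1\<close> relations are preserved by \<open>i\<close>, and \<open>y = t e\<close> is such a relation.
\<close>

lemma Fun1_commute:
  assumes "Fun1 M t" shows "i (t e) = t (\<lambda>n. i (e n))"
  using Sig1_upward[OF assms[unfolded Fun1_def], of "t e ## e"] by simp

lemma i_num: "i (num k) = num k"
  using Fun1_commute[OF Fun1_num] .

lemma i_upd: "i (upd a z y) = upd (i a) (i z) (i y)"
proof -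
  have "Fun1 M (\<lambda>e. upd (e 0) (e 1) (e 2))" by (intro definable)
  from Fun1_commute[OF this, of "a ## z ## y ## undefined"] show ?thesis by simp
qed

lemma i_holds_in: "holds_in B a t \<Longrightarrow> holds_in (i B) (i a) (i t)"
  using Sig1_upward[OF Sig1_Del1[OF Del1_holds_in0], of "B ## a ## t ## undefined"] by simp

end

section \<open>Toplessness\<close>

context rank_cut begin

text \<open>
  The ordinals with a given internal property cannot be exactly those in \<open>S\<close>, because a nonempty
  set of ordinals has a least element, and the ordinals outside \<open>S\<close> have none.
\<close>

lemma overspill:
  assumes "\<theta>0 \<in> Ord M - S" and D: "Sig1 M (\<lambda>e. \<not> R (e 0) (e 1) (e 2) (e 3))"
    and R: "\<And>\<theta>. \<theta> \<in> Ord M \<Longrightarrow> \<theta> \<in> S \<Longrightarrow> R \<theta> p q r"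
  shows "\<exists>\<theta>\<in>Ord M - S. elts \<theta> \<subseteq> elts \<theta>0 \<and> R \<theta> p q r"
proof (rule ccontr)
  assume no: "\<not> ?thesis"
  obtain N where N: "elts N = {\<theta> \<in> elts (succ \<theta>0). \<not> R \<theta> p q r}"
    using separation_param[where R = "\<lambda>\<theta> p q r. \<not> R \<theta> p q r", OF D] by blast
  have "\<theta>0 \<in> elts N" using no assms(1) by (auto simp: N)
  then obtain \<theta> where \<theta>: "\<theta> \<in> elts N" "elts \<theta> \<inter> elts N = {}" using regularity[of N] by blast
  have succ: "succ \<theta>0 \<in> Ord M" using assms(1) Ord_succ by blast
  have "\<theta> \<in> Ord M" using \<theta>(1) Ord_in_Ord[OF succ] by (simp add: N)
  with \<theta>(1) R have "\<theta> \<in> Ord M - S" by (auto simp: N)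
  then obtain \<theta>' where \<theta>': "\<theta>' \<in> Ord M - S" "\<theta>' \<in> elts \<theta>" by (rule outside_lower)
  then have s: "\<theta>' \<in> elts (succ \<theta>0)" using Ord_trans[OF succ _ \<theta>'(2)] \<theta>(1) N by blast
  then have "elts \<theta>' \<subseteq> elts \<theta>0" using assms(1) Ord_trans[of \<theta>0] by auto
  with no \<theta>'(1) have "\<theta>' \<in> elts N" using s by (auto simp: N)
  with \<theta> \<theta>' show False by blast
qed

text \<open>
  Suppose that \<open>\<nu>\<close> is the least ordinal outside the range of \<open>i\<close>, and consider the finite map at
  the stage for \<open>\<nu>\<close>. For \<open>\<theta>\<close> in \<open>S\<close>, the true formulas of rank below \<open>\<theta>\<close> have a common bound
  \<open>B\<close>. They are fixed by \<open>i\<close>, so they are true in \<open>i B\<close> on the right, and the rank of \<open>i B\<close> is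
  below \<open>\<nu>\<close>. By overspill this extends to some \<open>\<theta>\<close> outside \<open>S\<close>, where it says that the invariant
  holds with a bound of rank below \<open>\<nu>\<close>. Then such a bound was chosen at that stage, and an
  ordinal below \<open>\<nu>\<close> is not in the range.
\<close>

theorem proper_topless_self_embedding:
  assumes "countable (UNIV :: 'a set)"
  shows "\<exists>i. (\<forall>x y. i x \<in> elts (i y) \<longleftrightarrow> x \<in> elts y) \<and> inj i \<and>
    (\<forall>x y. elts (rk y) \<subseteq> elts (rk (i x)) \<longrightarrow> y \<in> range i) \<and>
    (\<forall>s\<in>S. i s = s) \<and> (\<forall>\<alpha>\<in>Ord M - S. \<exists>m. rk m = \<alpha> \<and> i m \<noteq> m) \<and>
    (\<exists>\<beta>\<in>Ord M. \<forall>x. rk (i x) \<in> elts \<beta>) \<and>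
    \<not> (\<exists>\<nu>\<in>Ord M - range i. \<forall>\<gamma>\<in>Ord M - range i. ord_le M \<nu> \<gamma>)"
proof -
  obtain i where i: "\<And>x y. i x \<in> elts (i y) \<longleftrightarrow> x \<in> elts y" "inj i"
    "\<And>x y. elts (rk y) \<subseteq> elts (rk (i x)) \<Longrightarrow> y \<in> range i"
    "\<And>s. s \<in> S \<Longrightarrow> i s = s" "\<And>\<alpha>. \<alpha> \<in> Ord M - S \<Longrightarrow> \<exists>m. rk m = \<alpha> \<and> i m \<noteq> m"
    "\<exists>\<beta>. \<forall>x. rk (i x) \<in> elts (rk \<beta>)"
    "\<And>x. \<exists>as. (\<exists>\<nu>\<in>elts x. \<exists>\<theta>. approx (map (\<lambda>a. (a, i a)) as) (V \<nu>) \<theta>) \<longrightarrow>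
      (\<exists>\<nu>\<in>elts x. \<forall>a. rk (i a) \<in> elts (rk \<nu>))"
    using back_and_forth[OF assms] by blast
  interpret initial_embedding M i by unfold_locales (use i in auto)
  have i_pos: "i (pos as) = pos (map i as)" for as
  proof (induction as)
    case Nil
    show ?case using i_num[of 0] by simp
  qed (simp add: i_upd i_num)
  have "\<not> (\<forall>\<gamma>\<in>Ord M - range i. ord_le M \<nu> \<gamma>)" if \<nu>: "\<nu> \<in> Ord M - range i" for \<nu>
  proof
    assume least: "\<forall>\<gamma>\<in>Ord M - range i. ord_le M \<nu> \<gamma>"
    have \<nu>O: "\<nu> \<in> Ord M" using \<nu> by blast
    have below: "\<beta> \<in> range i" if "\<beta> \<in> elts \<nu>" for \<beta>
    proof (rule ccontr)
      assume "\<beta> \<notin> range i"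
      then have "ord_le M \<nu> \<beta>" using least Ord_in_Ord[OF \<nu>O that] by blast
      then show False using that mem_asym[of \<beta> \<nu>] mem_irrefl[of \<nu>] by (auto simp: ord_le_def)
    qed
    have above: "rk (i x) \<in> elts \<nu>" for x
    proof (rule ccontr)
      assume "rk (i x) \<notin> elts \<nu>"
      then have "elts \<nu> \<subseteq> elts (rk (i x))"
        using Ord_linear[OF \<nu>O Ord_rank, of "i x"] Ord_subset_iff[OF \<nu>O Ord_rank] by blast
      then have "\<nu> \<in> range i" using initial_i[of \<nu> x] rank_Ord[OF \<nu>O] by simp
      with \<nu> show False by blast
    qed
    obtain as where as: "\<exists>\<nu>'\<in>elts \<nu>. \<exists>\<theta>. approx (map (\<lambda>a. (a, i a)) as) (V \<nu>') \<theta> \<Longrightarrow>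
      \<exists>\<nu>'\<in>elts \<nu>. \<forall>a. rk (i a) \<in> elts (rk \<nu>')" using i(7) by blast
    obtain \<theta>0 where \<theta>0: "\<theta>0 \<in> Ord M - S" by (rule Ord_outside)
    obtain T where "elts T = {t \<in> elts (V \<theta>0). holds (pos as) t}"
      using small_type unfolding small_def by blast
    then have T: "elts T = {t. rk t \<in> elts \<theta>0 \<and> holds (pos as) t}" using \<theta>0 by (simp add: rank_Ord)
    let ?R = "\<lambda>\<theta> \<nu> T b. \<exists>\<nu>'\<in>elts \<nu>. \<forall>t\<in>elts T. rk t \<in> elts \<theta> \<longrightarrow> holds_in (V \<nu>') b t"
    have "Sig1 M (\<lambda>e. \<not> ?R (e 0) (e 1) (e 2) (e 3))" by (rule Sig1_Del1) (intro definable)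
    moreover have "?R \<theta> \<nu> T (pos (map i as))" if \<theta>: "\<theta> \<in> Ord M" "\<theta> \<in> S" for \<theta>
    proof -
      obtain B where B: "\<forall>t\<in>elts T. holds_in B (pos as) t" using holds_uniform[of T "pos as"] T by blast
      have "rk (i B) \<in> elts \<nu>" by (rule above)
      moreover have "holds_in (V (rk (i B))) (pos (map i as)) t" if t: "t \<in> elts T" "rk t \<in> elts \<theta>" for t
      proof -
        have "elts (rk t) \<subseteq> elts (rk \<theta>)" using t(2) \<theta>(1) Ord_trans[OF \<theta>(1)] by (auto simp: rank_Ord)
        then have "t \<in> S" by (rule S_rank_le[OF \<theta>(2)])
        then have "holds_in (i B) (pos (map i as)) t"
          using i_holds_in[of B "pos as" t] B t(1) i(4) i_pos by simp
        then show ?thesis by (rule holds_in_mono[rotated]) (auto intro: rank_mem)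
      qed
      ultimately show ?thesis by blast
    qed
    ultimately obtain \<theta> where \<theta>: "\<theta> \<in> Ord M - S" "elts \<theta> \<subseteq> elts \<theta>0" "?R \<theta> \<nu> T (pos (map i as))"
      using overspill[where R = ?R, OF \<theta>0] by blast
    then obtain \<nu>' where "\<nu>' \<in> elts \<nu>"
      "\<forall>t\<in>elts T. rk t \<in> elts \<theta> \<longrightarrow> holds_in (V \<nu>') (pos (map i as)) t" by blast
    moreover from this have "approx (map (\<lambda>a. (a, i a)) as) (V \<nu>') \<theta>"
      using \<theta>(1,2) T by (auto simp: approx_def comp_def)
    ultimately obtain \<nu>1 where \<nu>1: "\<nu>1 \<in> elts \<nu>" "\<forall>a. rk (i a) \<in> elts (rk \<nu>1)" using as by blast
    then obtain a where "\<nu>1 = i a" using below by blast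
    with \<nu>1(2) mem_irrefl show False by metis
  qed
  moreover have "\<exists>\<beta>\<in>Ord M. \<forall>x. rk (i x) \<in> elts \<beta>" using i(6) Ord_rank by blast
  ultimately show ?thesis using i(1-5) by (intro exI[of _ i] conjI) blast+
qed

end

section \<open>Transport to a structure on a whole type\<close>

text \<open>
  A finite universe would be contained in an element of \<open>M\<close>, by Pair and Union, and Russell's
  argument excludes a universal set.
\<close>

lemma infinite_univ:
  assumes "models_KP_P M" shows "infinite (univ M)"
proof
  assume fin: "finite (univ M)"
  have ne: "\<exists>x. x \<in> univ M" using assms by (auto simp: models_KP_P_def infinity_def)
  have adjoin: "\<exists>y\<in>univ M. \<forall>u\<in>univ M. mem M u x \<or> u = a \<longrightarrow> mem M u y" if xa: "x \<in> univ M" "a \<in> univ M" for x a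
  proof -
    have P: "pairing M" and U: "union_axiom M" using assms by (simp_all add: models_KP_P_def)
    obtain s where s: "s \<in> univ M" "is_upair M a a s" using P xa by (auto simp: pairing_def)
    obtain p where p: "p \<in> univ M" "is_upair M x s p" using P xa s by (auto simp: pairing_def)
    obtain y where y: "y \<in> univ M" "\<forall>z\<in>univ M. mem M z y \<longleftrightarrow> (\<exists>w\<in>univ M. mem M w p \<and> mem M z w)"
      using U p(1) by (auto simp: union_axiom_def)
    show ?thesis
    proof (intro bexI[OF _ y(1)] ballI impI)
      fix u assume u: "u \<in> univ M" "mem M u x \<or> u = a"
      then have "\<exists>w\<in>univ M. mem M w p \<and> mem M u w" using s p xa by (auto simp: is_upair_def)
      with y(2) u(1) show "mem M u y" by blast
    qed
  qed
  have "\<exists>y\<in>univ M. \<forall>u\<in>F. mem M u y" if "finite F" "F \<subseteq> univ M" for F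
    using that
  proof (induction F)
    case empty
    then show ?case using ne by blast
  next
    case (insert a F)
    then obtain y where "y \<in> univ M" "\<forall>u\<in>F. mem M u y" by blast
    with adjoin[of y a] insert.prems show ?case by blast
  qed
  then obtain x where x: "x \<in> univ M" "\<forall>u\<in>univ M. mem M u x" using fin by blast
  have "Neg (Mem 0 0) \<in> Delta0_P" "separation M Delta0_P" "assignment M (\<lambda>_. x)"
    using assms x(1) by (auto simp: Delta0_P_def models_KP_P_def assignment_def)
  then have "\<exists>y\<in>univ M. \<forall>u\<in>univ M. mem M u y \<longleftrightarrow> mem M u x \<and> sat M ((\<lambda>_. x)(0 := u)) (Neg (Mem 0 0))"
    using x(1) unfolding separation_def by blast
  then show False using x by auto
qed

text \<open>
  The structure on \<open>'b\<close> for which the bijection \<open>h\<close> is an isomorphism onto \<open>M\<close>.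
\<close>

locale pullback =
  fixes M :: "'a set_structure" and h :: "'b \<Rightarrow> 'a"
  assumes bij: "bij_betw h UNIV (univ M)"
begin

definition N :: "'b set_structure" where
  "N = \<lparr>univ = UNIV, mem = (\<lambda>x y. mem M (h x) (h y))\<rparr>"

lemma N_simps [simp]: "univ N = UNIV" "mem N x y \<longleftrightarrow> mem M (h x) (h y)"
  by (simp_all add: N_def)

lemma ball_univ: "(\<forall>x\<in>univ M. P x) \<longleftrightarrow> (\<forall>x. P (h x))"
  using bij_betw_imp_surj_on[OF bij] by (metis UNIV_I imageE imageI)

lemma bex_univ: "(\<exists>x\<in>univ M. P x) \<longleftrightarrow> (\<exists>x. P (h x))"
  using bij_betw_imp_surj_on[OF bij] by (metis UNIV_I imageE imageI)

lemma h_univ [simp]: "h x \<in> univ M"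
  using bij_betw_imp_surj_on[OF bij] by blast

lemma h_eq [simp]: "h x = h y \<longleftrightarrow> x = y"
  using bij_betw_imp_inj_on[OF bij] by (simp add: inj_eq)

lemma subset_in_N [simp]: "subset_in N x y \<longleftrightarrow> subset_in M (h x) (h y)"
  by (simp add: subset_in_def ball_univ)

lemma sat_N: "sat N v \<phi> = sat M (h \<circ> v) \<phi>"
  by (induction \<phi> arbitrary: v) (simp_all add: bex_univ fun_upd_comp)

lemma assignment_M: "assignment M (h \<circ> v)"
  by (auto simp: assignment_def)

lemma separation_N:
  assumes "separation M \<Gamma>" shows "separation N \<Gamma>"
  unfolding separation_def
proof (intro ballI allI impI)
  fix \<phi> v a x assume "\<phi> \<in> \<Gamma>"
  then have "\<exists>y\<in>univ M. \<forall>u\<in>univ M. mem M u y \<longleftrightarrow> mem M u (h x) \<and> sat M ((h \<circ> v)(a := u)) \<phi>"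
    using assms assignment_M unfolding separation_def by (simp add: ball_univ)
  then show "\<exists>y\<in>univ N. \<forall>u\<in>univ N. mem N u y \<longleftrightarrow> mem N u x \<and> sat N (v(a := u)) \<phi>"
    by (simp add: ball_univ bex_univ sat_N fun_upd_comp)
qed

lemma collection_N:
  assumes "collection M \<Gamma>" shows "collection N \<Gamma>"
  unfolding collection_def
proof (intro ballI allI impI)
  fix \<phi> v and a b :: nat and x assume *: "\<phi> \<in> \<Gamma>" "a \<noteq> b"
    and "\<forall>u\<in>univ N. mem N u x \<longrightarrow> (\<exists>w\<in>univ N. sat N (v(a := u, b := w)) \<phi>)"
  then have "\<forall>u\<in>univ M. mem M u (h x) \<longrightarrow> (\<exists>w\<in>univ M. sat M ((h \<circ> v)(a := u, b := w)) \<phi>)"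
    by (simp add: ball_univ bex_univ sat_N fun_upd_comp)
  then have "\<exists>y\<in>univ M. \<forall>u\<in>univ M. mem M u (h x) \<longrightarrow>
      (\<exists>w\<in>univ M. mem M w y \<and> sat M ((h \<circ> v)(a := u, b := w)) \<phi>)"
    using assms * assignment_M h_univ unfolding collection_def by blast
  then show "\<exists>y\<in>univ N. \<forall>u\<in>univ N. mem N u x \<longrightarrow>
      (\<exists>w\<in>univ N. mem N w y \<and> sat N (v(a := u, b := w)) \<phi>)"
    by (simp add: ball_univ bex_univ sat_N fun_upd_comp)
qed

lemma foundation_N:
  assumes "foundation M \<Gamma>" shows "foundation N \<Gamma>"
  unfolding foundation_def
proof (intro ballI allI impI)
  fix \<phi> v a assume *: "\<phi> \<in> \<Gamma>" and "\<exists>x\<in>univ N. sat N (v(a := x)) \<phi>"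
  then have "\<exists>x\<in>univ M. sat M ((h \<circ> v)(a := x)) \<phi>"
    by (simp add: bex_univ sat_N fun_upd_comp)
  then have "\<exists>y\<in>univ M. sat M ((h \<circ> v)(a := y)) \<phi> \<and>
      (\<forall>u\<in>univ M. mem M u y \<longrightarrow> \<not> sat M ((h \<circ> v)(a := u)) \<phi>)"
    using assms * assignment_M unfolding foundation_def by blast
  then show "\<exists>y\<in>univ N. sat N (v(a := y)) \<phi> \<and> (\<forall>u\<in>univ N. mem N u y \<longrightarrow> \<not> sat N (v(a := u)) \<phi>)"
    by (simp add: ball_univ bex_univ sat_N fun_upd_comp)
qed

lemma models_N:
  assumes "models_KP_P M" shows "models_KP_P N"
proof -
  have "extensionality N" "pairing N" "union_axiom N" "powerset N" "infinity N"
    using assms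
    by (simp_all add: models_KP_P_def extensionality_def pairing_def is_upair_def union_axiom_def
        powerset_def infinity_def ball_univ bex_univ)
  then show ?thesis
    using assms separation_N collection_N foundation_N by (simp add: models_KP_P_def)
qed

lemma Ord_N: "x \<in> Ord N \<longleftrightarrow> h x \<in> Ord M"
  by (simp add: Ord_def transitive_in_def ball_univ)

lemma maps_to_N: "maps_to N f x y \<longleftrightarrow> maps_to M (h f) (h x) (h y)"
  by (simp add: maps_to_def is_pair_def is_upair_def ball_univ bex_univ)

lemma is_rank_function_N: "is_rank_function N f \<longleftrightarrow> is_rank_function M (h f)"
  by (simp add: is_rank_function_def is_function_def maps_to_N is_pair_def is_upair_def ball_univ bex_univ)

text \<open>
  The rank is a definite description, so the isomorphism respects it only because the
  description is known to be proper.
\<close>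

lemma rank_N:
  assumes "models_KP_P M" "separation M (Sigma_P 1)" shows "rank M (h x) = h (rank N x)"
proof -
  interpret N: set_model N
    by unfold_locales (rule N_simps models_N[OF assms(1)] separation_N[OF assms(2)])+
  let ?P = "\<lambda>\<alpha>. \<exists>f. is_rank_function N f \<and> maps_to N f x \<alpha>"
  have ex1: "\<exists>!\<alpha>. ?P \<alpha>" using N.rank_unique_ex[of x] by simp
  have r: "rank N x = (THE \<alpha>. ?P \<alpha>)" by (simp add: rank_def)
  have *: "h \<alpha> \<in> univ M \<and> (\<exists>f\<in>univ M. is_rank_function M f \<and> maps_to M f (h x) (h \<alpha>)) \<longleftrightarrow> ?P \<alpha>" for \<alpha>
    by (simp add: bex_univ is_rank_function_N maps_to_N)
  show ?thesis unfolding rank_def[of M]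
  proof (rule the_equality)
    show "h (rank N x) \<in> univ M \<and> (\<exists>f\<in>univ M. is_rank_function M f \<and> maps_to M f (h x) (h (rank N x)))"
      unfolding * r by (rule theI'[OF ex1])
    fix \<alpha> assume a: "\<alpha> \<in> univ M \<and> (\<exists>f\<in>univ M. is_rank_function M f \<and> maps_to M f (h x) \<alpha>)"
    then obtain \<beta> where \<beta>: "\<alpha> = h \<beta>" using bij_betw_imp_surj_on[OF bij] by blast
    with a have "?P \<beta>" using * by blast
    then show "\<alpha> = h (rank N x)" unfolding \<beta> r using the1_equality[OF ex1] by simp
  qed
qed

lemma ord_le_N: "ord_le N x y \<longleftrightarrow> ord_le M (h x) (h y)"
  by (simp add: ord_le_def)

end

theorem corollary5p2p8:
  fixes M S :: "'a set_structure"
  assumes "models_KP_P M"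
    and "separation M (Sigma_P 1)"
    and "countable (univ M)"
    and "nonstandard M"
    and "substructure S M"
    and "rank_initial S M id"
    and "topless S M id"
  shows "\<exists>i. embedding M M i \<and> rank_initial M M i \<and> topless M M i \<and>
    i ` univ M \<noteq> univ M \<and>
    (\<forall>s\<in>univ S. i s = s) \<and>
    (\<forall>\<alpha> \<in> Ord M - univ S. \<exists>m\<in>univ M. rank M m = \<alpha> \<and> i m \<noteq> m)"
proof -
  obtain h :: "nat \<Rightarrow> 'a" where h: "bij_betw h UNIV (univ M)"
    using bij_betw_from_nat_into[OF assms(3) infinite_univ[OF assms(1)]] by (rule that)
  interpret pullback M h by unfold_locales (rule h)
  note rank = rank_N[OF assms(1,2)]
  define I where "I = h -` univ S"
  have SM: "univ S \<subseteq> univ M" using assms(5) by (simp add: substructure_def)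
  have I: "h x \<in> univ S \<longleftrightarrow> x \<in> I" for x by (simp add: I_def)
  have surj: "\<exists>x'. x = h x'" if "x \<in> univ M" for x
    using bij_betw_imp_surj_on[OF h] that by blast
  have ball_S: "(\<forall>m\<in>univ S. P m) \<longleftrightarrow> (\<forall>m\<in>I. P (h m))" for P
    using I surj SM by blast
  have bex_S: "(\<exists>m\<in>univ S. P m) \<longleftrightarrow> (\<exists>m\<in>I. P (h m))" for P
    using I surj SM by blast
  have Ord_M: "Ord M \<subseteq> univ M" by (auto simp: Ord_def)
  have ball_Ord: "(\<forall>\<alpha>\<in>Ord M - A. P \<alpha>) \<longleftrightarrow> (\<forall>\<alpha>\<in>Ord N - h -` A. P (h \<alpha>))" for P A
    using Ord_N surj Ord_M by blast
  have bex_Ord: "(\<exists>\<alpha>\<in>Ord M - A. P \<alpha>) \<longleftrightarrow> (\<exists>\<alpha>\<in>Ord N - h -` A. P (h \<alpha>))" for P A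
    using Ord_N surj Ord_M by blast
  have bex_Ord': "(\<exists>\<alpha>\<in>Ord M. P \<alpha>) \<longleftrightarrow> (\<exists>\<alpha>\<in>Ord N. P (h \<alpha>))" for P
    using bex_Ord[of "{}" P] by simp
  interpret N: set_model N
    by unfold_locales (rule N_simps models_N[OF assms(1)] separation_N[OF assms(2)])+
  interpret N: rank_cut N I
  proof unfold_locales
    show "n \<in> I" if "m \<in> I" "ord_le N (rank N n) (rank N m)" for m n
      using assms(6) that unfolding rank_initial_def
      by (simp add: ball_univ bex_S rank ord_le_N I) blast
    show "\<exists>\<alpha>\<in>Ord N. \<forall>m\<in>I. rank N m \<in> N.elts \<alpha>"
      using assms(7) unfolding topless_def
      by (simp add: bex_Ord' ball_S rank flip: N.mem_iff)
    show "\<not> (\<exists>\<beta>\<in>Ord N - I. \<forall>\<gamma>\<in>Ord N - I. ord_le N \<beta> \<gamma>)"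
      using assms(7) unfolding topless_def
      by (simp add: bex_Ord ball_Ord ord_le_N I_def)
  qed
  obtain j where j0: "\<forall>x y. j x \<in> N.elts (j y) \<longleftrightarrow> x \<in> N.elts y" "inj j"
    "\<forall>x y. N.elts (rank N y) \<subseteq> N.elts (rank N (j x)) \<longrightarrow> y \<in> range j"
    "\<forall>s\<in>I. j s = s" "\<forall>\<alpha>\<in>Ord N - I. \<exists>m. rank N m = \<alpha> \<and> j m \<noteq> m"
    "\<exists>\<beta>\<in>Ord N. \<forall>x. rank N (j x) \<in> N.elts \<beta>"
    "\<not> (\<exists>\<nu>\<in>Ord N - range j. \<forall>\<gamma>\<in>Ord N - range j. ord_le N \<nu> \<gamma>)"
    using N.proper_topless_self_embedding[OF countableI_type] by (elim exE conjE) (rule that)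
  note j = j0(1)[rule_format] j0(2) j0(3)[rule_format] j0(4)[rule_format] j0(5)[rule_format] j0(6,7)
  define i where "i = h \<circ> j \<circ> Hilbert_Choice.inv h"
  have i: "i (h x) = h (j x)" for x
    using bij_betw_imp_inj_on[OF h] by (simp add: i_def)
  have image_i: "h x \<in> i ` univ M \<longleftrightarrow> x \<in> range j" for x
    using bex_univ[of "\<lambda>y. h x = i y"] by (simp add: image_iff i)
  then have vimage_i: "h -` (i ` univ M) = range j" by blast
  have "embedding M M i"
    unfolding embedding_def
  proof (intro conjI)
    show "i ` univ M \<subseteq> univ M" using ball_univ[of "\<lambda>x. i x \<in> univ M"] i by auto
    show "inj_on i (univ M)" unfolding inj_on_def ball_univ i using j(2) by (simp add: inj_eq)
    show "\<forall>x\<in>univ M. \<forall>y\<in>univ M. mem M (i x) (i y) \<longleftrightarrow> mem M x y"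
      unfolding ball_univ i using j(1) by (simp flip: N.mem_iff)
  qed
  moreover have "rank_initial M M i"
    unfolding rank_initial_def ball_univ bex_univ image_i rank i ord_le_N[symmetric]
    using j(3) N.ord_le_iff[OF N.Ord_rank N.Ord_rank] by blast
  moreover have bound: "\<exists>\<alpha>\<in>Ord M. \<forall>m\<in>univ M. mem M (rank M (i m)) \<alpha>"
    using j(6) unfolding bex_Ord' ball_univ i rank by (simp flip: N.mem_iff)
  moreover have "\<not> (\<exists>\<beta>\<in>Ord M - i ` univ M. \<forall>\<gamma>\<in>Ord M - i ` univ M. ord_le M \<beta> \<gamma>)"
    unfolding bex_Ord ball_Ord vimage_i using j(7) by (simp add: ord_le_N)
  moreover have "i ` univ M \<noteq> univ M"
  proof
    assume *: "i ` univ M = univ M"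
    obtain \<beta> where \<beta>: "\<beta> \<in> Ord N" "\<And>x. rank N (j x) \<in> N.elts \<beta>" using j(6) by blast
    obtain x where "\<beta> = j x" using image_i[of \<beta>] * by auto
    with \<beta> N.rank_Ord N.mem_irrefl show False by metis
  qed
  moreover have "\<forall>s\<in>univ S. i s = s" using j(4) by (simp add: ball_S i)
  moreover have "\<forall>\<alpha>\<in>Ord M - univ S. \<exists>m\<in>univ M. rank M m = \<alpha> \<and> i m \<noteq> m"
    unfolding ball_Ord bex_univ rank i using j(5) by (simp add: I_def)
  ultimately show ?thesis unfolding topless_def by blast
qed

end
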